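(* Under the setting in the context (null log-linear model true), for any admissible $\phi_1,\phi_2$, \[ \frac{T^{\phi_1}(\boldsymbol{Y},\widehat{\boldsymbol{\theta}}_{\phi_2})}{\widetilde{\vartheta}_{n,N,\phi_2}}\xrightarrow[N\to\infty]{\mathcal{L}}\chi^2_{M-M_0-1},\qquad T^{\phi_1}(\boldsymbol{Y},\widehat{\boldsymbol{\theta}}_{\phi_2})=\frac{2nN}{\phi_1''(1)}d_{\phi_1}\big(\widehat{\boldsymbol{p}},\boldsymbol{p}(\widehat{\boldsymbol{\theta}}_{\phi_2})\big). \]
   Context: Let $M\ge 3$ and $1\le M_0<M-1$. Let $\boldsymbol{W}$ be a real $M\times M_0$ matrix of full column rank whose columns, together with $\boldsymbol{1}_M=(1,\dots,1)^T$, are linearly independent. For $\boldsymbol{\theta}\in\mathbb{R}^{M_0}$ define $\boldsymbol{p}(\boldsymbol{\theta})=\exp\{\boldsymbol{W}\boldsymbol{\theta}\}/(\boldsymbol{1}_M^T\exp\{\boldsymbol{W}\boldsymbol{\theta}\})$. For a probability vector $\boldsymbol{p}$, $\boldsymbol{D}_{\boldsymbol{p}}=\mathrm{diag}(\boldsymbol{p})$ and $\boldsymbol{\Sigma}_{\boldsymbol{p}}=\boldsymbol{D}_{\boldsymbol{p}}-\boldsymbol{p}\boldsymbol{p}^T$. Data (equal cluster sizes): $N$ clusters of size $n\ge 2$; cluster frequency vectors $\boldsymbol{Y}^{(\ell)}$, $\ell=1,\dots,N$, i.i.d. with nonnegative integer entries summing to $n$, $\mathrm{E}[\boldsymbol{Y}^{(\ell)}]=n\boldsymbol{p}(\boldsymbol{\theta}_0)$,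 $\mathrm{Var}[\boldsymbol{Y}^{(\ell)}]=\vartheta_n n\boldsymbol{\Sigma}_{\boldsymbol{p}(\boldsymbol{\theta}_0)}$, $\vartheta_n=1+(n-1)\rho^2$, $\rho^2\ge0$, $\boldsymbol{\theta}_0$ the unknown true parameter. $\widehat{\boldsymbol{p}}^{(\ell)}=\boldsymbol{Y}^{(\ell)}/n$, $\widehat{\boldsymbol{p}}=\frac1{nN}\sum_\ell\boldsymbol{Y}^{(\ell)}$. Admissible $\phi:(0,\infty)\to\mathbb{R}$: convex, twice continuously differentiable, $\phi(1)=\phi'(1)=0$, $\phi''(1)>0$, conventions $0\phi(0/0)=0$, $0\phi(p/0)=p\lim_{u\to\infty}\phi(u)/u$; $d_\phi(\boldsymbol{p},\boldsymbol{q})=\sum_r q_r\phi(p_r/q_r)$; QM$\phi$E $\widehat{\boldsymbol{\theta}}_\phi=\arg\min_{\boldsymbol{\theta}}d_\phi(\widehat{\boldsymbol{p}},\boldsymbol{p}(\boldsymbol{\theta}))$. Semi-parametric design effect estimator: $\widetilde{\vartheta}_{n,N,\phi}=X^2(\widetilde{\boldsymbol{Y}},\widehat{\boldsymbol{\theta}}_\phi)/((N-1)(M-1))$ with $X^2(\widetilde{\boldsymbol{Y}},\widehat{\boldsymbol{\theta}}_\phi)=n\sum_{\ell=1}^N\sum_{r=1}^M(\widehat{p}^{(\ell)}_r-\widehat{p}_r)^2/p_r(\widehat{\boldsymbol{\theta}}_\phi)$. *)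

theory Defs
  imports "HOL-Probability.Probability"
begin

(* Vectors are functions nat => real; only the indices r < M (categories) and
   j < M0 (parameters) are used. *)

definition loglin_p :: "nat \<Rightarrow> nat \<Rightarrow> (nat \<Rightarrow> nat \<Rightarrow> real) \<Rightarrow> (nat \<Rightarrow> real) \<Rightarrow> nat \<Rightarrow> real" where
  "loglin_p M M0 W \<theta> r =
     exp (\<Sum>j<M0. W r j * \<theta> j) / (\<Sum>s<M. exp (\<Sum>j<M0. W s j * \<theta> j))"

definition admissible_phi :: "(real \<Rightarrow> real) \<Rightarrow> bool" where
  "admissible_phi \<phi> \<longleftrightarrow>
     convex_on {0<..} \<phi> \<and>
     (\<forall>u>0. \<phi> differentiable (at u) \<and> deriv \<phi> differentiable (at u)) \<and>
     continuous_on {0<..} (deriv (deriv \<phi>)) \<and>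
     \<phi> 1 = 0 \<and> deriv \<phi> 1 = 0 \<and> deriv (deriv \<phi>) 1 > 0"

(* phi-divergence d_phi(p,q) = sum_r q_r phi(p_r/q_r), with the conventions
   0 phi(0/0) = 0, 0 phi(p/0) = p lim_{u->oo} phi(u)/u, and q phi(0/q) = q phi(0+)
   (phi(0) understood as the limit at 0+, possibly +oo); values in ereal. *)
definition phi_div :: "nat \<Rightarrow> (real \<Rightarrow> real) \<Rightarrow> (nat \<Rightarrow> real) \<Rightarrow> (nat \<Rightarrow> real) \<Rightarrow> ereal" where
  "phi_div M \<phi> p q =
     (\<Sum>r<M. if q r = 0 then
                (if p r = 0 then 0 else ereal (p r) * Lim at_top (\<lambda>u. ereal (\<phi> u / u)))
              else if p r = 0 then ereal (q r) * Lim (at_right 0) (\<lambda>u. ereal (\<phi> u))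
              else ereal (q r * \<phi> (p r / q r)))"

definition chi2_density :: "nat \<Rightarrow> real \<Rightarrow> real" where
  "chi2_density k x =
     (if x \<le> 0 then 0
      else x powr (real k / 2 - 1) * exp (- x / 2) / (2 powr (real k / 2) * Gamma (real k / 2)))"

definition chi2_distribution :: "nat \<Rightarrow> real measure" where
  "chi2_distribution k = density lborel (\<lambda>x. ennreal (chi2_density k x))"

end

theory Submission
  imports Defs "HOL-Real_Asymp.Real_Asymp"
begin

text \<open>
  Write \<open>x = (p - p\<^sub>0) / sqrt p\<^sub>0\<close> for the observed relative frequencies \<open>p\<close> and let
  \<open>e\<close> be an orthonormal basis of the orthogonal complement of the span of \<open>sqrt p\<^sub>0\<close> and the
  columns \<open>sqrt p\<^sub>0 * W\<^sub>j\<close>; it has \<open>M - M0 - 1\<close> elements.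

  Deterministically, for every \<open>p\<close> near \<open>p\<^sub>0\<close> and every minimiser \<open>\<theta>\<close> of the
  \<open>\<phi>2\<close>-divergence, the normalised \<open>\<phi>1\<close>-divergence of \<open>p\<close> from \<open>p(\<theta>)\<close> is
  the squared length of the \<open>e\<close>-component of \<open>x\<close> up to \<open>o(|x|\<^sup>2)\<close>. No likelihood equations
  are needed: both divergences are quadratic near the diagonal, a global quadratic lower bound keeps
  \<open>p(\<theta>)\<close> within a multiple of \<open>|x|\<close> from \<open>p\<^sub>0\<close>, linearising \<open>ln (p(\<theta>) / p\<^sub>0)\<close> gives the
  lower bound, and comparison with the parameter suggested by the linear model gives the upper bound.

  The \<open>e\<close>-component of \<open>x\<close> is a normalised sum of i.i.d. vectors with scalar covariance. The Laplace
  transform of its squared length is an average of characteristic functions over an independent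
  Gaussian vector, so the univariate central limit theorem identifies the limit, and Laplace
  transforms at the integers determine weak convergence of nonnegative variables. The design effect
  estimator is consistent by the law of large numbers.
\<close>

section \<open>Orthonormal complements\<close>

text \<open>The estimator is constrained only where the divergence has a minimiser, and empty cells
  can make the divergence infinite. The deterministic estimates are therefore pathwise and uniform
  over all \<open>p\<close> near \<open>p0\<close> and all minimisers. Probability enters only
  through two kinds of events: \<open>N\<close> times the squared distance of the relative
  frequencies from \<open>p0\<close> is at most \<open>R\<close>, and averaged squares are near
  their means. For large \<open>N\<close> a minimiser exists on these events, and an error of order
  \<open>o(|x|^2)\<close> stays negligible after multiplication by \<open>n * N\<close>.

  One weighted distance with denominators frozen at \<open>p0\<close> replaces every divergence:
  after division by the second derivative at 1 all admissible functions have the same quadratic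
  part, so \<open>\<phi>1\<close> and \<open>\<phi>2\<close> need not be related. The logarithm of
  \<open>p(\<theta>) / p0\<close> is an exact linear combination of score vectors, so all curvature
  sits in the difference between \<open>t\<close> and \<open>ln (1 + t)\<close>.

  The covariance of one scaled cluster deviation is \<open>design / n\<close> times the identity
  minus the projection on \<open>sqrt p0\<close>. As \<open>e\<close> is orthogonal to
  \<open>sqrt p0\<close>, only the factor \<open>design / n\<close> remains, and the estimated
  design effect removes \<open>design\<close> in the limit.\<close>

definition inner_upto :: "nat \<Rightarrow> (nat \<Rightarrow> real) \<Rightarrow> (nat \<Rightarrow> real) \<Rightarrow> real" where
  "inner_upto M x y = (\<Sum>r<M. x r * y r)"

text \<open>The dimension \<open>M\<close> is a term, so vectors are functions whose values from
  \<open>M\<close> on are ignored; two vectors count as equal when they agree below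
  \<open>M\<close>.\<close>

definition orthonormal_upto :: "nat \<Rightarrow> nat \<Rightarrow> (nat \<Rightarrow> nat \<Rightarrow> real) \<Rightarrow> bool" where
  "orthonormal_upto M k f \<longleftrightarrow> (\<forall>i<k. \<forall>j<k. inner_upto M (f i) (f j) = (if i = j then 1 else 0))"

lemma inner_upto_commute: "inner_upto M x y = inner_upto M y x"
  by (simp add: inner_upto_def mult.commute)

lemma inner_upto_add_right: "inner_upto M x (\<lambda>r. y r + z r) = inner_upto M x y + inner_upto M x z"
  by (simp add: inner_upto_def algebra_simps sum.distrib)

lemma inner_upto_diff_right: "inner_upto M x (\<lambda>r. y r - z r) = inner_upto M x y - inner_upto M x z"
  by (simp add: inner_upto_def algebra_simps sum_subtractf)

lemma inner_upto_scale_right: "inner_upto M x (\<lambda>r. c * y r) = c * inner_upto M x y"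
  by (simp add: inner_upto_def algebra_simps sum_distrib_left)

lemma inner_upto_sum_right:
  "inner_upto M x (\<lambda>r. \<Sum>i\<in>I. c i * y i r) = (\<Sum>i\<in>I. c i * inner_upto M x (y i))"
  unfolding inner_upto_def sum_distrib_left
  by (subst sum.swap) (simp add: algebra_simps)

lemma inner_upto_cong:
  "(\<And>r. r < M \<Longrightarrow> x r = x' r) \<Longrightarrow> (\<And>r. r < M \<Longrightarrow> y r = y' r) \<Longrightarrow> inner_upto M x y = inner_upto M x' y'"
  by (simp add: inner_upto_def)

lemma inner_upto_self_nonneg: "0 \<le> inner_upto M x x"
  by (simp add: inner_upto_def sum_nonneg)

lemma inner_upto_self_eq_0: "inner_upto M x x = 0 \<longleftrightarrow> (\<forall>r<M. x r = 0)"
  by (auto simp: inner_upto_def sum_nonneg_eq_0_iff)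

lemma inner_upto_self: "inner_upto M x x = (L2_set x {..<M})\<^sup>2"
  by (simp add: inner_upto_def L2_set_def sum_nonneg power2_eq_square)

lemma abs_inner_upto_le: "\<bar>inner_upto M x y\<bar> \<le> L2_set x {..<M} * L2_set y {..<M}"
proof -
  have "\<bar>inner_upto M x y\<bar> \<le> (\<Sum>r<M. \<bar>x r\<bar> * \<bar>y r\<bar>)"
    unfolding inner_upto_def by (rule order_trans[OF sum_abs]) (simp add: abs_mult)
  then show ?thesis using L2_set_mult_ineq[of x y "{..<M}"] by linarith
qed

definition residual :: "nat \<Rightarrow> nat \<Rightarrow> (nat \<Rightarrow> nat \<Rightarrow> real) \<Rightarrow> (nat \<Rightarrow> real) \<Rightarrow> nat \<Rightarrow> real" where
  "residual M k f x r = x r - (\<Sum>i<k. inner_upto M (f i) x * f i r)"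

lemma residual_orthogonal:
  assumes "orthonormal_upto M k f" "i < k"
  shows "inner_upto M (f i) (residual M k f x) = 0"
proof -
  have "(\<Sum>j<k. inner_upto M (f j) x * inner_upto M (f i) (f j)) = inner_upto M (f i) x"
    using assms by (subst sum.cong[OF refl, where h="\<lambda>j. if j = i then inner_upto M (f j) x else 0"])
       (auto simp: orthonormal_upto_def)
  then show ?thesis
    unfolding residual_def[abs_def] by (simp add: inner_upto_diff_right inner_upto_sum_right)
qed

lemma residual_pythagoras:
  assumes "orthonormal_upto M k f"
  shows "inner_upto M (residual M k f x) (residual M k f x)
           = inner_upto M x x - (\<Sum>i<k. (inner_upto M (f i) x)\<^sup>2)"
proof -
  let ?w = "residual M k f x"
  have "inner_upto M ?w ?w = inner_upto M ?w x - (\<Sum>i<k. inner_upto M (f i) x * inner_upto M ?w (f i))"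
    by (subst (2) residual_def[abs_def]) (simp add: inner_upto_diff_right inner_upto_sum_right)
  also have "(\<Sum>i<k. inner_upto M (f i) x * inner_upto M ?w (f i)) = 0"
    using residual_orthogonal[OF assms] by (intro sum.neutral) (simp add: inner_upto_commute)
  also have "inner_upto M ?w x = inner_upto M x ?w" by (rule inner_upto_commute)
  also have "\<dots> = inner_upto M x x - (\<Sum>i<k. inner_upto M (f i) x * inner_upto M x (f i))"
    unfolding residual_def[abs_def] by (simp add: inner_upto_diff_right inner_upto_sum_right)
  finally show ?thesis by (simp add: power2_eq_square inner_upto_commute)
qed

lemma bessel_upto:
  assumes "orthonormal_upto M k f"
  shows "(\<Sum>i<k. (inner_upto M (f i) x)\<^sup>2) \<le> inner_upto M x x"
  using residual_pythagoras[OF assms, of x] inner_upto_self_nonneg[of M "residual M k f x"] by linarith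

definition unit_fun :: "nat \<Rightarrow> nat \<Rightarrow> real" where
  "unit_fun s r = (if r = s then 1 else 0)"

lemma inner_unit_fun: "s < M \<Longrightarrow> inner_upto M x (unit_fun s) = x s"
  by (simp add: inner_upto_def unit_fun_def if_distrib cong: if_cong)

text \<open>The trace of the orthogonal projection onto the complement of \<open>k\<close> orthonormal vectors.\<close>

lemma sum_residual_unit_fun:
  assumes "orthonormal_upto M k f"
  shows "(\<Sum>s<M. inner_upto M (residual M k f (unit_fun s)) (residual M k f (unit_fun s)))
           = real M - real k"
proof -
  have "(\<Sum>s<M. inner_upto M (residual M k f (unit_fun s)) (residual M k f (unit_fun s)))
        = (\<Sum>s<M. 1 - (\<Sum>i<k. (f i s)\<^sup>2))"
    by (intro sum.cong refl)
       (simp add: residual_pythagoras[OF assms] inner_unit_fun, simp add: unit_fun_def)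
  also have "\<dots> = real M - (\<Sum>i<k. \<Sum>s<M. (f i s)\<^sup>2)"
    by (simp add: sum_subtractf) (rule sum.swap)
  also have "(\<Sum>i<k. \<Sum>s<M. (f i s)\<^sup>2) = (\<Sum>i<k. 1)"
    using assms by (intro sum.cong refl) (auto simp: orthonormal_upto_def inner_upto_def power2_eq_square)
  finally show ?thesis by simp
qed

lemma orthonormal_upto_Suc:
  assumes "orthonormal_upto M k f" and "inner_upto M w w > 0"
    and "\<And>i. i < k \<Longrightarrow> inner_upto M (f i) w = 0"
  shows "orthonormal_upto M (Suc k) (f(k := (\<lambda>r. (1 / sqrt (inner_upto M w w)) * w r)))"
proof -
  let ?c = "1 / sqrt (inner_upto M w w)"
  have 1: "inner_upto M (\<lambda>r. ?c * w r) (\<lambda>r. ?c * w r) = 1"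
    using assms(2) by (simp only: inner_upto_scale_right inner_upto_commute[of M "\<lambda>r. ?c * w r"])
       (simp add: real_div_sqrt)
  have 2: "inner_upto M (f i) (\<lambda>r. ?c * w r) = 0" if "i < k" for i
    using assms(3)[OF that] by (simp add: inner_upto_scale_right del: times_divide_eq_left)
  have 3: "inner_upto M (\<lambda>r. ?c * w r) (f i) = 0" if "i < k" for i
    using 2[OF that] by (simp add: inner_upto_commute)
  show ?thesis
    unfolding orthonormal_upto_def
  proof (intro allI impI)
    fix i j assume "i < Suc k" "j < Suc k"
    then consider "i = k" "j = k" | "i = k" "j < k" | "i < k" "j = k" | "i < k" "j < k" by linarith
    then show "inner_upto M ((f(k := \<lambda>r. ?c * w r)) i) ((f(k := \<lambda>r. ?c * w r)) j) = (if i = j then 1 else 0)"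
      using assms(1) by cases (simp_all only: fun_upd_same fun_upd_other 1 2 3 less_irrefl, auto simp: 1 2 3 orthonormal_upto_def)
  qed
qed

text \<open>By the trace identity the residuals of the \<open>M\<close> unit vectors have total
  squared length \<open>M - k > 0\<close>, so one of them is nonzero and can be normalised.\<close>

lemma orthonormal_extend_one:
  assumes "orthonormal_upto M k f" and "k < M"
  obtains w where "orthonormal_upto M (Suc k) (f(k := w))"
proof -
  have "\<exists>s<M. inner_upto M (residual M k f (unit_fun s)) (residual M k f (unit_fun s)) > 0"
  proof (rule ccontr)
    assume "\<not> ?thesis"
    then have "(\<Sum>s<M. inner_upto M (residual M k f (unit_fun s)) (residual M k f (unit_fun s))) \<le> 0"
      by (intro sum_nonpos) force
    then show False using sum_residual_unit_fun[OF assms(1)] assms(2) by simp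
  qed
  then show ?thesis using that orthonormal_upto_Suc[OF assms(1) _ residual_orthogonal[OF assms(1)]] by blast
qed

lemma orthonormal_extend:
  assumes "orthonormal_upto M k f" and "k \<le> m" "m \<le> M"
  shows "\<exists>g. orthonormal_upto M m g \<and> (\<forall>i<k. g i = f i)"
  using assms(2,3)
proof (induction m rule: dec_induct)
  case base
  then show ?case using assms(1) by blast
next
  case (step m)
  then obtain g where g: "orthonormal_upto M m g" "\<forall>i<k. g i = f i" by auto
  from step obtain w where "orthonormal_upto M (Suc m) (g(m := w))"
    using orthonormal_extend_one[OF g(1)] by (metis Suc_le_lessD)
  moreover have "\<forall>i<k. (g(m := w)) i = f i" using g(2) step.hyps by simp
  ultimately show ?case by blast
qed

text \<open>With \<open>M\<close> orthonormal vectors the trace is 0, so every unit vector equals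
  its own projection; pairing \<open>x\<close> with this identity gives the expansion.\<close>

lemma orthonormal_expansion:
  assumes "orthonormal_upto M M f" and "s < M"
  shows "x s = (\<Sum>i<M. inner_upto M (f i) x * f i s)"
proof -
  have "inner_upto M (residual M M f (unit_fun s)) (residual M M f (unit_fun s)) = 0"
    using sum_residual_unit_fun[OF assms(1)] assms(2)
    by (simp add: sum_nonneg_eq_0_iff inner_upto_self_nonneg)
  then have "\<forall>r<M. unit_fun s r = (\<Sum>i<M. f i s * f i r)"
    unfolding inner_upto_self_eq_0 by (simp add: residual_def inner_unit_fun assms(2))
  then have "inner_upto M x (unit_fun s) = inner_upto M x (\<lambda>r. \<Sum>i<M. f i s * f i r)"
    by (intro inner_upto_cong) auto
  then show ?thesis using assms(2)
    by (simp add: inner_unit_fun inner_upto_sum_right) (simp add: inner_upto_commute mult.commute)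
qed

section \<open>Gram-Schmidt and dual bases\<close>

definition independent_upto :: "nat \<Rightarrow> nat \<Rightarrow> (nat \<Rightarrow> nat \<Rightarrow> real) \<Rightarrow> bool" where
  "independent_upto M k a \<longleftrightarrow>
     (\<forall>c. (\<forall>r<M. (\<Sum>j<k. c j * a j r) = 0) \<longrightarrow> (\<forall>j<k. c j = 0))"

lemma independent_uptoD:
  assumes "independent_upto M k a" and "\<And>r. r < M \<Longrightarrow> (\<Sum>j<k. c j * a j r) = 0" and "j < k"
  shows "c j = 0"
  using assms unfolding independent_upto_def by blast

text \<open>Both coefficient matrices are recorded because both are needed later: \<open>R\<close>
  transfers orthogonality from \<open>f\<close> to \<open>a\<close>, and \<open>S\<close> produces
  the vectors dual to \<open>a\<close>.\<close>

lemma gram_schmidt_upto: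
  assumes "independent_upto M k a"
  shows "\<exists>f S R. orthonormal_upto M k f \<and>
           (\<forall>i<k. \<forall>r<M. f i r = (\<Sum>j<k. S i j * a j r)) \<and>
           (\<forall>j<k. \<forall>r<M. a j r = (\<Sum>i<k. R j i * f i r))"
  using assms
proof (induction k)
  case 0
  then show ?case by (simp add: orthonormal_upto_def)
next
  case (Suc k)
  have "independent_upto M k a"
    unfolding independent_upto_def
  proof (intro allI impI)
    fix c j assume c: "\<forall>r<M. (\<Sum>j<k. c j * a j r) = 0" and "j < k"
    then have "\<forall>r<M. (\<Sum>j<Suc k. (c(k := 0)) j * a j r) = 0" by simp
    then have "(c(k := 0)) j = 0" using \<open>j < k\<close>
      using independent_uptoD[OF Suc.prems, of "c(k := 0)" j] by auto
    then show "c j = 0" using \<open>j < k\<close> by simp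
  qed
  from Suc.IH[OF this] obtain f S R where fSR: "orthonormal_upto M k f \<and>
           (\<forall>i<k. \<forall>r<M. f i r = (\<Sum>j<k. S i j * a j r)) \<and>
           (\<forall>j<k. \<forall>r<M. a j r = (\<Sum>i<k. R j i * f i r))"
    by blast
  then have f: "orthonormal_upto M k f" by simp
  from fSR have S: "\<And>i r. i < k \<Longrightarrow> r < M \<Longrightarrow> f i r = (\<Sum>j<k. S i j * a j r)" by blast
  from fSR have R: "\<And>j r. j < k \<Longrightarrow> r < M \<Longrightarrow> a j r = (\<Sum>i<k. R j i * f i r)" by blast
  define w where "w = residual M k f (a k)"
  \<comment> \<open>The projection of \<open>a k\<close> rewritten in terms of the earlier
    \<open>a j\<close>: this exhibits \<open>w\<close> as a combination of \<open>a\<close> with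
    coefficient 1 at \<open>k\<close>, so independence forbids \<open>w = 0\<close>.\<close>
  define \<gamma> where "\<gamma> j = (\<Sum>i<k. inner_upto M (f i) (a k) * S i j)" for j
  have w_eq: "w r = a k r - (\<Sum>j<k. \<gamma> j * a j r)" if "r < M" for r
    unfolding w_def residual_def \<gamma>_def using that
    by (simp add: S sum_distrib_left sum_distrib_right mult.assoc) (rule sum.swap)
  have wpos: "inner_upto M w w > 0"
  proof (rule ccontr)
    assume "\<not> ?thesis"
    then have "inner_upto M w w = 0" using inner_upto_self_nonneg[of M w] by simp
    then have "\<forall>r<M. w r = 0" by (simp add: inner_upto_self_eq_0)
    then have "(\<Sum>j<Suc k. (if j = k then 1 else - \<gamma> j) * a j r) = 0" if "r < M" for r
      using that by (simp add: w_eq sum_negf)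
    then have "(if k = k then 1 else - \<gamma> k) = 0"
      by (rule independent_uptoD[OF Suc.prems, of "\<lambda>j. if j = k then 1 else - \<gamma> j"]) auto
    then show False by simp
  qed
  define s where "s = sqrt (inner_upto M w w)"
  have s: "s > 0" using wpos by (simp add: s_def)
  let ?f = "f(k := (\<lambda>r. (1 / s) * w r))"
  define S' where "S' = (\<lambda>i j. if i = k then (if j = k then 1 / s else - \<gamma> j / s)
                            else if j = k then 0 else S i j)"
  define R' where "R' = (\<lambda>j i. if j = k then (if i = k then s else inner_upto M (f i) (a k))
                            else if i = k then 0 else R j i)"
  have "orthonormal_upto M (Suc k) ?f"
    unfolding s_def by (rule orthonormal_upto_Suc[OF f wpos]) (simp add: w_def residual_orthogonal[OF f])
  moreover have "\<forall>i<Suc k. \<forall>r<M. ?f i r = (\<Sum>j<Suc k. S' i j * a j r)"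
  proof (intro allI impI)
    fix i r assume "i < Suc k" "r < M"
    then show "?f i r = (\<Sum>j<Suc k. S' i j * a j r)"
      unfolding S'_def
      by (cases "i = k") (auto simp: w_eq S sum_negf diff_divide_distrib sum_divide_distrib)
  qed
  moreover have "\<forall>j<Suc k. \<forall>r<M. a j r = (\<Sum>i<Suc k. R' j i * ?f i r)"
  proof (intro allI impI)
    fix j r assume "j < Suc k" "r < M"
    then show "a j r = (\<Sum>i<Suc k. R' j i * ?f i r)"
      using s unfolding R'_def by (cases "j = k") (auto simp: R w_def residual_def)
  qed
  ultimately have "orthonormal_upto M (Suc k) ?f \<and>
      (\<forall>i<Suc k. \<forall>r<M. ?f i r = (\<Sum>j<Suc k. S' i j * a j r)) \<and>
      (\<forall>j<Suc k. \<forall>r<M. a j r = (\<Sum>i<Suc k. R' j i * ?f i r))"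
    by (intro conjI)
  then show ?case by (intro exI[of _ ?f] exI[of _ S'] exI[of _ R'])
qed

text \<open>The family \<open>a\<close> is not orthogonal, so its coefficients in an expansion are
  read off by a dual family \<open>b\<close>; the remaining part of the space is covered by the
  orthonormal \<open>e\<close>.\<close>

lemma independent_complement:
  assumes a: "independent_upto M k a" and "k \<le> M"
  obtains e b where "orthonormal_upto M (M - k) e"
    and "\<And>i j. i < M - k \<Longrightarrow> j < k \<Longrightarrow> inner_upto M (e i) (a j) = 0"
    and "\<And>j l. j < k \<Longrightarrow> l < k \<Longrightarrow> inner_upto M (b j) (a l) = (if j = l then 1 else 0)"
    and "\<And>x r. r < M \<Longrightarrow>
           x r = (\<Sum>i<M-k. inner_upto M (e i) x * e i r) + (\<Sum>j<k. inner_upto M (b j) x * a j r)"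
proof -
  obtain f S R where fSR: "orthonormal_upto M k f \<and>
           (\<forall>i<k. \<forall>r<M. f i r = (\<Sum>j<k. S i j * a j r)) \<and>
           (\<forall>j<k. \<forall>r<M. a j r = (\<Sum>i<k. R j i * f i r))"
    using gram_schmidt_upto[OF a] by blast
  then have f: "orthonormal_upto M k f" by simp
  from fSR have S: "\<And>i r. i < k \<Longrightarrow> r < M \<Longrightarrow> f i r = (\<Sum>j<k. S i j * a j r)" by blast
  from fSR have R: "\<And>j r. j < k \<Longrightarrow> r < M \<Longrightarrow> a j r = (\<Sum>i<k. R j i * f i r)" by blast
  obtain g where g: "orthonormal_upto M M g" and gf: "\<And>i. i < k \<Longrightarrow> g i = f i"
    using orthonormal_extend[OF f assms(2) order_refl] by blast
  define e where "e i = g (k + i)" for i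
  \<comment> \<open>Substituting \<open>S\<close> into the projection onto the span of
    \<open>f\<close> gives \<open>a j\<close> the coefficient that is the inner product of
    \<open>x\<close> with this vector.\<close>
  define b where "b j r = (\<Sum>i<k. S i j * f i r)" for j r
  have e: "orthonormal_upto M (M - k) e"
    using g by (auto simp: orthonormal_upto_def e_def)
  have ef: "inner_upto M (e i) (f j) = 0" if "i < M - k" "j < k" for i j
    using that g gf[OF that(2)] \<open>k \<le> M\<close> unfolding orthonormal_upto_def e_def
    by (metis add_less_cancel_left le_add_diff_inverse less_le_trans not_add_less1)
  have ea: "inner_upto M (e i) (a j) = 0" if "i < M - k" "j < k" for i j
  proof -
    have "inner_upto M (e i) (a j) = inner_upto M (e i) (\<lambda>r. \<Sum>l<k. R j l * f l r)"
      using that by (intro inner_upto_cong) (auto simp: R)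
    then show ?thesis using that by (simp add: inner_upto_sum_right ef)
  qed
  have exp: "x r = (\<Sum>i<M-k. inner_upto M (e i) x * e i r) + (\<Sum>j<k. inner_upto M (b j) x * a j r)"
    if r: "r < M" for x r
  proof -
    have "x r = (\<Sum>i<M. inner_upto M (g i) x * g i r)" by (rule orthonormal_expansion[OF g r])
    also have "{..<M} = {..<k} \<union> (\<lambda>i. k + i) ` {..<M-k}"
      using \<open>k \<le> M\<close> by (auto simp: image_iff) (metis add.commute le_add_diff_inverse2 less_diff_conv2 not_less lessThan_iff)
    also have "(\<Sum>i\<in>{..<k} \<union> (\<lambda>i. k + i) ` {..<M-k}. inner_upto M (g i) x * g i r)
       = (\<Sum>i<k. inner_upto M (g i) x * g i r) + (\<Sum>i<M-k. inner_upto M (e i) x * e i r)"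
      by (subst sum.union_disjoint) (auto simp: sum.reindex e_def)
    also have "(\<Sum>i<k. inner_upto M (g i) x * g i r)
        = (\<Sum>i<k. \<Sum>j<k. inner_upto M (f i) x * S i j * a j r)"
      using r by (intro sum.cong refl) (simp add: gf S sum_distrib_left mult.assoc)
    also have "\<dots> = (\<Sum>j<k. \<Sum>i<k. inner_upto M (f i) x * S i j * a j r)" by (rule sum.swap)
    also have "\<dots> = (\<Sum>j<k. inner_upto M x (b j) * a j r)"
      unfolding b_def[abs_def] by (simp add: inner_upto_sum_right sum_distrib_right)
         (simp add: inner_upto_commute mult.commute)
    finally show ?thesis by (simp add: inner_upto_commute)
  qed
  \<comment> \<open>Expanding \<open>a l\<close> itself leaves no \<open>e\<close>-part, and
    independence forces its coefficients to be those of the trivial representation.\<close>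
  have ba: "inner_upto M (b j) (a l) = (if j = l then 1 else 0)" if "j < k" "l < k" for j l
  proof -
    have delta: "(\<Sum>j<k. (if j = l then 1 else 0) * a j r) = a l r" for r
      using \<open>l < k\<close> by (simp add: if_distrib[of "\<lambda>c. c * _"] cong: if_cong)
    have "(\<Sum>j<k. (inner_upto M (b j) (a l) - (if j = l then 1 else 0)) * a j r) = 0" if r: "r < M" for r
      using exp[OF r, of "a l"] ea[OF _ \<open>l < k\<close>] \<open>l < k\<close>
      by (simp add: left_diff_distrib sum_subtractf delta)
    then have "inner_upto M (b j) (a l) - (if j = l then 1 else 0) = 0"
      using that(1) by (rule independent_uptoD[OF a])
    then show ?thesis by simp
  qed
  show ?thesis using that[OF e ea ba exp] by blast
qed

section \<open>Divergences\<close>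

lemma admissible_DERIV:
  assumes "admissible_phi \<phi>" "u > 0"
  shows "DERIV \<phi> u :> deriv \<phi> u" and "DERIV (deriv \<phi>) u :> deriv (deriv \<phi>) u"
  using assms unfolding admissible_phi_def
  by (auto simp: DERIV_deriv_iff_real_differentiable)

text \<open>The derivative vanishes at 1 and is differentiable there, so it is
  \<open>c * (v - 1)\<close> up to \<open>\<epsilon> * \<bar>v - 1\<bar>\<close>; the mean value
  theorem for \<open>\<phi>\<close> minus its quadratic part transfers this to
  \<open>\<phi>\<close>.\<close>

lemma admissible_near_quadratic:
  assumes adm: "admissible_phi \<phi>" and "\<epsilon> > 0"
  shows "\<exists>\<delta>>0. \<delta> < 1 \<and> (\<forall>u. \<bar>u - 1\<bar> \<le> \<delta> \<longrightarrow>
           \<bar>\<phi> u - deriv (deriv \<phi>) 1 / 2 * (u - 1)\<^sup>2\<bar> \<le> \<epsilon> * (u - 1)\<^sup>2)"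
proof -
  define c where "c = deriv (deriv \<phi>) 1"
  have 1: "\<phi> 1 = 0" "deriv \<phi> 1 = 0" using adm by (auto simp: admissible_phi_def)
  have "(\<lambda>v. (deriv \<phi> v - deriv \<phi> 1) / (v - 1)) \<midarrow>1\<rightarrow> c"
    using admissible_DERIV(2)[OF adm, of 1] by (simp add: has_field_derivative_iff c_def)
  then obtain d where d: "d > 0"
      and "\<And>v. v \<noteq> 1 \<Longrightarrow> \<bar>v - 1\<bar> < d \<Longrightarrow> \<bar>deriv \<phi> v / (v - 1) - c\<bar> < \<epsilon>"
    using \<open>\<epsilon> > 0\<close> unfolding LIM_def 1 dist_real_def by (auto simp: 1)
  then have slope: "\<bar>deriv \<phi> v - c * (v - 1)\<bar> \<le> \<epsilon> * \<bar>v - 1\<bar>" if "\<bar>v - 1\<bar> < d" for v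
  proof (cases "v = 1")
    case False
    then have "\<bar>deriv \<phi> v - c * (v - 1)\<bar> = \<bar>deriv \<phi> v / (v - 1) - c\<bar> * \<bar>v - 1\<bar>"
      by (simp add: abs_mult[symmetric] field_simps)
    also have "\<dots> \<le> \<epsilon> * \<bar>v - 1\<bar>"
      using \<open>\<And>v. v \<noteq> 1 \<Longrightarrow> \<bar>v - 1\<bar> < d \<Longrightarrow> _\<close>[OF False that] by (intro mult_right_mono) auto
    finally show ?thesis .
  qed (simp add: 1)
  define g where "g u = \<phi> u - c / 2 * (u - 1)\<^sup>2" for u
  have g': "DERIV g v :> deriv \<phi> v - c * (v - 1)" if "v > 0" for v
    unfolding g_def by (auto intro!: derivative_eq_intros admissible_DERIV(1)[OF adm that])
  \<comment> \<open>Halving \<open>d\<close> restores a strict inequality, and the bound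
    \<open>1/2\<close> keeps the interval inside the positive reals, where \<open>\<phi>\<close> is
    differentiable.\<close>
  define \<delta> where "\<delta> = min (d/2) (1/2)"
  have "\<bar>g u\<bar> \<le> \<epsilon> * (u - 1)\<^sup>2" if u: "\<bar>u - 1\<bar> \<le> \<delta>" for u
  proof -
    have "\<exists>v. \<bar>v - 1\<bar> \<le> \<bar>u - 1\<bar> \<and> \<bar>g u\<bar> = \<bar>deriv \<phi> v - c * (v - 1)\<bar> * \<bar>u - 1\<bar>"
    proof (cases u "1::real" rule: linorder_cases)
      case less
      then obtain z where z: "u < z" "z < 1" "g 1 - g u = (1 - u) * (deriv \<phi> z - c * (z - 1))"
        using MVT2[of u 1 g "\<lambda>v. deriv \<phi> v - c * (v - 1)"] g' u by (force simp: \<delta>_def abs_if split: if_splits)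
      then have "\<bar>g u\<bar> = \<bar>(1 - u) * (deriv \<phi> z - c * (z - 1))\<bar>" using 1 by (simp add: g_def)
      then show ?thesis using z by (intro exI[of _ z]) (auto simp: abs_mult abs_minus_commute)
    next
      case equal
      then show ?thesis using 1 by (auto simp: g_def)
    next
      case greater
      then obtain z where z: "1 < z" "z < u" "g u - g 1 = (u - 1) * (deriv \<phi> z - c * (z - 1))"
        using MVT2[of 1 u g "\<lambda>v. deriv \<phi> v - c * (v - 1)"] g' by force
      then have "\<bar>g u\<bar> = \<bar>(u - 1) * (deriv \<phi> z - c * (z - 1))\<bar>" using 1 by (simp add: g_def)
      then show ?thesis using z by (intro exI[of _ z]) (auto simp: abs_mult)
    qed
    then obtain v where v: "\<bar>v - 1\<bar> \<le> \<bar>u - 1\<bar>" "\<bar>g u\<bar> = \<bar>deriv \<phi> v - c * (v - 1)\<bar> * \<bar>u - 1\<bar>" by blast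
    have "\<bar>deriv \<phi> v - c * (v - 1)\<bar> \<le> \<epsilon> * \<bar>v - 1\<bar>" using v(1) u d by (intro slope) (auto simp: \<delta>_def)
    also have "\<dots> \<le> \<epsilon> * \<bar>u - 1\<bar>" using v(1) \<open>\<epsilon> > 0\<close> by simp
    finally have "\<bar>g u\<bar> \<le> \<epsilon> * \<bar>u - 1\<bar> * \<bar>u - 1\<bar>" unfolding v(2) by (intro mult_right_mono) auto
    then show ?thesis by (simp add: power2_eq_square)
  qed
  moreover have "\<delta> > 0" "\<delta> < 1" using d by (auto simp: \<delta>_def)
  ultimately show ?thesis unfolding g_def c_def by blast
qed

text \<open>Near 1 the quadratic expansion applies. Farther out, convexity compares \<open>u\<close>
  with the point \<open>w\<close> at distance \<open>\<delta>\<close> from 1 on the segment towards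
  \<open>u\<close>: since \<open>\<phi> 1 = 0\<close>, the value at \<open>w\<close> forces at least
  linear growth.\<close>

lemma admissible_lower_bound:
  assumes adm: "admissible_phi \<phi>"
  shows "\<exists>c>0. \<forall>u>0. c * min ((u - 1)\<^sup>2) \<bar>u - 1\<bar> \<le> \<phi> u"
proof -
  \<comment> \<open>Half of the leading coefficient; the other half absorbs the approximation
    error.\<close>
  define k where "k = deriv (deriv \<phi>) 1 / 4"
  have k: "k > 0" using adm by (simp add: k_def admissible_phi_def)
  have cvx: "convex_on {0<..} \<phi>" and phi1: "\<phi> 1 = 0" using adm by (auto simp: admissible_phi_def)
  from admissible_near_quadratic[OF adm k] obtain \<delta> where \<delta>: "\<delta> > 0" "\<delta> < 1"
    and quad: "\<And>u. \<bar>u - 1\<bar> \<le> \<delta> \<Longrightarrow> \<bar>\<phi> u - 2 * (k * (u - 1)\<^sup>2)\<bar> \<le> k * (u - 1)\<^sup>2"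
    by (auto simp: k_def)
  have near: "k * (u - 1)\<^sup>2 \<le> \<phi> u" if "\<bar>u - 1\<bar> \<le> \<delta>" for u
    using quad[OF that] by linarith
  have far: "k * \<delta> * \<bar>u - 1\<bar> \<le> \<phi> u" if u: "u > 0" "\<bar>u - 1\<bar> > \<delta>" for u
  proof -
    define t where "t = \<delta> / \<bar>u - 1\<bar>"
    define w where "w = (1 - t) * 1 + t * u"
    have t: "0 < t" "t < 1" using u \<delta> by (auto simp: t_def)
    have w: "w - 1 = t * (u - 1)" by (simp add: w_def algebra_simps)
    have "t * \<bar>u - 1\<bar> = \<delta>" using u \<delta> by (simp add: t_def)
    then have aw: "\<bar>w - 1\<bar> = \<delta>" using t unfolding w by (simp add: abs_mult)
    have "\<phi> w \<le> (1 - t) * \<phi> 1 + t * \<phi> u"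
      unfolding w_def using convex_onD[OF cvx, of t 1 u] t u by simp
    then have "k * \<delta>\<^sup>2 \<le> t * \<phi> u" using near[of w] aw phi1 by (simp add: power2_abs[symmetric, of "w - 1"])
    then have "(k * \<delta>\<^sup>2) * \<bar>u - 1\<bar> \<le> (t * \<phi> u) * \<bar>u - 1\<bar>" by (intro mult_right_mono) auto
    also have "\<dots> = \<delta> * \<phi> u" using \<open>t * \<bar>u - 1\<bar> = \<delta>\<close> by (metis mult.commute mult.left_commute)
    finally have "\<delta> * (k * \<delta> * \<bar>u - 1\<bar>) \<le> \<delta> * \<phi> u" by (simp add: power2_eq_square algebra_simps)
    then show ?thesis using \<delta> by simp
  qed
  have "k * \<delta> * min ((u - 1)\<^sup>2) \<bar>u - 1\<bar> \<le> \<phi> u" if "u > 0" for u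
  proof (cases "\<bar>u - 1\<bar> \<le> \<delta>")
    case True
    have "k * \<delta> * min ((u - 1)\<^sup>2) \<bar>u - 1\<bar> \<le> (k * 1) * (u - 1)\<^sup>2"
      using k \<delta> by (intro mult_mono) auto
    then show ?thesis using near[OF True] by simp
  next
    case False
    have "k * \<delta> * min ((u - 1)\<^sup>2) \<bar>u - 1\<bar> \<le> k * \<delta> * \<bar>u - 1\<bar>"
      using k \<delta> by (intro mult_left_mono) auto
    then show ?thesis using far[OF that] False by simp
  qed
  then show ?thesis using k \<delta> by (intro exI[of _ "k * \<delta>"]) auto
qed

definition real_phi_div :: "nat \<Rightarrow> (real \<Rightarrow> real) \<Rightarrow> (nat \<Rightarrow> real) \<Rightarrow> (nat \<Rightarrow> real) \<Rightarrow> real" where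
  "real_phi_div M \<phi> p q = (\<Sum>r<M. q r * \<phi> (p r / q r))"

lemma phi_div_eq_real:
  assumes "\<And>r. r < M \<Longrightarrow> p r > 0" "\<And>r. r < M \<Longrightarrow> q r > 0"
  shows "phi_div M \<phi> p q = ereal (real_phi_div M \<phi> p q)"
proof -
  have "phi_div M \<phi> p q = (\<Sum>r<M. ereal (q r * \<phi> (p r / q r)))"
    unfolding phi_div_def
    by (intro sum.cong refl) (use assms in \<open>fastforce simp: less_le\<close>)
  then show ?thesis by (simp add: real_phi_div_def)
qed

text \<open>For entries in \<open>(0,1]\<close> both branches of the minimum, after multiplication
  by \<open>q r\<close>, dominate \<open>(p r - q r)^2\<close>. The constant is uniform in
  \<open>q\<close>, even near the boundary of the simplex, so fitted probabilities can be localised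
  without a compact parameter space.\<close>

lemma real_phi_div_lower:
  assumes "admissible_phi \<phi>"
  shows "\<exists>c>0. \<forall>M p q. (\<forall>r<M. 0 < p r \<and> p r \<le> 1 \<and> 0 < q r \<and> q r \<le> 1) \<longrightarrow>
            c * (\<Sum>r<M. (p r - q r)\<^sup>2) \<le> real_phi_div M \<phi> p q"
proof -
  obtain c where c: "c > 0" and low: "\<And>u. u > 0 \<Longrightarrow> c * min ((u - 1)\<^sup>2) \<bar>u - 1\<bar> \<le> \<phi> u"
    using admissible_lower_bound[OF assms] by blast
  have "c * (x - y)\<^sup>2 \<le> y * \<phi> (x / y)" if xy: "0 < x" "x \<le> 1" "0 < y" "y \<le> 1" for x y :: real
  proof -
    have "y * (x / y - 1) = x - y" using xy by (simp add: field_simps)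
    then have e: "y * \<bar>x / y - 1\<bar> = \<bar>x - y\<bar>" using xy by (metis abs_mult abs_of_pos)
    have "(x - y)\<^sup>2 \<le> y * min ((x / y - 1)\<^sup>2) \<bar>x / y - 1\<bar>"
    proof -
      have "(x - y)\<^sup>2 = y * (y * (x / y - 1)\<^sup>2)" using xy by (simp add: field_simps power2_eq_square)
      also have "\<dots> \<le> y * (1 * (x / y - 1)\<^sup>2)"
        using xy by (intro mult_left_mono mult_right_mono) auto
      finally have "(x - y)\<^sup>2 \<le> y * (x / y - 1)\<^sup>2" by simp
      moreover have "\<bar>x - y\<bar> * \<bar>x - y\<bar> \<le> 1 * \<bar>x - y\<bar>" using xy by (intro mult_right_mono) auto
      ultimately show ?thesis using e by (auto simp: min_def power2_eq_square)
    qed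
    then have "c * (x - y)\<^sup>2 \<le> c * (y * min ((x / y - 1)\<^sup>2) \<bar>x / y - 1\<bar>)" using c by simp
    also have "\<dots> = y * (c * min ((x / y - 1)\<^sup>2) \<bar>x / y - 1\<bar>)" by (simp only: mult.left_commute)
    also have "\<dots> \<le> y * \<phi> (x / y)" using xy by (intro mult_left_mono low) auto
    finally show ?thesis .
  qed
  then show ?thesis
    unfolding real_phi_div_def sum_distrib_left using c by (intro exI[of _ c]) (auto intro!: sum_mono)
qed

section \<open>Log-linear models near the true parameter\<close>

text \<open>Expanding at \<open>p / q = 1\<close> gives the denominator \<open>q\<close>; exchanging
  it for the fixed \<open>a\<close> costs a further small relative error. A fixed denominator is
  what later yields a norm.\<close>

lemma phi_term_quadratic:
  assumes adm: "admissible_phi \<phi>" and "\<epsilon> > 0"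
  shows "\<exists>\<eta>>0. \<eta> \<le> 1/2 \<and> (\<forall>a p q. a > 0 \<longrightarrow> \<bar>p - a\<bar> \<le> \<eta> * a \<longrightarrow> \<bar>q - a\<bar> \<le> \<eta> * a \<longrightarrow>
           \<bar>2 / deriv (deriv \<phi>) 1 * (q * \<phi> (p / q)) - (p - q)\<^sup>2 / a\<bar> \<le> \<epsilon> * ((p - q)\<^sup>2 / a))"
proof -
  define c where "c = deriv (deriv \<phi>) 1"
  have c: "c > 0" using adm by (simp add: c_def admissible_phi_def)
  \<comment> \<open>The tolerance \<open>c * \<epsilon> / 8\<close> becomes
    \<open>\<epsilon> / 4\<close> after the factor \<open>2 / c\<close>, and
    \<open>\<epsilon> / 2\<close> after replacing \<open>1 / q\<close> by at most
    \<open>2 / a\<close>.\<close>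
  obtain \<delta> where \<delta>: "\<delta> > 0"
    and quad: "\<And>u. \<bar>u - 1\<bar> \<le> \<delta> \<Longrightarrow> \<bar>\<phi> u - c / 2 * (u - 1)\<^sup>2\<bar> \<le> (c * \<epsilon> / 8) * (u - 1)\<^sup>2"
    using admissible_near_quadratic[OF adm, of "c * \<epsilon> / 8"] c \<open>\<epsilon> > 0\<close> unfolding c_def by auto
  \<comment> \<open>The three bounds give \<open>q \<ge> a / 2\<close>, then
    \<open>\<bar>p / q - 1\<bar> \<le> 4 * \<eta> \<le> \<delta>\<close>, and
    \<open>\<bar>a - q\<bar> / q \<le> 2 * \<eta> \<le> \<epsilon> / 2\<close> for the exchange of
    denominators.\<close>
  define \<eta> where "\<eta> = min (1/2) (min (\<delta>/4) (\<epsilon>/4))"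
  have \<eta>: "\<eta> > 0" "\<eta> \<le> 1/2" "4 * \<eta> \<le> \<delta>" "4 * \<eta> \<le> \<epsilon>" using \<delta> \<open>\<epsilon> > 0\<close> by (auto simp: \<eta>_def)
  have "\<bar>2 / c * (q * \<phi> (p / q)) - (p - q)\<^sup>2 / a\<bar> \<le> \<epsilon> * ((p - q)\<^sup>2 / a)"
    if a: "a > 0" "\<bar>p - a\<bar> \<le> \<eta> * a" "\<bar>q - a\<bar> \<le> \<eta> * a" for a p q
  proof -
    have "\<eta> * a \<le> 1/2 * a" using a \<eta> by (intro mult_right_mono) auto
    then have qa: "q \<ge> a / 2" using a by linarith
    then have q: "q > 0" using a by linarith
    have "\<bar>p - q\<bar> \<le> 2 * \<eta> * a" using a by linarith
    also have "\<dots> \<le> 2 * \<eta> * (2 * q)" using qa \<eta> by (intro mult_left_mono) auto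
    also have "\<dots> = 4 * \<eta> * q" by simp
    also have "\<dots> \<le> \<delta> * q" using q \<eta> by (intro mult_right_mono) auto
    finally have "\<bar>p / q - 1\<bar> \<le> \<delta>" using q by (simp add: field_simps abs_if split: if_splits)
    then have h: "\<bar>\<phi> (p / q) - c / 2 * (p / q - 1)\<^sup>2\<bar> \<le> (c * \<epsilon> / 8) * (p / q - 1)\<^sup>2" by (rule quad)
    have sq: "q * (p / q - 1)\<^sup>2 = (p - q)\<^sup>2 / q" using q by (simp add: field_simps power2_eq_square)
    have inv: "(p - q)\<^sup>2 / q \<le> 2 * ((p - q)\<^sup>2 / a)"
    proof -
      have "1 / q \<le> 2 / a" using qa q a by (simp add: field_simps)
      then have "(p - q)\<^sup>2 * (1 / q) \<le> (p - q)\<^sup>2 * (2 / a)" by (intro mult_left_mono) auto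
      then show ?thesis by (simp add: mult.commute)
    qed
    have scale: "2 / c * (q * F) - q * Q = (2 / c * q) * (F - c / 2 * Q)" for F Q
      using c by (simp add: right_diff_distrib)
    have "2 / c * (q * \<phi> (p / q)) - (p - q)\<^sup>2 / q = (2 / c * q) * (\<phi> (p / q) - c / 2 * (p / q - 1)\<^sup>2)"
      unfolding sq[symmetric] by (rule scale)
    then have "\<bar>2 / c * (q * \<phi> (p / q)) - (p - q)\<^sup>2 / q\<bar> = (2 / c * q) * \<bar>\<phi> (p / q) - c / 2 * (p / q - 1)\<^sup>2\<bar>"
      using c q by (simp add: abs_mult)
    also have "\<dots> \<le> (2 / c * q) * ((c * \<epsilon> / 8) * (p / q - 1)\<^sup>2)"
      using c q h by (intro mult_left_mono) auto
    also have "\<dots> = \<epsilon> / 4 * (q * (p / q - 1)\<^sup>2)" using c by simp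
    also have "\<dots> \<le> \<epsilon> / 4 * (2 * ((p - q)\<^sup>2 / a))" unfolding sq using inv \<open>\<epsilon> > 0\<close> by (intro mult_left_mono) auto
    finally have 1: "\<bar>2 / c * (q * \<phi> (p / q)) - (p - q)\<^sup>2 / q\<bar> \<le> \<epsilon> / 2 * ((p - q)\<^sup>2 / a)" by simp
    have "(p - q)\<^sup>2 / q - (p - q)\<^sup>2 / a = (p - q)\<^sup>2 / a * ((a - q) / q)" using a q by (simp add: field_simps)
    then have "\<bar>(p - q)\<^sup>2 / q - (p - q)\<^sup>2 / a\<bar> = (p - q)\<^sup>2 / a * (\<bar>a - q\<bar> / q)"
      using a q by (simp add: abs_mult)
    also have "\<dots> \<le> (p - q)\<^sup>2 / a * (\<epsilon> / 2)"
    proof (intro mult_left_mono)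
      have "\<bar>a - q\<bar> \<le> \<eta> * a" using a by linarith
      also have "\<dots> \<le> \<eta> * (2 * q)" using qa \<eta> by (intro mult_left_mono) auto
      also have "\<dots> \<le> \<epsilon> / 2 * q" using \<eta> q by (simp add: field_simps)
      finally show "\<bar>a - q\<bar> / q \<le> \<epsilon> / 2" using q by (simp add: field_simps)
    qed (use a in auto)
    finally have 2: "\<bar>(p - q)\<^sup>2 / q - (p - q)\<^sup>2 / a\<bar> \<le> \<epsilon> / 2 * ((p - q)\<^sup>2 / a)" by (simp add: mult.commute)
    have "\<epsilon> * ((p - q)\<^sup>2 / a) = \<epsilon> / 2 * ((p - q)\<^sup>2 / a) + \<epsilon> / 2 * ((p - q)\<^sup>2 / a)" by (simp add: field_simps)
    moreover have "\<bar>x - z\<bar> \<le> \<bar>x - y\<bar> + \<bar>y - z\<bar>" for x y z :: real by linarith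
    ultimately show ?thesis using order_trans[OF _ add_mono[OF 1 2]] by metis
  qed
  then show ?thesis using \<eta> unfolding c_def by blast
qed

locale loglinear_model =
  fixes M M0 :: nat and W :: "nat \<Rightarrow> nat \<Rightarrow> real" and \<theta>0 :: "nat \<Rightarrow> real"
  assumes M0_less: "M0 < M - 1"
    and W_indep: "\<And>(a::real) (c::nat \<Rightarrow> real).
         (\<forall>r<M. a + (\<Sum>j<M0. W r j * c j) = 0) \<Longrightarrow> a = 0 \<and> (\<forall>j<M0. c j = 0)"
begin

abbreviation pm :: "(nat \<Rightarrow> real) \<Rightarrow> nat \<Rightarrow> real" where "pm \<equiv> loglin_p M M0 W"
abbreviation p0 :: "nat \<Rightarrow> real" where "p0 \<equiv> loglin_p M M0 W \<theta>0"

definition partition_fun :: "(nat \<Rightarrow> real) \<Rightarrow> real" where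
  "partition_fun \<theta> = (\<Sum>s<M. exp (\<Sum>j<M0. W s j * \<theta> j))"

definition scaled_diff :: "(nat \<Rightarrow> real) \<Rightarrow> (nat \<Rightarrow> real) \<Rightarrow> nat \<Rightarrow> real" where
  "scaled_diff p q r = (p r - q r) / sqrt (p0 r)"

text \<open>Its square is Pearson's chi-square distance with the denominator frozen at
  \<open>p0\<close>; freezing makes it symmetric and gives the triangle inequality.\<close>

definition wdist :: "(nat \<Rightarrow> real) \<Rightarrow> (nat \<Rightarrow> real) \<Rightarrow> real" where
  "wdist p q = L2_set (scaled_diff p q) {..<M}"

text \<open>Index 0 is the direction \<open>sqrt p0\<close> of the normalising constant, and index
  \<open>Suc j\<close> belongs to column \<open>j\<close> of \<open>W\<close>. Together they span
  the tangent space of the model at \<open>p0\<close>, enlarged by the constants, in scaled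
  coordinates.\<close>

definition score :: "nat \<Rightarrow> nat \<Rightarrow> real" where
  "score i r = sqrt (p0 r) * (case i of 0 \<Rightarrow> 1 | Suc j \<Rightarrow> W r j)"

text \<open>A single constant dominating both \<open>1 / p0 r\<close> and
  \<open>1 / sqrt (p0 r)\<close> for all categories.\<close>

definition inv_sum :: real where "inv_sum = (\<Sum>r<M. 1 / p0 r)"

lemma M_pos: "0 < M" using M0_less by simp

lemma partition_fun_pos: "0 < partition_fun \<theta>"
  unfolding partition_fun_def using M_pos by (intro sum_pos) auto

lemma pm_eq: "pm \<theta> r = exp (\<Sum>j<M0. W r j * \<theta> j) / partition_fun \<theta>"
  by (simp add: loglin_p_def partition_fun_def)

lemma pm_pos: "0 < pm \<theta> r"
  using partition_fun_pos by (simp add: pm_eq)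

lemma pm_sum: "(\<Sum>r<M. pm \<theta> r) = 1"
  using partition_fun_pos[of \<theta>] by (simp add: pm_eq sum_divide_distrib[symmetric] partition_fun_def)

lemma pm_le_1: "r < M \<Longrightarrow> pm \<theta> r \<le> 1"
  using member_le_sum[of r "{..<M}" "pm \<theta>"] pm_sum pm_pos by (simp add: less_imp_le)

lemma ln_pm: "ln (pm \<theta> r) = (\<Sum>j<M0. W r j * \<theta> j) - ln (partition_fun \<theta>)"
  using partition_fun_pos[of \<theta>] by (simp add: pm_eq ln_div)

lemma inv_p0_le: "r < M \<Longrightarrow> 1 / p0 r \<le> inv_sum"
  unfolding inv_sum_def by (rule member_le_sum) (auto simp: pm_pos less_imp_le)

lemma inv_sum_pos: "0 < inv_sum"
  unfolding inv_sum_def using M_pos by (intro sum_pos) (auto simp: pm_pos)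

lemma inv_sqrt_p0_le: "r < M \<Longrightarrow> 1 / sqrt (p0 r) \<le> inv_sum"
proof -
  assume r: "r < M"
  have "sqrt (p0 r) * sqrt (p0 r) \<le> sqrt (p0 r) * 1"
    using pm_le_1[OF r] pm_pos[of \<theta>0 r] by (intro mult_left_mono) auto
  then have "p0 r \<le> sqrt (p0 r)" using pm_pos[of \<theta>0 r] by simp
  then have "1 / sqrt (p0 r) \<le> 1 / p0 r" using pm_pos[of \<theta>0 r] by (intro divide_left_mono) auto
  then show ?thesis using inv_p0_le[OF r] by linarith
qed

lemma wdist_nonneg: "0 \<le> wdist p q" by (simp add: wdist_def)

lemma wdist_sq: "(wdist p q)\<^sup>2 = (\<Sum>r<M. (p r - q r)\<^sup>2 / p0 r)"
  using pm_pos by (simp add: wdist_def L2_set_def sum_nonneg scaled_diff_def power_divide less_imp_le)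

lemma wdist_commute: "wdist p q = wdist q p"
  unfolding wdist_def L2_set_def scaled_diff_def by (simp add: power2_commute power_divide)

lemma wdist_triangle: "wdist p q \<le> wdist p s + wdist s q"
proof -
  have "scaled_diff p q = (\<lambda>r. scaled_diff p s r + scaled_diff s q r)"
    by (auto simp: scaled_diff_def add_divide_distrib[symmetric])
  then show ?thesis unfolding wdist_def using L2_set_triangle_ineq by metis
qed

lemma scaled_diff_le: "r < M \<Longrightarrow> \<bar>scaled_diff p q r\<bar> \<le> wdist p q"
  unfolding wdist_def using member_le_L2_set[of "{..<M}" r "\<lambda>r. \<bar>scaled_diff p q r\<bar>"] by (simp add: L2_set_def)

lemma diff_le_wdist: assumes "r < M" shows "\<bar>p r - p0 r\<bar> \<le> inv_sum * wdist p p0 * p0 r"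
proof -
  have p: "p0 r > 0" by (rule pm_pos)
  have "\<bar>p r - p0 r\<bar> = \<bar>scaled_diff p p0 r\<bar> * (1 / sqrt (p0 r)) * p0 r"
    using p by (simp add: scaled_diff_def field_simps)
  also have "\<dots> \<le> wdist p p0 * inv_sum * p0 r"
    using p scaled_diff_le[OF assms] inv_sqrt_p0_le[OF assms]
    by (intro mult_right_mono mult_mono) (auto simp: wdist_nonneg)
  finally show ?thesis by (simp add: mult.commute)
qed

text \<open>The radius makes the relative deviation at most one half: this excludes empty cells and
  is the range in which the logarithm is linearised.\<close>

lemma near_p0:
  assumes "wdist p p0 \<le> 1 / (2 * inv_sum)" "r < M"
  shows "p r > 0" and "\<bar>p r / p0 r - 1\<bar> \<le> 1/2"
proof -
  have p: "p0 r > 0" by (rule pm_pos)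
  have "inv_sum * wdist p p0 \<le> 1/2" using assms(1) inv_sum_pos by (simp add: field_simps)
  then have "inv_sum * wdist p p0 * p0 r \<le> 1/2 * p0 r" using p by (intro mult_right_mono) auto
  then have "\<bar>p r - p0 r\<bar> \<le> p0 r / 2" using diff_le_wdist[OF assms(2), of p] by linarith
  then show "p r > 0" "\<bar>p r / p0 r - 1\<bar> \<le> 1/2" using p by (auto simp: field_simps abs_if split: if_splits)
qed

text \<open>The limit form does not depend on \<open>\<phi>\<close>; this is why one function may be
  used for estimation and another for testing.\<close>

lemma real_phi_div_quadratic:
  assumes adm: "admissible_phi \<phi>" and "\<epsilon> > 0"
  shows "\<exists>\<delta>>0. \<forall>p q. wdist p p0 \<le> \<delta> \<longrightarrow> wdist q p0 \<le> \<delta> \<longrightarrow>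
     \<bar>2 / deriv (deriv \<phi>) 1 * real_phi_div M \<phi> p q - (wdist p q)\<^sup>2\<bar> \<le> \<epsilon> * (wdist p q)\<^sup>2"
proof -
  obtain \<eta> where \<eta>: "\<eta> > 0" and H: "\<And>a p q. a > 0 \<Longrightarrow> \<bar>p - a\<bar> \<le> \<eta> * a \<Longrightarrow> \<bar>q - a\<bar> \<le> \<eta> * a \<Longrightarrow>
           \<bar>2 / deriv (deriv \<phi>) 1 * (q * \<phi> (p / q)) - (p - q)\<^sup>2 / a\<bar> \<le> \<epsilon> * ((p - q)\<^sup>2 / a)"
    using phi_term_quadratic[OF assms] by auto
  have near: "\<bar>p r - p0 r\<bar> \<le> \<eta> * p0 r" if "wdist p p0 \<le> \<eta> / inv_sum" "r < M" for p r
  proof -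
    have "inv_sum * wdist p p0 \<le> \<eta>" using that(1) inv_sum_pos by (simp add: field_simps)
    then have "inv_sum * wdist p p0 * p0 r \<le> \<eta> * p0 r" using pm_pos[of \<theta>0 r] by (intro mult_right_mono) auto
    then show ?thesis using diff_le_wdist[OF that(2), of p] by linarith
  qed
  have "\<bar>2 / deriv (deriv \<phi>) 1 * real_phi_div M \<phi> p q - (wdist p q)\<^sup>2\<bar> \<le> \<epsilon> * (wdist p q)\<^sup>2"
    if "wdist p p0 \<le> \<eta> / inv_sum" "wdist q p0 \<le> \<eta> / inv_sum" for p q
  proof -
    have "2 / deriv (deriv \<phi>) 1 * real_phi_div M \<phi> p q - (wdist p q)\<^sup>2 =
       (\<Sum>r<M. 2 / deriv (deriv \<phi>) 1 * (q r * \<phi> (p r / q r)) - (p r - q r)\<^sup>2 / p0 r)"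
      by (simp only: real_phi_div_def wdist_sq sum_distrib_left sum_subtractf)
    also have "\<bar>\<dots>\<bar> \<le> (\<Sum>r<M. \<epsilon> * ((p r - q r)\<^sup>2 / p0 r))"
      by (rule order_trans[OF sum_abs], intro sum_mono H pm_pos near) (use that in auto)
    also have "\<dots> = \<epsilon> * (wdist p q)\<^sup>2" by (simp only: wdist_sq sum_distrib_left)
    finally show ?thesis .
  qed
  then show ?thesis using \<eta> inv_sum_pos by (intro exI[of _ "\<eta> / inv_sum"]) auto
qed

text \<open>The global lower bound at \<open>pm \<theta>\<close> and the local upper bound at
  \<open>p0\<close> squeeze the distance from \<open>p\<close> to \<open>pm \<theta>\<close>. Since
  \<open>\<theta>\<close> only has to be no worse than \<open>\<theta>0\<close>, this covers
  minimisers and also the sublevel set in which one is sought.\<close>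

lemma sublevel_near:
  assumes adm: "admissible_phi \<phi>"
  shows "\<exists>C>0. \<exists>\<delta>>0. \<forall>p \<theta>. (\<Sum>r<M. p r) = 1 \<longrightarrow> wdist p p0 \<le> \<delta> \<longrightarrow>
           real_phi_div M \<phi> p (pm \<theta>) \<le> real_phi_div M \<phi> p p0 \<longrightarrow>
           wdist (pm \<theta>) p0 \<le> C * wdist p p0"
proof -
  define k where "k = deriv (deriv \<phi>) 1"
  have k: "k > 0" using adm by (simp add: k_def admissible_phi_def)
  obtain \<delta>1 where \<delta>1: "\<delta>1 > 0" and quad: "\<And>p q. wdist p p0 \<le> \<delta>1 \<Longrightarrow> wdist q p0 \<le> \<delta>1 \<Longrightarrow>
     \<bar>2 / k * real_phi_div M \<phi> p q - (wdist p q)\<^sup>2\<bar> \<le> 1 * (wdist p q)\<^sup>2"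
    using real_phi_div_quadratic[OF adm, of 1] unfolding k_def by auto
  obtain c where c: "c > 0" and low: "\<And>p q. (\<forall>r<M. 0 < p r \<and> p r \<le> 1 \<and> 0 < q r \<and> q r \<le> 1) \<Longrightarrow>
            c * (\<Sum>r<M. (p r - q r)\<^sup>2) \<le> real_phi_div M \<phi> p q"
    using real_phi_div_lower[OF adm] by blast
  define \<delta> where "\<delta> = min \<delta>1 (1 / (2 * inv_sum))"
  \<comment> \<open>\<open>inv_sum\<close> converts plain squares into weighted ones,
    \<open>c\<close> is the constant of the global bound, and \<open>k\<close> comes from the
    quadratic bound with relative error 1.\<close>
  define B where "B = sqrt (inv_sum * k / c)"
  have B: "B \<ge> 0" using inv_sum_pos k c by (simp add: B_def)
  have "wdist (pm \<theta>) p0 \<le> (B + 1) * wdist p p0"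
    if p: "(\<Sum>r<M. p r) = 1" "wdist p p0 \<le> \<delta>" and le: "real_phi_div M \<phi> p (pm \<theta>) \<le> real_phi_div M \<phi> p p0" for p \<theta>
  proof -
    have pos: "p r > 0" if "r < M" for r using near_p0(1)[OF _ that] p by (simp add: \<delta>_def)
    have le1: "p r \<le> 1" if "r < M" for r
      using member_le_sum[of r "{..<M}" p] pos that p by (simp add: less_imp_le)
    have "wdist p0 p0 = 0" by (simp add: wdist_def scaled_diff_def L2_set_def)
    then have "2 / k * real_phi_div M \<phi> p p0 \<le> 2 * (wdist p p0)\<^sup>2"
      using quad[of p p0] p \<delta>1 by (simp add: \<delta>_def)
    then have up: "real_phi_div M \<phi> p p0 \<le> k * (wdist p p0)\<^sup>2" using k by (simp add: field_simps)
    have "(wdist p (pm \<theta>))\<^sup>2 \<le> (\<Sum>r<M. inv_sum * (p r - pm \<theta> r)\<^sup>2)"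
      unfolding wdist_sq
    proof (intro sum_mono)
      fix r assume "r \<in> {..<M}"
      then have "(1 / p0 r) * (p r - pm \<theta> r)\<^sup>2 \<le> inv_sum * (p r - pm \<theta> r)\<^sup>2"
        using inv_p0_le by (intro mult_right_mono) auto
      then show "(p r - pm \<theta> r)\<^sup>2 / p0 r \<le> inv_sum * (p r - pm \<theta> r)\<^sup>2" by simp
    qed
    also have "\<dots> = inv_sum / c * (c * (\<Sum>r<M. (p r - pm \<theta> r)\<^sup>2))"
      using c by (simp add: sum_distrib_left)
    also have "\<dots> \<le> inv_sum / c * (k * (wdist p p0)\<^sup>2)"
      using low[of p "pm \<theta>"] pos le1 pm_pos pm_le_1 le up c inv_sum_pos by (intro mult_left_mono) auto
    also have "\<dots> = (B * wdist p p0)\<^sup>2" using inv_sum_pos k c by (simp add: B_def power_mult_distrib)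
    finally have "wdist p (pm \<theta>) \<le> B * wdist p p0"
      by (rule power2_le_imp_le) (use B wdist_nonneg in auto)
    then show ?thesis using wdist_triangle[of "pm \<theta>" p0 p] by (simp add: wdist_commute algebra_simps)
  qed
  moreover have "\<delta> > 0" using \<delta>1 inv_sum_pos by (simp add: \<delta>_def)
  moreover have "B + 1 > 0" using B by simp
  ultimately show ?thesis by blast
qed

section \<open>Linearisation of the log-probabilities\<close>

definition log_rem :: "(nat \<Rightarrow> real) \<Rightarrow> nat \<Rightarrow> real" where
  "log_rem \<theta> r = sqrt (p0 r) * ((pm \<theta> r / p0 r - 1) - ln (pm \<theta> r / p0 r))"

text \<open>Logarithms of model probabilities are linear in the parameter apart from the normaliser,
  whose contribution points along \<open>score 0\<close>; hence the identity is exact.\<close>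

lemma scaled_log_ratio:
  "sqrt (p0 r) * ln (pm \<theta> r / p0 r)
     = (ln (partition_fun \<theta>0) - ln (partition_fun \<theta>)) * score 0 r
         + (\<Sum>j<M0. (\<theta> j - \<theta>0 j) * score (Suc j) r)"
  using pm_pos[of \<theta> r] pm_pos[of \<theta>0 r]
  by (simp add: ln_div ln_pm score_def algebra_simps sum_subtractf sum_distrib_left)

lemma scaled_diff_expansion:
  "scaled_diff (pm \<theta>) p0 r
     = (ln (partition_fun \<theta>0) - ln (partition_fun \<theta>)) * score 0 r
         + (\<Sum>j<M0. (\<theta> j - \<theta>0 j) * score (Suc j) r) + log_rem \<theta> r"
proof -
  have "scaled_diff (pm \<theta>) p0 r = sqrt (p0 r) * (pm \<theta> r / p0 r - 1)"
    using pm_pos[of \<theta>0 r] unfolding scaled_diff_def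
    by (simp add: field_simps flip: real_sqrt_mult)
  then show ?thesis unfolding log_rem_def by (simp add: right_diff_distrib scaled_log_ratio)
qed

lemma log_rem_bound:
  assumes "wdist (pm \<theta>) p0 \<le> 1 / (2 * inv_sum)"
  shows "L2_set (log_rem \<theta>) {..<M} \<le> 2 * inv_sum * (wdist (pm \<theta>) p0)\<^sup>2"
proof -
  have "\<bar>log_rem \<theta> r\<bar> \<le> 2 * inv_sum * ((pm \<theta> r - p0 r)\<^sup>2 / p0 r)" if r: "r < M" for r
  proof -
    define t where "t = pm \<theta> r / p0 r - 1"
    have p: "p0 r > 0" by (rule pm_pos)
    have "\<bar>ln (1 + t) - t\<bar> \<le> 2 * t\<^sup>2"
      by (rule abs_ln_one_plus_x_minus_x_bound) (use near_p0(2)[OF assms r] in \<open>simp add: t_def\<close>)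
    then have "\<bar>log_rem \<theta> r\<bar> \<le> sqrt (p0 r) * (2 * t\<^sup>2)"
      using p unfolding log_rem_def t_def by (simp add: abs_mult abs_minus_commute)
    also have "\<dots> = 2 * ((1 / sqrt (p0 r)) * ((pm \<theta> r - p0 r)\<^sup>2 / p0 r))"
    proof -
      have "t = (pm \<theta> r - p0 r) / p0 r" using p by (simp add: t_def field_simps)
      then have "t\<^sup>2 = (pm \<theta> r - p0 r)\<^sup>2 / p0 r / (sqrt (p0 r) * sqrt (p0 r))"
        using p by (simp add: power2_eq_square)
      then show ?thesis using p by (simp add: field_simps)
    qed
    also have "\<dots> \<le> 2 * (inv_sum * ((pm \<theta> r - p0 r)\<^sup>2 / p0 r))"
      using inv_sqrt_p0_le[OF r] p by (intro mult_left_mono mult_right_mono) auto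
    finally show ?thesis by simp
  qed
  then have "(\<Sum>r<M. \<bar>log_rem \<theta> r\<bar>) \<le> (\<Sum>r<M. 2 * inv_sum * ((pm \<theta> r - p0 r)\<^sup>2 / p0 r))"
    by (intro sum_mono) auto
  also have "\<dots> = 2 * inv_sum * (wdist (pm \<theta>) p0)\<^sup>2" by (simp only: wdist_sq sum_distrib_left)
  finally show ?thesis using L2_set_le_sum_abs[of "log_rem \<theta>" "{..<M}"] by linarith
qed

lemma independent_score: "independent_upto M (Suc M0) score"
  unfolding independent_upto_def
proof (intro allI impI)
  fix c j assume h: "\<forall>r<M. (\<Sum>j<Suc M0. c j * score j r) = 0" and j: "j < Suc M0"
  have "c 0 + (\<Sum>j<M0. W r j * c (Suc j)) = 0" if "r < M" for r
  proof -
    have "sqrt (p0 r) * (c 0 + (\<Sum>j<M0. W r j * c (Suc j))) = (\<Sum>j<Suc M0. c j * score j r)"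
      unfolding sum.lessThan_Suc_shift by (simp add: score_def algebra_simps sum_distrib_left)
    then show ?thesis using h that pm_pos[of \<theta>0 r] by auto
  qed
  then have "c 0 = 0 \<and> (\<forall>j<M0. c (Suc j) = 0)" using W_indep[of "c 0" "\<lambda>j. c (Suc j)"] by blast
  then show "c j = 0" using j by (cases j) auto
qed

end

section \<open>The defect of a relative frequency vector\<close>

text \<open>The families \<open>e\<close> and \<open>b\<close> obtained from
  \<open>independent_complement\<close> for \<open>score\<close>, fixed once;
  \<open>loglinear_frame_exists\<close> supplies them.\<close>

locale loglinear_frame = loglinear_model +
  fixes e b :: "nat \<Rightarrow> nat \<Rightarrow> real"
  assumes e_orthonormal: "orthonormal_upto M (M - Suc M0) e"
    and e_score: "\<And>i j. i < M - Suc M0 \<Longrightarrow> j < Suc M0 \<Longrightarrow> inner_upto M (e i) (score j) = 0"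
    and b_score: "\<And>j l. j < Suc M0 \<Longrightarrow> l < Suc M0 \<Longrightarrow> inner_upto M (b j) (score l) = (if j = l then 1 else 0)"
    and frame: "\<And>x r. r < M \<Longrightarrow> x r = (\<Sum>i<M - Suc M0. inner_upto M (e i) x * e i r)
                                     + (\<Sum>j<Suc M0. inner_upto M (b j) x * score j r)"
begin

abbreviation K :: nat where "K \<equiv> M - Suc M0"

definition defect :: "(nat \<Rightarrow> real) \<Rightarrow> real" where
  "defect p = (\<Sum>i<K. (inner_upto M (e i) (scaled_diff p p0))\<^sup>2)"

text \<open>The dual vectors extract the coefficients of \<open>scaled_log_ratio\<close>. This is
  identifiability in quantitative form: bounded log-ratios bound the parameter.\<close>

lemma param_recover:
  assumes "j < M0"
  shows "\<theta> j - \<theta>0 j = inner_upto M (b (Suc j)) (\<lambda>r. sqrt (p0 r) * ln (pm \<theta> r / p0 r))"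
proof -
  let ?b = "b (Suc j)"
  have "inner_upto M ?b (\<lambda>r. sqrt (p0 r) * ln (pm \<theta> r / p0 r))
     = (ln (partition_fun \<theta>0) - ln (partition_fun \<theta>)) * inner_upto M ?b (score 0)
         + (\<Sum>l<M0. (\<theta> l - \<theta>0 l) * inner_upto M ?b (score (Suc l)))"
    unfolding scaled_log_ratio by (simp add: inner_upto_add_right inner_upto_scale_right inner_upto_sum_right)
  also have "\<dots> = (\<Sum>l<M0. if l = j then \<theta> l - \<theta>0 l else 0)"
    using assms by (simp add: b_score if_distrib[of "\<lambda>c. _ * c"] eq_commute cong: if_cong)
  finally show ?thesis using assms by simp
qed

text \<open>The parameter space is not compact, but a parameter no worse than
  \<open>\<theta>0\<close> has \<open>pm \<theta>\<close> near \<open>p0\<close>, hence log-ratios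
  at most 1, hence by \<open>param_recover\<close> lies in a fixed box around
  \<open>\<theta>0\<close>, on which a minimum is attained.\<close>

lemma minimiser_exists:
  assumes adm: "admissible_phi \<phi>"
  shows "\<exists>\<delta>>0. \<forall>p. (\<Sum>r<M. p r) = 1 \<longrightarrow> wdist p p0 \<le> \<delta> \<longrightarrow>
           (\<exists>\<theta>. \<forall>\<theta>'. real_phi_div M \<phi> p (pm \<theta>) \<le> real_phi_div M \<phi> p (pm \<theta>'))"
proof -
  obtain C \<delta>1 where C: "C > 0" "\<delta>1 > 0" and near: "\<And>p \<theta>. (\<Sum>r<M. p r) = 1 \<Longrightarrow> wdist p p0 \<le> \<delta>1 \<Longrightarrow>
           real_phi_div M \<phi> p (pm \<theta>) \<le> real_phi_div M \<phi> p p0 \<Longrightarrow>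
           wdist (pm \<theta>) p0 \<le> C * wdist p p0"
    using sublevel_near[OF adm] by blast
  define \<delta> where "\<delta> = min \<delta>1 (min (1 / (2 * inv_sum)) (1 / (2 * inv_sum) / C))"
  have \<delta>: "\<delta> > 0" using C inv_sum_pos by (simp add: \<delta>_def)
  define R where "R = (\<Sum>j<M0. L2_set (b (Suc j)) {..<M} * real M)"
  \<comment> \<open>Coordinates from \<open>M0\<close> on do not influence \<open>pm\<close>;
    freezing them at \<open>\<theta>0\<close> makes the box compact in the space of all
    sequences.\<close>
  define S where "S = (\<Pi>\<^sub>E j\<in>UNIV. if j < M0 then {\<theta>0 j - R..\<theta>0 j + R} else {\<theta>0 j})"
  have R: "R \<ge> 0" unfolding R_def by (intro sum_nonneg) auto
  have "compactin (product_topology (\<lambda>_. euclidean) UNIV) S"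
    unfolding S_def compactin_PiE by auto
  then have cS: "compact S" by (simp add: euclidean_product_topology)
  have S0: "\<theta>0 \<in> S" using R by (auto simp: S_def PiE_UNIV_domain)
  have "\<exists>\<theta>. \<forall>\<theta>'. real_phi_div M \<phi> p (pm \<theta>) \<le> real_phi_div M \<phi> p (pm \<theta>')"
    if p: "(\<Sum>r<M. p r) = 1" "wdist p p0 \<le> \<delta>" for p
  proof -
    have pos: "p r > 0" if "r < M" for r using near_p0(1)[OF _ that] p by (simp add: \<delta>_def)
    have box: "(\<lambda>j. if j < M0 then \<theta> j else \<theta>0 j) \<in> S"
      if le: "real_phi_div M \<phi> p (pm \<theta>) \<le> real_phi_div M \<phi> p p0" for \<theta>
    proof -
      have "wdist (pm \<theta>) p0 \<le> C * wdist p p0" using near[OF p(1) _ le] p(2) by (simp add: \<delta>_def)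
      also have "\<dots> \<le> C * (1 / (2 * inv_sum) / C)" using p(2) C by (intro mult_left_mono) (auto simp: \<delta>_def)
      finally have d: "wdist (pm \<theta>) p0 \<le> 1 / (2 * inv_sum)" using C by simp
      let ?v = "\<lambda>r. sqrt (p0 r) * ln (pm \<theta> r / p0 r)"
      have v: "\<bar>?v r\<bar> \<le> 1" if r: "r < M" for r
      proof -
        define t where "t = pm \<theta> r / p0 r - 1"
        have t: "\<bar>t\<bar> \<le> 1/2" using near_p0(2)[OF d r] by (simp add: t_def)
        have "t\<^sup>2 \<le> (1/2)\<^sup>2" using t by (simp add: abs_le_square_iff[symmetric])
        then have "\<bar>ln (1 + t)\<bar> \<le> 1"
          using abs_ln_one_plus_x_minus_x_bound[OF t] t by (simp add: power2_eq_square)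
        moreover have "0 \<le> sqrt (p0 r)" "sqrt (p0 r) \<le> 1" using pm_pos[of \<theta>0 r] pm_le_1[OF r] by auto
        ultimately have "\<bar>sqrt (p0 r)\<bar> * \<bar>ln (1 + t)\<bar> \<le> 1 * 1" by (intro mult_mono) auto
        then show ?thesis by (simp add: abs_mult t_def)
      qed
      have "L2_set ?v {..<M} \<le> (\<Sum>r<M. \<bar>?v r\<bar>)" by (rule L2_set_le_sum_abs)
      also have "\<dots> \<le> (\<Sum>r<M. 1)" using v by (intro sum_mono) auto
      finally have V: "L2_set ?v {..<M} \<le> real M" by simp
      have "\<bar>\<theta> j - \<theta>0 j\<bar> \<le> R" if j: "j < M0" for j
      proof -
        have "\<bar>\<theta> j - \<theta>0 j\<bar> \<le> L2_set (b (Suc j)) {..<M} * L2_set ?v {..<M}"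
          unfolding param_recover[OF j] by (rule abs_inner_upto_le)
        also have "\<dots> \<le> L2_set (b (Suc j)) {..<M} * real M" using V by (intro mult_left_mono) auto
        also have "\<dots> \<le> R" unfolding R_def using j
          by (intro member_le_sum[of j "{..<M0}" "\<lambda>j. L2_set (b (Suc j)) {..<M} * real M"]) auto
        finally show ?thesis .
      qed
      then show ?thesis by (auto simp: S_def PiE_UNIV_domain abs_le_iff algebra_simps)
    qed
    have pm_restrict: "pm (\<lambda>j. if j < M0 then \<theta> j else \<theta>0 j) = pm \<theta>" for \<theta>
      by (auto simp: loglin_p_def)
    have c1: "continuous_on UNIV (\<lambda>\<theta>::nat \<Rightarrow> real. pm \<theta> r)" for r
      unfolding pm_eq partition_fun_def
      by (intro continuous_intros continuous_on_product_coordinates)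
         (use partition_fun_pos in \<open>auto simp: partition_fun_def less_le\<close>)
    have c2: "continuous_on {0<..} \<phi>"
      using admissible_DERIV(1)[OF adm] by (intro DERIV_continuous_on) (auto intro: has_field_derivative_at_within)
    have c3: "continuous_on UNIV (\<lambda>\<theta>::nat \<Rightarrow> real. \<phi> (p r / pm \<theta> r))" if "r < M" for r
      by (rule continuous_on_compose2[OF c2])
         (use pm_pos pos[OF that] in \<open>auto intro!: continuous_intros c1 simp: less_le\<close>)
    have "continuous_on UNIV (\<lambda>\<theta>. real_phi_div M \<phi> p (pm \<theta>))"
      unfolding real_phi_div_def by (intro continuous_intros c1 c3) auto
    then obtain \<theta> where \<theta>: "\<theta> \<in> S" "\<And>\<theta>'. \<theta>' \<in> S \<Longrightarrow> real_phi_div M \<phi> p (pm \<theta>) \<le> real_phi_div M \<phi> p (pm \<theta>')"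
      using continuous_attains_inf[OF cS, of "\<lambda>\<theta>. real_phi_div M \<phi> p (pm \<theta>)"] S0 continuous_on_subset
      by (metis empty_iff subset_UNIV)
    \<comment> \<open>A competitor whose box representative might leave \<open>S\<close> is already
      worse than \<open>\<theta>0\<close>, which belongs to \<open>S\<close>.\<close>
    have "real_phi_div M \<phi> p (pm \<theta>) \<le> real_phi_div M \<phi> p (pm \<theta>')" for \<theta>'
    proof (cases "real_phi_div M \<phi> p (pm \<theta>') \<le> real_phi_div M \<phi> p p0")
      case True
      then show ?thesis using \<theta>(2)[OF box[OF True]] by (simp add: pm_restrict)
    next
      case False
      then show ?thesis using \<theta>(2)[OF S0] by simp
    qed
    then show ?thesis by blast
  qed
  then show ?thesis using \<delta> by blast
qed

section \<open>The defect against the squared distance to the model\<close>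

lemma score_0: "inner_upto M (score 0) (score 0) = 1"
  using pm_sum pm_pos by (simp add: inner_upto_def score_def less_imp_le)

lemma scaled_diff_score_0:
  assumes "(\<Sum>r<M. p r) = 1" "(\<Sum>r<M. q r) = 1"
  shows "inner_upto M (score 0) (scaled_diff p q) = 0"
proof -
  have "inner_upto M (score 0) (scaled_diff p q) = (\<Sum>r<M. p r - q r)"
    unfolding inner_upto_def
    by (intro sum.cong) (use pm_pos[of \<theta>0] in \<open>auto simp: score_def scaled_diff_def less_le\<close>)
  then show ?thesis using assms by (simp add: sum_subtractf)
qed

lemma L2_e: "i < K \<Longrightarrow> L2_set (e i) {..<M} = 1"
  using e_orthonormal inner_upto_self[of M "e i"] unfolding orthonormal_upto_def
  by (auto simp: power2_eq_1_iff) (smt (verit) L2_set_nonneg)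

lemma abs_inner_e: "i < K \<Longrightarrow> \<bar>inner_upto M (e i) x\<bar> \<le> L2_set x {..<M}"
  using abs_inner_upto_le[of M "e i" x] by (simp add: L2_e)

lemma defect_le: "defect p \<le> (wdist p p0)\<^sup>2"
  unfolding defect_def wdist_def inner_upto_self[symmetric] by (rule bessel_upto[OF e_orthonormal])

text \<open>The linear part of the expansion lies in the span of \<open>score\<close>, which
  \<open>e\<close> annihilates; only the curvature is left.\<close>

lemma inner_e_scaled_diff_pm:
  assumes "i < K"
  shows "inner_upto M (e i) (scaled_diff (pm \<theta>) p0) = inner_upto M (e i) (log_rem \<theta>)"
proof -
  have "scaled_diff (pm \<theta>) p0 = (\<lambda>r. ((ln (partition_fun \<theta>0) - ln (partition_fun \<theta>)) * score 0 r
         + (\<Sum>j<M0. (\<theta> j - \<theta>0 j) * score (Suc j) r)) + log_rem \<theta> r)"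
    by (rule ext) (rule scaled_diff_expansion)
  then show ?thesis using assms
    by (simp only: inner_upto_add_right inner_upto_scale_right inner_upto_sum_right) (simp add: e_score)
qed

text \<open>Bessel's inequality keeps only the \<open>e\<close>-components. Those of
  \<open>pm \<theta>\<close> are components of \<open>log_rem\<close>, which is quadratic by
  \<open>log_rem_bound\<close>, so after dropping a square the loss is a cubic cross term.\<close>

lemma defect_lower:
  assumes "wdist (pm \<theta>) p0 \<le> 1 / (2 * inv_sum)"
  shows "defect p - 4 * real K * inv_sum * wdist p p0 * (wdist (pm \<theta>) p0)\<^sup>2 \<le> (wdist p (pm \<theta>))\<^sup>2"
proof -
  let ?a = "\<lambda>i. inner_upto M (e i) (scaled_diff p p0)" and ?r = "\<lambda>i. inner_upto M (e i) (log_rem \<theta>)"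
  have sd: "scaled_diff p (pm \<theta>) = (\<lambda>r. scaled_diff p p0 r - scaled_diff (pm \<theta>) p0 r)"
    by (auto simp: scaled_diff_def diff_divide_distrib)
  have "(\<Sum>i<K. (inner_upto M (e i) (scaled_diff p (pm \<theta>)))\<^sup>2) \<le> (wdist p (pm \<theta>))\<^sup>2"
    unfolding wdist_def inner_upto_self[symmetric] by (rule bessel_upto[OF e_orthonormal])
  also have "(\<Sum>i<K. (inner_upto M (e i) (scaled_diff p (pm \<theta>)))\<^sup>2) = (\<Sum>i<K. (?a i - ?r i)\<^sup>2)"
    unfolding sd by (intro sum.cong refl) (simp add: inner_upto_diff_right inner_e_scaled_diff_pm)
  finally have 1: "(\<Sum>i<K. (?a i - ?r i)\<^sup>2) \<le> (wdist p (pm \<theta>))\<^sup>2" .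
  have "(?a i)\<^sup>2 - 4 * inv_sum * wdist p p0 * (wdist (pm \<theta>) p0)\<^sup>2 \<le> (?a i - ?r i)\<^sup>2" if i: "i < K" for i
  proof -
    have "\<bar>?a i\<bar> * \<bar>?r i\<bar> \<le> wdist p p0 * (2 * inv_sum * (wdist (pm \<theta>) p0)\<^sup>2)"
      using abs_inner_e[OF i, of "scaled_diff p p0"] abs_inner_e[OF i, of "log_rem \<theta>"] log_rem_bound[OF assms]
      by (intro mult_mono) (auto simp: wdist_def)
    moreover have "?a i * ?r i \<le> \<bar>?a i\<bar> * \<bar>?r i\<bar>" by (metis abs_ge_self abs_mult)
    moreover have "(?a i - ?r i)\<^sup>2 \<ge> (?a i)\<^sup>2 - 2 * (?a i * ?r i)"
      by (simp add: power2_diff)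
    ultimately show ?thesis by (simp add: algebra_simps)
  qed
  then have "(\<Sum>i<K. (?a i)\<^sup>2 - 4 * inv_sum * wdist p p0 * (wdist (pm \<theta>) p0)\<^sup>2) \<le> (\<Sum>i<K. (?a i - ?r i)\<^sup>2)"
    by (intro sum_mono) auto
  then show ?thesis using 1 by (simp add: sum_subtractf defect_def mult.assoc mult.left_commute)
qed

lemma L2_set_frame_part:
  "(L2_set (\<lambda>r. \<Sum>i<K. \<alpha> i * e i r) {..<M})\<^sup>2 = (\<Sum>i<K. (\<alpha> i)\<^sup>2)"
proof -
  have "inner_upto M (e j) (\<lambda>r. \<Sum>i<K. \<alpha> i * e i r) = \<alpha> j" if j: "j < K" for j
  proof -
    have "(\<Sum>i<K. \<alpha> i * inner_upto M (e j) (e i)) = (\<Sum>i<K. if i = j then \<alpha> i else 0)"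
      using e_orthonormal j by (intro sum.cong refl) (auto simp: orthonormal_upto_def)
    then show ?thesis using j by (simp add: inner_upto_sum_right)
  qed
  note coord = this
  let ?v = "\<lambda>r. \<Sum>i<K. \<alpha> i * e i r"
  have "(L2_set ?v {..<M})\<^sup>2 = (\<Sum>i<K. \<alpha> i * inner_upto M ?v (e i))"
    unfolding inner_upto_self[symmetric] by (rule inner_upto_sum_right)
  also have "\<dots> = (\<Sum>i<K. (\<alpha> i)\<^sup>2)"
    using coord by (intro sum.cong refl) (simp add: inner_upto_commute[of M ?v] power2_eq_square)
  finally show ?thesis .
qed

text \<open>Every exponent moves by at most \<open>h\<close>, and so does the logarithm of the
  normaliser; the ratio lies between \<open>exp (- 2 * h)\<close> and \<open>exp (2 * h)\<close>.
  The bound \<open>h \<le> 1/2\<close> makes the quadratic estimate of the exponential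
  available.\<close>

lemma pm_shift_ratio:
  assumes h: "\<And>r. r < M \<Longrightarrow> \<bar>\<Sum>j<M0. W r j * c j\<bar> \<le> h" "0 \<le> h" "h \<le> 1/2" and r: "r < M"
  shows "\<bar>pm (\<lambda>j. \<theta>0 j + c j) r / p0 r - 1\<bar> \<le> 4 * h"
proof -
  define w where "w r = (\<Sum>j<M0. W r j * c j)" for r
  let ?Z = "partition_fun (\<lambda>j. \<theta>0 j + c j)" and ?Y = "partition_fun \<theta>0"
  let ?x = "\<lambda>r. exp (\<Sum>j<M0. W r j * \<theta>0 j)"
  have w: "\<bar>w s\<bar> \<le> h" if "s < M" for s using h(1)[OF that] by (simp add: w_def)
  have split: "exp (\<Sum>j<M0. W s j * (\<theta>0 j + c j)) = ?x s * exp (w s)" for s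
    by (simp add: w_def distrib_left sum.distrib exp_add)
  have Zeq: "?Z = (\<Sum>s<M. ?x s * exp (w s))" by (simp only: partition_fun_def split)
  have Z0eq: "?Y = (\<Sum>s<M. ?x s)" by (simp only: partition_fun_def)
  have Zup: "?Z \<le> exp h * ?Y"
    unfolding Zeq Z0eq sum_distrib_left
  proof (intro sum_mono)
    fix s assume "s \<in> {..<M}"
    then have "exp (w s) \<le> exp h" using w[of s] by simp
    then show "?x s * exp (w s) \<le> exp h * ?x s" by simp
  qed
  have Zlo: "exp (- h) * ?Y \<le> ?Z"
    unfolding Zeq Z0eq sum_distrib_left
  proof (intro sum_mono)
    fix s assume "s \<in> {..<M}"
    then have "exp (- h) \<le> exp (w s)" using w[of s] by simp
    then show "exp (- h) * ?x s \<le> ?x s * exp (w s)" by simp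
  qed
  have Z: "?Z > 0" "?Y > 0" by (rule partition_fun_pos)+
  have ratio: "pm (\<lambda>j. \<theta>0 j + c j) r / p0 r = exp (w r) * (?Y / ?Z)"
    unfolding pm_eq split using Z by (simp add: field_simps)
  have "?Y / ?Z \<le> exp h" using Zlo Z by (simp add: field_simps exp_minus)
  moreover have "exp (w r) \<le> exp h" using w[OF r] by simp
  ultimately have "pm (\<lambda>j. \<theta>0 j + c j) r / p0 r \<le> exp h * exp h"
    unfolding ratio using Z by (intro mult_mono) auto
  also have "\<dots> = exp (2 * h)" by (simp flip: exp_add)
  also have "\<dots> \<le> 1 + 2 * h + (2 * h)\<^sup>2" using h by (intro exp_bound) auto
  also have "(2 * h)\<^sup>2 \<le> 2 * h"
  proof -
    have "(2 * h) * (2 * h) \<le> 1 * (2 * h)" using h by (intro mult_right_mono) auto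
    then show ?thesis by (simp add: power2_eq_square)
  qed
  finally have up: "pm (\<lambda>j. \<theta>0 j + c j) r / p0 r \<le> 1 + 4 * h" by simp
  have "?Y / ?Z \<ge> exp (- h)" using Zup Z by (simp add: field_simps exp_minus)
  moreover have "exp (w r) \<ge> exp (- h)" using w[OF r] by simp
  ultimately have "exp (- h) * exp (- h) \<le> pm (\<lambda>j. \<theta>0 j + c j) r / p0 r"
    unfolding ratio using Z by (intro mult_mono) auto
  moreover have "exp (- h) * exp (- h) = exp (- 2 * h)" by (simp flip: exp_add)
  moreover have "exp (- 2 * h) \<ge> 1 + (- 2 * h)" by (rule exp_ge_add_one_self)
  ultimately show ?thesis using up h(2) by linarith
qed

text \<open>It suffices to exhibit one good competitor for the minimiser. In scaled coordinates its
  distance to \<open>p\<close> is the \<open>e\<close>-part of the deviation up to two terms bounded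
  by the norm of \<open>log_rem\<close>.\<close>

lemma defect_upper:
  "\<exists>C>0. \<exists>\<delta>>0. \<forall>p. (\<Sum>r<M. p r) = 1 \<longrightarrow> wdist p p0 \<le> \<delta> \<longrightarrow>
     (\<exists>\<theta>. wdist (pm \<theta>) p0 \<le> C * wdist p p0 \<and> (wdist p (pm \<theta>))\<^sup>2 \<le> defect p + C * wdist p p0 ^ 3)"
proof -
  \<comment> \<open>\<open>Cw * d\<close> bounds the change of every exponent; the added 1 keeps
    \<open>Cw\<close> away from 0. Then \<open>C1 * d\<close> bounds the distance of the competitor
    from \<open>p0\<close>, \<open>C2 * d^2\<close> bounds its \<open>log_rem\<close>, and
    \<open>C\<close> collects the final errors.\<close>
  define Cw where "Cw = 1 + (\<Sum>r<M. \<Sum>j<M0. \<bar>W r j\<bar> * L2_set (b (Suc j)) {..<M})"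
  have Cw: "Cw \<ge> 1" by (auto simp: Cw_def intro!: sum_nonneg)
  define C1 where "C1 = 4 * real M * Cw"
  define C2 where "C2 = 2 * inv_sum * C1\<^sup>2"
  define C where "C = C1 + 4 * C2 + 4 * C2\<^sup>2"
  \<comment> \<open>The three bounds serve to absorb \<open>d^4\<close> into \<open>d^3\<close>, to
    apply \<open>pm_shift_ratio\<close>, and to apply \<open>log_rem_bound\<close>.\<close>
  define \<delta> where "\<delta> = min 1 (min (1 / (2 * Cw)) (1 / (2 * inv_sum) / C1))"
  have C1: "C1 > 0" using Cw M_pos by (simp add: C1_def)
  have C2: "C2 > 0" using inv_sum_pos C1 by (simp add: C2_def)
  have C: "C > 0" "C1 \<le> C" using C1 C2 by (auto simp: C_def add_pos_pos)
  have \<delta>: "\<delta> > 0" using Cw C1 inv_sum_pos by (simp add: \<delta>_def)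
  have "\<exists>\<theta>. wdist (pm \<theta>) p0 \<le> C * wdist p p0 \<and> (wdist p (pm \<theta>))\<^sup>2 \<le> defect p + C * wdist p p0 ^ 3"
    if p: "(\<Sum>r<M. p r) = 1" "wdist p p0 \<le> \<delta>" for p
  proof -
    define d where "d = wdist p p0"
    define x where "x = scaled_diff p p0"
    define c where "c j = inner_upto M (b j) x" for j
    \<comment> \<open>The least squares fit in the linearised model: with these coefficients all
      \<open>score (Suc j)\<close> terms cancel in
      \<open>scaled_diff p (pm \<theta>)\<close>.\<close>
    define \<theta> where "\<theta> j = \<theta>0 j + c (Suc j)" for j
    have d: "0 \<le> d" "d \<le> 1" "Cw * d \<le> 1/2" "C1 * d \<le> 1 / (2 * inv_sum)"
    proof -
      show "0 \<le> d" "d \<le> 1" using p by (auto simp: d_def wdist_nonneg \<delta>_def)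
      have "Cw * d \<le> Cw * (1 / (2 * Cw))" using p Cw by (intro mult_left_mono) (auto simp: d_def \<delta>_def)
      then show "Cw * d \<le> 1/2" using Cw by simp
      have "C1 * d \<le> C1 * (1 / (2 * inv_sum) / C1)" using p C1 by (intro mult_left_mono) (auto simp: d_def \<delta>_def)
      then show "C1 * d \<le> 1 / (2 * inv_sum)" using C1 by simp
    qed
    have Lx: "L2_set x {..<M} = d" by (simp add: d_def x_def wdist_def)
    have wb: "\<bar>\<Sum>j<M0. W r j * c (Suc j)\<bar> \<le> Cw * d" if r: "r < M" for r
    proof -
      have "\<bar>\<Sum>j<M0. W r j * c (Suc j)\<bar> \<le> (\<Sum>j<M0. \<bar>W r j\<bar> * (L2_set (b (Suc j)) {..<M} * d))"
        using abs_inner_upto_le[of M _ x]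
        by (intro order_trans[OF sum_abs] sum_mono) (auto simp: abs_mult c_def Lx intro!: mult_left_mono)
      also have "\<dots> = (\<Sum>j<M0. \<bar>W r j\<bar> * L2_set (b (Suc j)) {..<M}) * d"
        by (simp add: sum_distrib_right mult.assoc)
      also have "\<dots> \<le> Cw * d"
      proof (intro mult_right_mono)
        have "(\<Sum>j<M0. \<bar>W r j\<bar> * L2_set (b (Suc j)) {..<M})
                \<le> (\<Sum>r<M. \<Sum>j<M0. \<bar>W r j\<bar> * L2_set (b (Suc j)) {..<M})"
          using r by (intro member_le_sum[of r "{..<M}" "\<lambda>r. \<Sum>j<M0. \<bar>W r j\<bar> * L2_set (b (Suc j)) {..<M}"])
             (auto intro!: sum_nonneg)
        then show "(\<Sum>j<M0. \<bar>W r j\<bar> * L2_set (b (Suc j)) {..<M}) \<le> Cw" by (simp add: Cw_def)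
      qed (use d in auto)
      finally show ?thesis .
    qed
    have t: "\<bar>pm \<theta> r / p0 r - 1\<bar> \<le> 4 * (Cw * d)" if "r < M" for r
      unfolding \<theta>_def[abs_def] using wb d Cw that by (intro pm_shift_ratio) auto
    have "wdist (pm \<theta>) p0 \<le> (\<Sum>r<M. \<bar>scaled_diff (pm \<theta>) p0 r\<bar>)"
      unfolding wdist_def by (rule L2_set_le_sum_abs)
    also have "\<dots> \<le> (\<Sum>r<M. 4 * (Cw * d))"
    proof (intro sum_mono)
      fix r assume "r \<in> {..<M}"
      then have r: "r < M" by simp
      have p0: "0 < p0 r" "p0 r \<le> 1" using pm_pos pm_le_1[OF r] by auto
      have "scaled_diff (pm \<theta>) p0 r = sqrt (p0 r) * (pm \<theta> r / p0 r - 1)"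
        using p0 unfolding scaled_diff_def by (simp add: field_simps flip: real_sqrt_mult)
      then have "\<bar>scaled_diff (pm \<theta>) p0 r\<bar> = sqrt (p0 r) * \<bar>pm \<theta> r / p0 r - 1\<bar>"
        using p0 by (simp add: abs_mult)
      also have "\<dots> \<le> 1 * (4 * (Cw * d))" using t[OF r] p0 by (intro mult_mono) auto
      finally show "\<bar>scaled_diff (pm \<theta>) p0 r\<bar> \<le> 4 * (Cw * d)" by simp
    qed
    also have "\<dots> = C1 * d" by (simp add: C1_def)
    finally have dq: "wdist (pm \<theta>) p0 \<le> C1 * d" .
    define \<rho> where "\<rho> = L2_set (log_rem \<theta>) {..<M}"
    have "\<rho> \<le> 2 * inv_sum * (wdist (pm \<theta>) p0)\<^sup>2"
      unfolding \<rho>_def using dq d by (intro log_rem_bound) auto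
    also have "\<dots> \<le> 2 * inv_sum * (C1 * d)\<^sup>2"
      using dq inv_sum_pos wdist_nonneg by (intro mult_left_mono power_mono) auto
    also have "\<dots> = C2 * d\<^sup>2" by (simp add: C2_def power_mult_distrib)
    finally have \<rho>: "\<rho> \<le> C2 * d\<^sup>2" .
    \<comment> \<open>The coefficient of \<open>score 0\<close> cannot be chosen freely, because the
      normaliser determines it; \<open>\<mu>\<close> is the resulting mismatch.\<close>
    define \<mu> where "\<mu> = c 0 - (ln (partition_fun \<theta>0) - ln (partition_fun \<theta>))"
    define pe where "pe r = (\<Sum>i<K. inner_upto M (e i) x * e i r)" for r
    have v: "scaled_diff p (pm \<theta>) r = pe r + (\<mu> * score 0 r + (-1) * log_rem \<theta> r)" if r: "r < M" for r
    proof -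
      have "x r = pe r + (c 0 * score 0 r + (\<Sum>j<M0. c (Suc j) * score (Suc j) r))"
        unfolding pe_def c_def by (subst frame[OF r]) (simp only: sum.lessThan_Suc_shift)
      moreover have "scaled_diff p (pm \<theta>) r = x r - scaled_diff (pm \<theta>) p0 r"
        by (simp add: x_def scaled_diff_def diff_divide_distrib)
      ultimately show ?thesis unfolding scaled_diff_expansion \<mu>_def \<theta>_def by (simp add: algebra_simps)
    qed
    \<comment> \<open>Both vectors have total mass 1, so their scaled difference is orthogonal to
      \<open>score 0\<close>; this identifies \<open>\<mu>\<close> with a component of
      \<open>log_rem\<close>.\<close>
    have "0 = inner_upto M (score 0) (scaled_diff p (pm \<theta>))"
      using scaled_diff_score_0[OF p(1) pm_sum] by simp
    also have "\<dots> = inner_upto M (score 0) (\<lambda>r. pe r + (\<mu> * score 0 r + (-1) * log_rem \<theta> r))"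
      by (rule inner_upto_cong) (use v in auto)
    also have "\<dots> = inner_upto M (score 0) pe + (\<mu> - inner_upto M (score 0) (log_rem \<theta>))"
      by (simp only: inner_upto_add_right inner_upto_scale_right score_0)
    also have "inner_upto M (score 0) pe = 0"
      unfolding pe_def[abs_def] by (simp add: inner_upto_sum_right inner_upto_commute[of M "score 0"] e_score)
    finally have "\<bar>\<mu>\<bar> = \<bar>inner_upto M (score 0) (log_rem \<theta>)\<bar>" by simp
    moreover have L0: "L2_set (score 0) {..<M} = 1"
      using score_0 unfolding inner_upto_self by (smt (verit) L2_set_nonneg power2_eq_1_iff)
    ultimately have \<mu>: "\<bar>\<mu>\<bar> \<le> \<rho>" using abs_inner_upto_le[of M "score 0" "log_rem \<theta>"] by (simp add: \<rho>_def)
    have sc: "L2_set (\<lambda>r. k * y r) {..<M} = \<bar>k\<bar> * L2_set y {..<M}" for k y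
      unfolding L2_set_def by (simp add: power_mult_distrib sum_distrib_left[symmetric] real_sqrt_mult)
    have "wdist p (pm \<theta>) = L2_set (\<lambda>r. pe r + (\<mu> * score 0 r + (-1) * log_rem \<theta> r)) {..<M}"
      unfolding wdist_def by (rule L2_set_cong) (use v in auto)
    also have "\<dots> \<le> L2_set pe {..<M} + (L2_set (\<lambda>r. \<mu> * score 0 r) {..<M} + L2_set (\<lambda>r. (-1) * log_rem \<theta> r) {..<M})"
      by (intro order_trans[OF L2_set_triangle_ineq] add_left_mono L2_set_triangle_ineq)
    also have "\<dots> \<le> L2_set pe {..<M} + 2 * \<rho>" unfolding sc using \<mu> by (simp add: L0 \<rho>_def)
    finally have wd: "wdist p (pm \<theta>) \<le> L2_set pe {..<M} + 2 * \<rho>" .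
    define s where "s = L2_set pe {..<M}"
    have s2: "s\<^sup>2 = defect p" unfolding s_def pe_def[abs_def] L2_set_frame_part defect_def x_def ..
    have s: "0 \<le> s" "s \<le> d"
      using s2 defect_le[of p] by (auto simp: s_def d_def wdist_nonneg intro: power2_le_imp_le)
    have r0: "0 \<le> \<rho>" by (simp add: \<rho>_def)
    have "(wdist p (pm \<theta>))\<^sup>2 \<le> (s + 2 * \<rho>)\<^sup>2"
      using wd wdist_nonneg unfolding s_def by (intro power_mono) auto
    also have "\<dots> = defect p + 4 * (s * \<rho>) + 4 * \<rho>\<^sup>2" unfolding s2[symmetric] by (simp add: power2_eq_square algebra_simps)
    also have "\<dots> \<le> defect p + 4 * (d * (C2 * d\<^sup>2)) + 4 * (C2 * d\<^sup>2)\<^sup>2"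
      using s r0 \<rho> d by (intro add_mono mult_left_mono mult_mono power_mono) auto
    also have "(C2 * d\<^sup>2)\<^sup>2 \<le> C2\<^sup>2 * d ^ 3"
    proof -
      have "d ^ 4 \<le> d ^ 3" using d by (intro power_decreasing) auto
      then have "C2\<^sup>2 * d ^ 4 \<le> C2\<^sup>2 * d ^ 3" by (intro mult_left_mono) auto
      then show ?thesis by (simp add: power_mult_distrib flip: power_mult)
    qed
    also have "defect p + 4 * (d * (C2 * d\<^sup>2)) + 4 * (C2\<^sup>2 * d ^ 3) = defect p + (C - C1) * d ^ 3"
      by (simp add: C_def algebra_simps power3_eq_cube power2_eq_square)
    also have "\<dots> \<le> defect p + C * d ^ 3" using C1 d by (intro add_left_mono mult_right_mono) auto
    finally have fin: "(wdist p (pm \<theta>))\<^sup>2 \<le> defect p + C * d ^ 3" by simp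
    have "C1 * d \<le> C * d" using C d by (intro mult_right_mono) auto
    then have "wdist (pm \<theta>) p0 \<le> C * d" using dq by linarith
    then show ?thesis using fin unfolding d_def by blast
  qed
  then show ?thesis using C(1) \<delta> by blast
qed

end

context loglinear_frame
begin

text \<open>A sandwich: the squared distance to the minimiser is at least the defect by
  \<open>defect_lower\<close>, and through the \<open>\<phi>2\<close>-divergence at most the squared
  distance to the competitor of \<open>defect_upper\<close>. The \<open>\<phi>1\<close>-divergence
  is compared with the former only at the end.\<close>

lemma minimum_divergence_defect:
  assumes adm1: "admissible_phi \<phi>1" and adm2: "admissible_phi \<phi>2" and "\<epsilon> > 0"
  shows "\<exists>\<delta>>0. \<forall>p \<theta>. (\<Sum>r<M. p r) = 1 \<longrightarrow> wdist p p0 \<le> \<delta> \<longrightarrow>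
           (\<forall>\<theta>'. real_phi_div M \<phi>2 p (pm \<theta>) \<le> real_phi_div M \<phi>2 p (pm \<theta>')) \<longrightarrow>
           \<bar>2 / deriv (deriv \<phi>1) 1 * real_phi_div M \<phi>1 p (pm \<theta>) - defect p\<bar> \<le> \<epsilon> * (wdist p p0)\<^sup>2"
proof -
  obtain C \<delta>1 where C: "C > 0" "\<delta>1 > 0" and near: "\<And>p \<theta>. (\<Sum>r<M. p r) = 1 \<Longrightarrow> wdist p p0 \<le> \<delta>1 \<Longrightarrow>
           real_phi_div M \<phi>2 p (pm \<theta>) \<le> real_phi_div M \<phi>2 p p0 \<Longrightarrow>
           wdist (pm \<theta>) p0 \<le> C * wdist p p0"
    using sublevel_near[OF adm2] by blast
  obtain C' \<delta>2 where C': "C' > 0" "\<delta>2 > 0" and upper: "\<And>p. (\<Sum>r<M. p r) = 1 \<Longrightarrow> wdist p p0 \<le> \<delta>2 \<Longrightarrow>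
     \<exists>\<theta>. wdist (pm \<theta>) p0 \<le> C' * wdist p p0 \<and> (wdist p (pm \<theta>))\<^sup>2 \<le> defect p + C' * wdist p p0 ^ 3"
    using defect_upper by blast
  \<comment> \<open>All distances that occur, among \<open>p\<close>, \<open>p0\<close>, the
    minimiser and the competitor, are at most \<open>B * d\<close> where they are used.\<close>
  define B where "B = 1 + C + C'"
  have B: "B \<ge> 1" "1 + C \<le> B" "1 + C' \<le> B" using C C' by (auto simp: B_def)
  \<comment> \<open>Three quadratic approximations cost \<open>\<epsilon> / 6\<close> each, and the
    cubic term costs the remaining \<open>\<epsilon> / 2\<close>.\<close>
  define \<epsilon>1 where "\<epsilon>1 = \<epsilon> / (6 * B\<^sup>2)"
  have \<epsilon>1: "\<epsilon>1 > 0" using \<open>\<epsilon> > 0\<close> B by (simp add: \<epsilon>1_def)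
  obtain \<delta>3 where \<delta>3: "\<delta>3 > 0" and quad1: "\<And>p q. wdist p p0 \<le> \<delta>3 \<Longrightarrow> wdist q p0 \<le> \<delta>3 \<Longrightarrow>
     \<bar>2 / deriv (deriv \<phi>1) 1 * real_phi_div M \<phi>1 p q - (wdist p q)\<^sup>2\<bar> \<le> \<epsilon>1 * (wdist p q)\<^sup>2"
    using real_phi_div_quadratic[OF adm1 \<epsilon>1] by blast
  obtain \<delta>4 where \<delta>4: "\<delta>4 > 0" and quad2: "\<And>p q. wdist p p0 \<le> \<delta>4 \<Longrightarrow> wdist q p0 \<le> \<delta>4 \<Longrightarrow>
     \<bar>2 / deriv (deriv \<phi>2) 1 * real_phi_div M \<phi>2 p q - (wdist p q)\<^sup>2\<bar> \<le> \<epsilon>1 * (wdist p q)\<^sup>2"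
    using real_phi_div_quadratic[OF adm2 \<epsilon>1] by blast
  \<comment> \<open>A common bound for the cubic coefficients of \<open>defect_upper\<close> and of
    \<open>defect_lower\<close> after inserting \<open>C * d\<close>.\<close>
  define L where "L = C' + 4 * real K * inv_sum * C\<^sup>2"
  have L: "L > 0" using C' inv_sum_pos by (simp add: L_def add_pos_nonneg)
  define \<delta> where "\<delta> = Min {\<delta>1, \<delta>2, \<delta>3 / B, \<delta>4 / B, 1 / (2 * inv_sum) / B, \<epsilon> / (2 * L)}"
  have \<delta>: "\<delta> > 0" using C C' \<delta>3 \<delta>4 B inv_sum_pos \<open>\<epsilon> > 0\<close> L by (simp add: \<delta>_def)
  have "\<bar>2 / deriv (deriv \<phi>1) 1 * real_phi_div M \<phi>1 p (pm \<theta>) - defect p\<bar> \<le> \<epsilon> * (wdist p p0)\<^sup>2"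
    if p: "(\<Sum>r<M. p r) = 1" "wdist p p0 \<le> \<delta>"
      and min: "\<And>\<theta>'. real_phi_div M \<phi>2 p (pm \<theta>) \<le> real_phi_div M \<phi>2 p (pm \<theta>')" for p \<theta>
  proof -
    define d where "d = wdist p p0"
    have d: "0 \<le> d" "d \<le> \<delta>1" "d \<le> \<delta>2" "B * d \<le> \<delta>3" "B * d \<le> \<delta>4" "B * d \<le> 1 / (2 * inv_sum)" "d * L \<le> \<epsilon> / 2"
    proof -
      have h: "d \<le> \<delta>1" "d \<le> \<delta>2" "d \<le> \<delta>3 / B" "d \<le> \<delta>4 / B" "d \<le> 1 / (2 * inv_sum) / B" "d \<le> \<epsilon> / (2 * L)"
        using p(2) unfolding d_def \<delta>_def by simp_all
      have Bp: "B > 0" using B by simp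
      show "0 \<le> d" by (simp add: d_def wdist_nonneg)
      show "d \<le> \<delta>1" "d \<le> \<delta>2" by (rule h)+
      show "B * d \<le> \<delta>3" "B * d \<le> \<delta>4" "B * d \<le> 1 / (2 * inv_sum)"
        using h(3-5) unfolding pos_le_divide_eq[OF Bp] by (simp_all add: mult.commute)
      show "d * L \<le> \<epsilon> / 2" using h(6) L by (simp add: field_simps)
    qed
    have scale: "c * d \<le> B * d" if "c \<le> B" for c using that d by (intro mult_right_mono) auto
    have dB: "d \<le> B * d" using scale[of 1] B by simp
    have q: "wdist (pm \<theta>) p0 \<le> C * d"
      unfolding d_def using min[of \<theta>0] p d by (intro near) (auto simp: d_def)
    have qB: "wdist (pm \<theta>) p0 \<le> B * d" using q scale[of C] B by simp
    obtain \<theta>s where s: "wdist (pm \<theta>s) p0 \<le> C' * d" and s2: "(wdist p (pm \<theta>s))\<^sup>2 \<le> defect p + C' * d ^ 3"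
      using upper[OF p(1)] d unfolding d_def by blast
    have sB: "wdist (pm \<theta>s) p0 \<le> B * d" using s scale[of C'] B by simp
    have "wdist p (pm \<theta>) \<le> (1 + C) * d"
      using wdist_triangle[of p "pm \<theta>" p0] q by (simp add: d_def wdist_commute algebra_simps)
    then have wB: "(wdist p (pm \<theta>))\<^sup>2 \<le> (B * d)\<^sup>2"
      using scale[OF B(2)] wdist_nonneg by (intro power_mono) auto
    have "wdist p (pm \<theta>s) \<le> (1 + C') * d"
      using wdist_triangle[of p "pm \<theta>s" p0] s by (simp add: d_def wdist_commute algebra_simps)
    then have wsB: "(wdist p (pm \<theta>s))\<^sup>2 \<le> (B * d)\<^sup>2"
      using scale[OF B(3)] wdist_nonneg by (intro power_mono) auto
    have err: "\<epsilon>1 * y \<le> \<epsilon> / 6 * d\<^sup>2" if "y \<le> (B * d)\<^sup>2" for y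
    proof -
      have "\<epsilon>1 * y \<le> \<epsilon>1 * (B * d)\<^sup>2" using that \<epsilon>1 by (intro mult_left_mono) auto
      also have "\<dots> = \<epsilon> / 6 * d\<^sup>2" using B by (simp add: \<epsilon>1_def power_mult_distrib)
      finally show ?thesis .
    qed
    have E1: "\<bar>2 / deriv (deriv \<phi>1) 1 * real_phi_div M \<phi>1 p (pm \<theta>) - (wdist p (pm \<theta>))\<^sup>2\<bar> \<le> \<epsilon> / 6 * d\<^sup>2"
      by (rule order_trans[OF quad1 err[OF wB]]) (use d dB qB in \<open>auto simp: d_def\<close>)
    have E2: "\<bar>2 / deriv (deriv \<phi>2) 1 * real_phi_div M \<phi>2 p (pm \<theta>) - (wdist p (pm \<theta>))\<^sup>2\<bar> \<le> \<epsilon> / 6 * d\<^sup>2"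
      by (rule order_trans[OF quad2 err[OF wB]]) (use d dB qB in \<open>auto simp: d_def\<close>)
    have E3: "\<bar>2 / deriv (deriv \<phi>2) 1 * real_phi_div M \<phi>2 p (pm \<theta>s) - (wdist p (pm \<theta>s))\<^sup>2\<bar> \<le> \<epsilon> / 6 * d\<^sup>2"
      by (rule order_trans[OF quad2 err[OF wsB]]) (use d dB sB in \<open>auto simp: d_def\<close>)
    have E4: "2 / deriv (deriv \<phi>2) 1 * real_phi_div M \<phi>2 p (pm \<theta>) \<le> 2 / deriv (deriv \<phi>2) 1 * real_phi_div M \<phi>2 p (pm \<theta>s)"
      using min[of \<theta>s] adm2 by (intro mult_left_mono) (auto simp: admissible_phi_def)
    have cubic: "k * d ^ 3 \<le> \<epsilon> / 2 * d\<^sup>2" if "k \<le> L" for k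
    proof -
      have "k * d ^ 3 \<le> L * d ^ 3" using that d by (intro mult_right_mono) auto
      also have "\<dots> = (d * L) * d\<^sup>2" by (simp add: power3_eq_cube power2_eq_square)
      also have "\<dots> \<le> \<epsilon> / 2 * d\<^sup>2" using d by (intro mult_right_mono) auto
      finally show ?thesis .
    qed
    have E5: "C' * d ^ 3 \<le> \<epsilon> / 2 * d\<^sup>2" using inv_sum_pos by (intro cubic) (simp add: L_def)
    have "defect p - 4 * real K * inv_sum * d * (wdist (pm \<theta>) p0)\<^sup>2 \<le> (wdist p (pm \<theta>))\<^sup>2"
      unfolding d_def using qB d by (intro defect_lower) auto
    moreover have "4 * real K * inv_sum * d * (wdist (pm \<theta>) p0)\<^sup>2 \<le> 4 * real K * inv_sum * d * (C * d)\<^sup>2"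
      using q d inv_sum_pos wdist_nonneg by (intro mult_left_mono power_mono) auto
    moreover have "4 * real K * inv_sum * d * (C * d)\<^sup>2 = (4 * real K * inv_sum * C\<^sup>2) * d ^ 3"
      by (simp add: power3_eq_cube power2_eq_square)
    moreover have "\<dots> \<le> \<epsilon> / 2 * d\<^sup>2" using C' by (intro cubic) (simp add: L_def)
    ultimately have E6: "defect p - \<epsilon> / 2 * d\<^sup>2 \<le> (wdist p (pm \<theta>))\<^sup>2" by linarith
    define G where "G = 2 / deriv (deriv \<phi>1) 1 * real_phi_div M \<phi>1 p (pm \<theta>)"
    define H where "H = 2 / deriv (deriv \<phi>2) 1 * real_phi_div M \<phi>2 p (pm \<theta>)"
    define J where "J = 2 / deriv (deriv \<phi>2) 1 * real_phi_div M \<phi>2 p (pm \<theta>s)"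
    define y where "y = \<epsilon> * d\<^sup>2"
    have y: "\<epsilon> / 6 * d\<^sup>2 = y / 6" "\<epsilon> / 2 * d\<^sup>2 = y / 2" "0 \<le> y" using \<open>\<epsilon> > 0\<close> by (auto simp: y_def)
    have "\<bar>G - defect p\<bar> \<le> y"
      using E1 E2 E3 E4 E5 E6 s2 unfolding G_def[symmetric] H_def[symmetric] J_def[symmetric] y using y(3)
      by linarith
    then show ?thesis unfolding G_def y_def d_def .
  qed
  then show ?thesis using \<delta> by blast
qed

end

section \<open>Weak convergence from Laplace transforms\<close>

lemma nn_integral_gamma_scaled:
  assumes a: "a > 0" and c: "c > (0::real)"
  shows "(\<integral>\<^sup>+x. ennreal (indicator {0..} x * x powr (a - 1) * exp (- c * x)) \<partial>lborel)
           = ennreal (Gamma a / c powr a)"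
proof -
  let ?g = "\<lambda>x. ennreal (indicator {0..} x * x powr (a - 1) * exp (- c * x))"
  have "ennreal (Gamma a) = (\<integral>\<^sup>+t. ennreal (indicator {0..} t * t powr (a - 1) / exp t) \<partial>lborel)"
    by (rule Gamma_conv_nn_integral_real[OF a])
  also have "\<dots> = ennreal \<bar>c\<bar> * (\<integral>\<^sup>+x. ennreal (indicator {0..} (0 + c * x) * (0 + c * x) powr (a - 1) / exp (0 + c * x)) \<partial>lborel)"
    using c by (intro nn_integral_real_affine) auto
  also have "(\<lambda>x. ennreal (indicator {0..} (0 + c * x) * (0 + c * x) powr (a - 1) / exp (0 + c * x)))
       = (\<lambda>x. ennreal (c powr (a - 1)) * ?g x)"
    using c by (auto simp: fun_eq_iff ennreal_mult'[symmetric] powr_mult exp_minus field_simps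
        zero_le_mult_iff split: split_indicator)
  also have "(\<integral>\<^sup>+x. ennreal (c powr (a - 1)) * ?g x \<partial>lborel) = ennreal (c powr (a - 1)) * integral\<^sup>N lborel ?g"
    by (rule nn_integral_cmult) auto
  also have "ennreal \<bar>c\<bar> * (ennreal (c powr (a - 1)) * integral\<^sup>N lborel ?g) = ennreal (c powr a) * integral\<^sup>N lborel ?g"
    using c by (simp add: mult.assoc[symmetric] ennreal_mult'[symmetric] powr_diff)
  finally have eq: "ennreal (Gamma a) = ennreal (c powr a) * integral\<^sup>N lborel ?g" .
  have "ennreal (Gamma a / c powr a) = ennreal (1 / c powr a) * ennreal (Gamma a)"
    using Gamma_real_pos[OF a] by (simp add: ennreal_mult'[symmetric])
  also have "\<dots> = ennreal (1 / c powr a) * ennreal (c powr a) * integral\<^sup>N lborel ?g"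
    unfolding eq by (simp add: mult.assoc)
  also have "ennreal (1 / c powr a) * ennreal (c powr a) = 1"
    using c by (simp add: ennreal_mult'[symmetric])
  finally show ?thesis by simp
qed

text \<open>Tilting the density only changes its rate from \<open>1/2\<close> to
  \<open>1/2 + l\<close>. The case \<open>l = 0\<close> is the total mass, from which
  \<open>real_distribution_chi2\<close> follows.\<close>

lemma nn_integral_chi2_exp:
  assumes k: "k \<ge> 1" and l: "l \<ge> 0"
  shows "(\<integral>\<^sup>+x. ennreal (exp (- l * x)) \<partial>chi2_distribution k) = ennreal ((1 + 2 * l) powr (- real k / 2))"
proof -
  define a where "a = real k / 2"
  have a: "a > 0" using k by (simp add: a_def)
  have G: "Gamma a > 0" by (rule Gamma_real_pos[OF a])
  have [measurable]: "chi2_density k \<in> borel_measurable borel"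
    unfolding chi2_density_def[abs_def] by measurable
  define K where "K = 1 / (2 powr a * Gamma a)"
  have K: "K \<ge> 0" using G by (simp add: K_def)
  have "(\<integral>\<^sup>+x. ennreal (exp (- l * x)) \<partial>chi2_distribution k)
      = (\<integral>\<^sup>+x. ennreal (chi2_density k x) * ennreal (exp (- l * x)) \<partial>lborel)"
    unfolding chi2_distribution_def by (subst nn_integral_density) auto
  also have "\<dots> = (\<integral>\<^sup>+x. ennreal K * ennreal (indicator {0..} x * x powr (a - 1) * exp (- (1/2 + l) * x)) \<partial>lborel)"
  proof (intro nn_integral_cong_AE)
    have "AE x in lborel. x \<noteq> (0::real)" by (rule AE_lborel_singleton)
    then show "AE x in lborel. ennreal (chi2_density k x) * ennreal (exp (- l * x))
         = ennreal K * ennreal (indicator {0..} x * x powr (a - 1) * exp (- (1/2 + l) * x))"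
    proof eventually_elim
      fix x :: real assume x: "x \<noteq> 0"
      have "chi2_density k x * exp (- l * x) = K * (indicator {0..} x * x powr (a - 1) * exp (- (1/2 + l) * x))"
        using x by (auto simp: chi2_density_def K_def a_def algebra_simps exp_add[symmetric] split: split_indicator)
      then show "ennreal (chi2_density k x) * ennreal (exp (- l * x))
         = ennreal K * ennreal (indicator {0..} x * x powr (a - 1) * exp (- (1/2 + l) * x))"
        using K by (simp add: ennreal_mult'[symmetric] ennreal_mult''[symmetric])
    qed
  qed
  also have "\<dots> = ennreal K * ennreal (Gamma a / (1/2 + l) powr a)"
    using l nn_integral_gamma_scaled[OF a, of "1/2 + l"] by (subst nn_integral_cmult) auto
  also have "\<dots> = ennreal (K * (Gamma a / (1/2 + l) powr a))"
    using K by (rule ennreal_mult'[symmetric])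
  also have "K * (Gamma a / (1/2 + l) powr a) = 1 / (2 powr a * (1/2 + l) powr a)"
    using G by (simp add: K_def)
  also have "2 powr a * (1/2 + l) powr a = (1 + 2 * l) powr a"
    using l powr_mult[of 2 "1/2 + l" a] by (simp add: distrib_left)
  also have "1 / (1 + 2 * l) powr a = (1 + 2 * l) powr (- real k / 2)"
    by (simp add: a_def powr_minus_divide)
  finally show ?thesis .
qed

lemma real_distribution_chi2: "k \<ge> 1 \<Longrightarrow> real_distribution (chi2_distribution k)"
  unfolding real_distribution_def real_distribution_axioms_def
proof (intro conjI prob_spaceI)
  assume k: "k \<ge> 1"
  show "emeasure (chi2_distribution k) (space (chi2_distribution k)) = 1"
    using nn_integral_chi2_exp[OF k, of 0] by simp
  show "sets (chi2_distribution k) = sets borel" by (simp add: chi2_distribution_def)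
qed

lemma chi2_nonneg: "AE x in chi2_distribution k. 0 \<le> x"
proof -
  have [measurable]: "chi2_density k \<in> borel_measurable borel"
    unfolding chi2_density_def[abs_def] by measurable
  show ?thesis
    unfolding chi2_distribution_def by (subst AE_density) (auto simp: chi2_density_def intro!: AE_I2)
qed

lemma integral_chi2_exp:
  assumes "k \<ge> 1" "l \<ge> 0"
  shows "(\<integral>x. exp (- l * x) \<partial>chi2_distribution k) = (1 + 2 * l) powr (- real k / 2)"
proof -
  interpret real_distribution "chi2_distribution k" by (rule real_distribution_chi2[OF assms(1)])
  show ?thesis
    by (subst integral_eq_nn_integral) (use nn_integral_chi2_exp[OF assms] in auto)
qed

text \<open>The logarithm is singular at \<open>v = 0\<close>, but \<open>cts_step x y\<close>
  vanishes from \<open>y\<close> on, so cutting \<open>v\<close> off at \<open>exp (- y)\<close>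
  changes nothing and gives a continuous function on \<open>[0,1]\<close>.\<close>

lemma cts_step_exp_extension:
  assumes "x < y"
  shows "continuous_on {0..1} (\<lambda>v. cts_step x y (- ln (max v (exp (- y)))))"
    and "cts_step x y (- ln (max (exp (- q)) (exp (- y)))) = cts_step x y q"
proof -
  have c: "continuous_on UNIV (cts_step x y)"
    using cts_step_uniformly_continuous[OF assms] by (rule uniformly_continuous_imp_continuous)
  have pos: "max v (exp (- y)) \<noteq> 0" for v
    using less_max_iff_disj[of 0 v "exp (- y)"] by force
  show "continuous_on {0..1} (\<lambda>v. cts_step x y (- ln (max v (exp (- y)))))"
    by (rule continuous_on_compose2[OF c]) (auto intro!: continuous_intros simp: pos)
  have "max (exp (- q)) (exp (- y)) = exp (- min q y)" by (auto simp: max_def min_def)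
  then show "cts_step x y (- ln (max (exp (- q)) (exp (- y)))) = cts_step x y q"
    using assms by (auto simp: cts_step_def min_def)
qed

text \<open>The substitution \<open>v = exp (- q)\<close> turns the transforms at integers into moments of a
  \<open>[0,1]\<close>-valued variable, so uniform polynomial approximation applies.\<close>

lemma laplace_imp_cts_step_conv:
  fixes Q :: "nat \<Rightarrow> 'a \<Rightarrow> real"
  assumes P: "prob_space P" and Q[measurable]: "\<And>N. Q N \<in> borel_measurable P"
    and Qpos: "\<And>N \<omega>. \<omega> \<in> space P \<Longrightarrow> 0 \<le> Q N \<omega>"
    and \<mu>: "real_distribution \<mu>" "AE x in \<mu>. 0 \<le> x"
    and lap: "\<And>m::nat. (\<lambda>N. \<integral>\<omega>. exp (- real m * Q N \<omega>) \<partial>P) \<longlonglongrightarrow> (\<integral>x. exp (- real m * x) \<partial>\<mu>)"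
    and "x < y"
  shows "(\<lambda>N. \<integral>\<omega>. cts_step x y (Q N \<omega>) \<partial>P) \<longlonglongrightarrow> (\<integral>z. cts_step x y z \<partial>\<mu>)"
proof (rule LIMSEQ_I)
  fix r :: real assume r: "r > 0"
  interpret P: prob_space P by (rule P)
  interpret \<mu>: real_distribution \<mu> by (rule \<mu>(1))
  define f where "f v = cts_step x y (- ln (max v (exp (- y))))" for v
  have fq: "f (exp (- q)) = cts_step x y q" for q
    unfolding f_def by (rule cts_step_exp_extension(2)[OF \<open>x < y\<close>])
  have "continuous_on {0..1} f"
    unfolding f_def by (rule cts_step_exp_extension(1)[OF \<open>x < y\<close>])
  then obtain g where g: "real_polynomial_function g" and fg: "\<And>v. v \<in> {0..1} \<Longrightarrow> \<bar>f v - g v\<bar> < r / 3"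
    using Stone_Weierstrass_real_polynomial_function[of "{0..1::real}" f "r/3"] r by auto
  obtain a and n :: nat where ga: "g = (\<lambda>v. \<Sum>i\<le>n. a i * v ^ i)"
    using real_polynomial_function_imp_sum[OF g] by blast
  have gexp: "g (exp (- q)) = (\<Sum>i\<le>n. a i * exp (- real i * q))" for q
    unfolding ga by (simp add: exp_of_nat_mult[symmetric])
  have [measurable]: "cts_step x y \<in> borel_measurable borel"
    unfolding cts_step_def[abs_def] by measurable
  have bnd: "\<bar>cts_step x y q\<bar> \<le> 1" for q using \<open>x < y\<close> by (auto simp: cts_step_def)
  have intP: "integrable P (\<lambda>\<omega>. exp (- real i * Q N \<omega>))" for i N
    by (rule P.integrable_const_bound[of _ 1]) (auto intro!: AE_I2 simp: Qpos)
  have int\<mu>: "integrable \<mu> (\<lambda>z. exp (- real i * z))" for i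
    by (rule \<mu>.integrable_const_bound[of _ 1]) (use \<mu>(2) in \<open>auto elim!: eventually_mono\<close>)
  have intPf: "integrable P (\<lambda>\<omega>. cts_step x y (Q N \<omega>))" for N
    by (rule P.integrable_const_bound[of _ 1]) (auto intro!: AE_I2 simp: bnd)
  have int\<mu>f: "integrable \<mu> (cts_step x y)"
    by (rule \<mu>.integrable_const_bound[of _ 1]) (auto intro!: AE_I2 simp: bnd)
  have 1: "\<bar>(\<integral>\<omega>. cts_step x y (Q N \<omega>) \<partial>P) - (\<Sum>i\<le>n. a i * (\<integral>\<omega>. exp (- real i * Q N \<omega>) \<partial>P))\<bar> \<le> r / 3" for N
  proof -
    have "(\<integral>\<omega>. cts_step x y (Q N \<omega>) \<partial>P) - (\<Sum>i\<le>n. a i * (\<integral>\<omega>. exp (- real i * Q N \<omega>) \<partial>P))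
      = (\<integral>\<omega>. cts_step x y (Q N \<omega>) - (\<Sum>i\<le>n. a i * exp (- real i * Q N \<omega>)) \<partial>P)"
      using intP intPf by (subst Bochner_Integration.integral_diff) auto
    also have "\<bar>\<dots>\<bar> \<le> (\<integral>\<omega>. \<bar>cts_step x y (Q N \<omega>) - (\<Sum>i\<le>n. a i * exp (- real i * Q N \<omega>))\<bar> \<partial>P)"
      by (rule integral_abs_bound)
    also have "\<dots> \<le> (\<integral>\<omega>. r / 3 \<partial>P)"
    proof (rule integral_mono_AE)
      show "AE \<omega> in P. \<bar>cts_step x y (Q N \<omega>) - (\<Sum>i\<le>n. a i * exp (- real i * Q N \<omega>))\<bar> \<le> r / 3"
        unfolding fq[symmetric] gexp[symmetric] using Qpos by (intro AE_I2 less_imp_le fg) auto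
    qed (use intP intPf in auto)
    finally show ?thesis by (simp add: P.prob_space)
  qed
  have 2: "\<bar>(\<integral>z. cts_step x y z \<partial>\<mu>) - (\<Sum>i\<le>n. a i * (\<integral>z. exp (- real i * z) \<partial>\<mu>))\<bar> \<le> r / 3"
  proof -
    have "(\<integral>z. cts_step x y z \<partial>\<mu>) - (\<Sum>i\<le>n. a i * (\<integral>z. exp (- real i * z) \<partial>\<mu>))
      = (\<integral>z. cts_step x y z - (\<Sum>i\<le>n. a i * exp (- real i * z)) \<partial>\<mu>)"
      using int\<mu> int\<mu>f by (subst Bochner_Integration.integral_diff) auto
    also have "\<bar>\<dots>\<bar> \<le> (\<integral>z. \<bar>cts_step x y z - (\<Sum>i\<le>n. a i * exp (- real i * z))\<bar> \<partial>\<mu>)"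
      by (rule integral_abs_bound)
    also have "\<dots> \<le> (\<integral>z. r / 3 \<partial>\<mu>)"
    proof (rule integral_mono_AE)
      show "AE z in \<mu>. \<bar>cts_step x y z - (\<Sum>i\<le>n. a i * exp (- real i * z))\<bar> \<le> r / 3"
        using \<mu>(2)
      proof eventually_elim
        fix z :: real assume "0 \<le> z"
        then show "\<bar>cts_step x y z - (\<Sum>i\<le>n. a i * exp (- real i * z))\<bar> \<le> r / 3"
          unfolding fq[symmetric, of z] gexp[symmetric] by (intro less_imp_le fg) auto
      qed
    qed (use int\<mu> int\<mu>f in auto)
    finally show ?thesis using \<mu>.prob_space by simp
  qed
  have "(\<lambda>N. \<Sum>i\<le>n. a i * (\<integral>\<omega>. exp (- real i * Q N \<omega>) \<partial>P)) \<longlonglongrightarrow> (\<Sum>i\<le>n. a i * (\<integral>z. exp (- real i * z) \<partial>\<mu>))"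
    by (intro tendsto_sum tendsto_mult_left lap)
  from LIMSEQ_D[OF this, of "r / 3"] r obtain n0 where 3: "\<And>N. N \<ge> n0 \<Longrightarrow> \<bar>(\<Sum>i\<le>n. a i * (\<integral>\<omega>. exp (- real i * Q N \<omega>) \<partial>P))
      - (\<Sum>i\<le>n. a i * (\<integral>z. exp (- real i * z) \<partial>\<mu>))\<bar> < r / 3"
    by (auto simp: real_norm_def)
  show "\<exists>n0. \<forall>N\<ge>n0. norm ((\<integral>\<omega>. cts_step x y (Q N \<omega>) \<partial>P) - (\<integral>z. cts_step x y z \<partial>\<mu>)) < r"
  proof (intro exI allI impI)
    fix N assume "N \<ge> n0"
    from 1[of N] 2 3[OF this]
    show "norm ((\<integral>\<omega>. cts_step x y (Q N \<omega>) \<partial>P) - (\<integral>z. cts_step x y z \<partial>\<mu>)) < r"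
      unfolding real_norm_def by linarith
  qed
qed

text \<open>\<open>cts_step x y\<close> has values in \<open>[0,1]\<close> and Lipschitz constant
  \<open>1 / (y - x)\<close>; its means differ by a small amount plus the probability that
  \<open>R N\<close> and \<open>Q N\<close> are far apart.\<close>

lemma slutsky_weak_conv:
  fixes Q R :: "nat \<Rightarrow> 'a \<Rightarrow> real"
  assumes P: "prob_space P" and Q[measurable]: "\<And>N. Q N \<in> borel_measurable P"
    and R[measurable]: "\<And>N. R N \<in> borel_measurable P"
    and \<mu>: "real_distribution \<mu>"
    and conv: "\<And>x y. x < y \<Longrightarrow> (\<lambda>N. \<integral>\<omega>. cts_step x y (Q N \<omega>) \<partial>P) \<longlonglongrightarrow> (\<integral>z. cts_step x y z \<partial>\<mu>)"
    and close: "\<And>\<epsilon>. \<epsilon> > 0 \<Longrightarrow> (\<lambda>N. measure P {\<omega> \<in> space P. \<epsilon> < \<bar>R N \<omega> - Q N \<omega>\<bar>}) \<longlonglongrightarrow> 0"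
  shows "weak_conv_m (\<lambda>N. distr P borel (R N)) \<mu>"
proof (rule integral_cts_step_conv_imp_weak_conv[OF _ \<mu>])
  interpret P: prob_space P by (rule P)
  show "real_distribution (distr P borel (R N))" for N by auto
  fix x y :: real assume xy: "x < y"
  have [measurable]: "cts_step x y \<in> borel_measurable borel"
    unfolding cts_step_def[abs_def] by measurable
  have bnd: "0 \<le> cts_step x y q" "cts_step x y q \<le> 1" for q using xy by (auto simp: cts_step_def)
  have lip: "\<bar>cts_step x y u - cts_step x y v\<bar> \<le> \<bar>u - v\<bar> / (y - x)" for u v
  proof -
    have clamp: "cts_step x y q = min 1 (max 0 ((y - q) / (y - x)))" for q
      using xy by (auto simp: cts_step_def min_def max_def divide_simps)
    have "(y - u) / (y - x) - (y - v) / (y - x) = (v - u) / (y - x)"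
      by (simp add: diff_divide_distrib[symmetric])
    then have "\<bar>(y - u) / (y - x) - (y - v) / (y - x)\<bar> = \<bar>u - v\<bar> / (y - x)"
      using xy by (simp add: abs_minus_commute)
    then show ?thesis unfolding clamp by (auto simp: min_def max_def abs_if split: if_splits)
  qed
  have int: "integrable P (\<lambda>\<omega>. cts_step x y (h \<omega>))" if [measurable]: "h \<in> borel_measurable P" for h
    by (rule P.integrable_const_bound[of _ 1]) (auto intro!: AE_I2 simp: bnd)
  have diff: "(\<lambda>N. (\<integral>\<omega>. cts_step x y (R N \<omega>) \<partial>P) - (\<integral>\<omega>. cts_step x y (Q N \<omega>) \<partial>P)) \<longlonglongrightarrow> 0"
  proof (rule LIMSEQ_I)
    fix r :: real assume r: "r > 0"
    define \<epsilon> where "\<epsilon> = r / 2 * (y - x)"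
    have \<epsilon>: "\<epsilon> > 0" using r xy by (simp add: \<epsilon>_def)
    have intB: "integrable P (indicat_real {\<omega> \<in> space P. \<epsilon> < \<bar>R N \<omega> - Q N \<omega>\<bar>})" for N
      by (rule P.integrable_const_bound[of _ 1]) (auto split: split_indicator)
    let ?B = "\<lambda>N. {\<omega> \<in> space P. \<epsilon> < \<bar>R N \<omega> - Q N \<omega>\<bar>}"
    obtain n0 where n0: "\<And>N. N \<ge> n0 \<Longrightarrow> measure P (?B N) < r / 2"
      using LIMSEQ_D[OF close[OF \<epsilon>], of "r/2"] r by auto
    have "\<bar>(\<integral>\<omega>. cts_step x y (R N \<omega>) \<partial>P) - (\<integral>\<omega>. cts_step x y (Q N \<omega>) \<partial>P)\<bar> < r" if N: "N \<ge> n0" for N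
    proof -
      have "(\<integral>\<omega>. cts_step x y (R N \<omega>) \<partial>P) - (\<integral>\<omega>. cts_step x y (Q N \<omega>) \<partial>P)
        = (\<integral>\<omega>. cts_step x y (R N \<omega>) - cts_step x y (Q N \<omega>) \<partial>P)"
        by (subst Bochner_Integration.integral_diff) (auto intro!: int)
      also have "\<bar>\<dots>\<bar> \<le> (\<integral>\<omega>. \<bar>cts_step x y (R N \<omega>) - cts_step x y (Q N \<omega>)\<bar> \<partial>P)"
        by (rule integral_abs_bound)
      also have "\<dots> \<le> (\<integral>\<omega>. r / 2 + indicator (?B N) \<omega> \<partial>P)"
      proof (rule integral_mono_AE)
        show "AE \<omega> in P. \<bar>cts_step x y (R N \<omega>) - cts_step x y (Q N \<omega>)\<bar> \<le> r / 2 + indicator (?B N) \<omega>"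
        proof (rule AE_I2)
          fix \<omega> assume \<omega>: "\<omega> \<in> space P"
          show "\<bar>cts_step x y (R N \<omega>) - cts_step x y (Q N \<omega>)\<bar> \<le> r / 2 + indicator (?B N) \<omega>"
          proof (cases "\<omega> \<in> ?B N")
            case True
            then show ?thesis using bnd[of "R N \<omega>"] bnd[of "Q N \<omega>"] r by simp
          next
            case False
            then have "\<bar>R N \<omega> - Q N \<omega>\<bar> / (y - x) \<le> \<epsilon> / (y - x)" using \<omega> xy by (intro divide_right_mono) auto
            also have "\<dots> = r / 2" unfolding \<epsilon>_def using xy by (intro nonzero_mult_div_cancel_right) simp
            finally have "\<bar>cts_step x y (R N \<omega>) - cts_step x y (Q N \<omega>)\<bar> \<le> r / 2"
              by (rule order_trans[OF lip])
            then show ?thesis using False by simp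
          qed
        qed
      qed (auto intro!: int intB integrable_abs Bochner_Integration.integrable_diff Bochner_Integration.integrable_add)
      also have "\<dots> = r / 2 + measure P (?B N)" by (subst Bochner_Integration.integral_add) (auto simp: P.prob_space intB)
      finally show ?thesis using n0[OF N] by linarith
    qed
    then show "\<exists>n0. \<forall>N\<ge>n0. norm ((\<integral>\<omega>. cts_step x y (R N \<omega>) \<partial>P) - (\<integral>\<omega>. cts_step x y (Q N \<omega>) \<partial>P) - 0) < r"
      by (intro exI[of _ n0]) auto
  qed
  have "(\<lambda>N. \<integral>\<omega>. cts_step x y (R N \<omega>) \<partial>P) \<longlonglongrightarrow> (\<integral>z. cts_step x y z \<partial>\<mu>)"
    using tendsto_add[OF diff conv[OF xy]] by simp
  then show "(\<lambda>N. integral\<^sup>L (distr P borel (R N)) (cts_step x y)) \<longlonglongrightarrow> integral\<^sup>L \<mu> (cts_step x y)"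
    by (simp add: integral_distr)
qed

section \<open>Quadratic forms of normalised sums\<close>

text \<open>The tilted density is \<open>\<sigma>\<close> times the centred normal density with
  variance \<open>1 / (1 + 2 * l)\<close>.\<close>

lemma integral_std_normal_exp_sq:
  assumes "l \<ge> 0"
  shows "(\<integral>g. exp (- l * g\<^sup>2) \<partial>std_normal_distribution) = (1 + 2 * l) powr (- 1 / 2)"
proof -
  define \<sigma> where "\<sigma> = 1 / sqrt (1 + 2 * l)"
  have \<sigma>: "\<sigma> > 0" "\<sigma>\<^sup>2 = 1 / (1 + 2 * l)" using assms by (auto simp: \<sigma>_def power_divide)
  have "(\<integral>g. exp (- l * g\<^sup>2) \<partial>std_normal_distribution)
      = (\<integral>g. std_normal_density g * exp (- l * g\<^sup>2) \<partial>lborel)"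
    by (subst integral_density) (auto simp: normal_density_def)
  also have "(\<lambda>g. std_normal_density g * exp (- l * g\<^sup>2)) = (\<lambda>g. \<sigma> * normal_density 0 \<sigma> g)"
  proof
    fix g :: real
    have "sqrt (2 * pi * \<sigma>\<^sup>2) = sqrt (2 * pi) * \<sigma>" using \<sigma>(1) by (simp add: real_sqrt_mult)
    moreover have "- (g - 0)\<^sup>2 / (2 * \<sigma>\<^sup>2) = - g\<^sup>2 / 2 + - l * g\<^sup>2"
      using assms unfolding \<sigma>(2) by (simp add: field_simps)
    ultimately show "std_normal_density g * exp (- l * g\<^sup>2) = \<sigma> * normal_density 0 \<sigma> g"
      using \<sigma>(1) unfolding normal_density_def by (simp add: exp_add[symmetric])
  qed
  also have "(\<integral>g. \<sigma> * normal_density 0 \<sigma> g \<partial>lborel) = \<sigma>" using \<sigma>(1) by simp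
  also have "\<sigma> = (1 + 2 * l) powr (- 1 / 2)"
    using assms by (simp add: \<sigma>_def powr_minus_divide powr_half_sqrt)
  finally show ?thesis .
qed

text \<open>Writing \<open>exp (- l s\<^sup>2)\<close> as the characteristic function of a Gaussian evaluated at
  \<open>sqrt (2 l) s\<close> linearises the quadratic form, so the univariate central limit theorem suffices.\<close>

lemma (in prob_space) laplace_quadratic_form:
  fixes S :: "nat \<Rightarrow> nat \<Rightarrow> 'a \<Rightarrow> real"
  assumes S[measurable]: "\<And>N i. i < K \<Longrightarrow> S N i \<in> borel_measurable M"
    and char: "\<And>t. (\<lambda>N. \<integral>\<omega>. iexp (\<Sum>i<K. t i * S N i \<omega>) \<partial>M)
                 \<longlonglongrightarrow> complex_of_real (exp (- (\<Sum>i<K. (t i)\<^sup>2) / 2))"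
    and l: "l \<ge> 0"
  shows "(\<lambda>N. \<integral>\<omega>. exp (- l * (\<Sum>i<K. (S N i \<omega>)\<^sup>2)) \<partial>M) \<longlonglongrightarrow> (1 + 2 * l) powr (- real K / 2)"
proof -
  \<comment> \<open>Chosen so that \<open>(c * s)^2 / 2 = l * s^2\<close> in the normal
    characteristic function.\<close>
  define c where "c = sqrt (2 * l)"
  have c2: "c\<^sup>2 = 2 * l" using l by (simp add: c_def)
  let ?n = "std_normal_distribution"
  define G where "G = Pi\<^sub>M {..<K} (\<lambda>_. ?n)"
  interpret n: prob_space ?n by (rule prob_space_normal_density) simp
  interpret Gp: product_prob_space "\<lambda>_. ?n" "{..<K}" ..
  interpret G: prob_space G unfolding G_def by (rule Gp.prob_space_P) auto
  interpret PG: pair_prob_space M G ..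
  have comp[measurable]: "(\<lambda>g. g i) \<in> borel_measurable G" if "i < K" for i
  proof -
    have "(\<lambda>g. g i) \<in> measurable G ?n"
      unfolding G_def using that by (intro measurable_component_singleton) simp
    then show ?thesis by simp
  qed
  define F where "F N \<omega> g = iexp (\<Sum>i<K. c * g i * S N i \<omega>)" for N \<omega> and g :: "nat \<Rightarrow> real"
  have Fm: "(\<lambda>(\<omega>, g). F N \<omega> g) \<in> borel_measurable (M \<Otimes>\<^sub>M G)" for N
  proof -
    have "(\<lambda>x. \<Sum>i<K. c * (snd x) i * S N i (fst x)) \<in> borel_measurable (M \<Otimes>\<^sub>M G)"
    proof (intro borel_measurable_sum borel_measurable_times borel_measurable_const)
      fix i assume "i \<in> {..<K}"
      then have i: "i < K" by simp
      show "(\<lambda>x. snd x i) \<in> borel_measurable (M \<Otimes>\<^sub>M G)"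
        using measurable_compose[OF measurable_snd comp[OF i]] .
      show "(\<lambda>x. S N i (fst x)) \<in> borel_measurable (M \<Otimes>\<^sub>M G)"
        using measurable_compose[OF measurable_fst S[OF i]] .
    qed
    then show ?thesis unfolding F_def case_prod_beta by measurable
  qed
  have norm_F: "norm (F N \<omega> g) = 1" for N \<omega> g unfolding F_def by (rule norm_exp_i_times)
  have inner: "(\<integral>g. F N \<omega> g \<partial>G) = complex_of_real (exp (- l * (\<Sum>i<K. (S N i \<omega>)\<^sup>2)))" for N \<omega>
  proof -
    have "F N \<omega> g = (\<Prod>i<K. iexp ((c * S N i \<omega>) * g i))" for g
      unfolding F_def by (simp add: exp_sum[symmetric] sum_distrib_left mult_ac)
    then have "(\<integral>g. F N \<omega> g \<partial>G) = (\<Prod>i<K. \<integral>x. iexp ((c * S N i \<omega>) * x) \<partial>?n)"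
      unfolding G_def by (simp only:) (rule Gp.product_integral_prod, auto intro!: n.integrable_const_bound[of _ 1])
    also have "\<dots> = (\<Prod>i<K. complex_of_real (exp (- (c * S N i \<omega>)\<^sup>2 / 2)))"
      using char_std_normal_distribution unfolding char_def fun_eq_iff by (intro prod.cong refl) metis
    also have "\<dots> = complex_of_real (exp (\<Sum>i<K. - (c * S N i \<omega>)\<^sup>2 / 2))"
      by (simp only: of_real_prod[symmetric] exp_sum finite_lessThan)
    also have "(\<Sum>i<K. - (c * S N i \<omega>)\<^sup>2 / 2) = - l * (\<Sum>i<K. (S N i \<omega>)\<^sup>2)"
      by (simp add: power_mult_distrib c2 sum_distrib_left sum_negf)
    finally show ?thesis .
  qed
  \<comment> \<open>With the Gaussian average outermost, the hypothesis \<open>char\<close> applies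
    for each fixed \<open>g\<close>, and the integrand bound 1 permits dominated
    convergence.\<close>
  have swap: "complex_of_real (\<integral>\<omega>. exp (- l * (\<Sum>i<K. (S N i \<omega>)\<^sup>2)) \<partial>M) = (\<integral>g. (\<integral>\<omega>. F N \<omega> g \<partial>M) \<partial>G)" for N
  proof -
    have "complex_of_real (\<integral>\<omega>. exp (- l * (\<Sum>i<K. (S N i \<omega>)\<^sup>2)) \<partial>M) = (\<integral>\<omega>. (\<integral>g. F N \<omega> g \<partial>G) \<partial>M)"
      unfolding inner by simp
    also have "\<dots> = (\<integral>g. (\<integral>\<omega>. F N \<omega> g \<partial>M) \<partial>G)"
      by (rule PG.Fubini_integral[symmetric], rule PG.integrable_const_bound[of _ 1])
         (use Fm in \<open>auto simp: norm_F intro!: AE_I2\<close>)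
    finally show ?thesis .
  qed
  have lim: "(\<lambda>N. \<integral>\<omega>. F N \<omega> g \<partial>M) \<longlonglongrightarrow> complex_of_real (exp (- (\<Sum>i<K. (c * g i)\<^sup>2) / 2))" for g
    unfolding F_def using char[of "\<lambda>i. c * g i"] .
  have "(\<lambda>N. \<integral>g. (\<integral>\<omega>. F N \<omega> g \<partial>M) \<partial>G) \<longlonglongrightarrow> (\<integral>g. complex_of_real (exp (- (\<Sum>i<K. (c * g i)\<^sup>2) / 2)) \<partial>G)"
  proof (rule integral_dominated_convergence[where w="\<lambda>_. 1"])
    show "(\<lambda>g. complex_of_real (exp (- (\<Sum>i<K. (c * g i)\<^sup>2) / 2))) \<in> borel_measurable G"
      by measurable
    show "(\<lambda>g. \<integral>\<omega>. F N \<omega> g \<partial>M) \<in> borel_measurable G" for N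
    proof (rule borel_measurable_lebesgue_integral)
      show "(\<lambda>(g, \<omega>). F N \<omega> g) \<in> borel_measurable (G \<Otimes>\<^sub>M M)"
        using measurable_compose[OF measurable_pair_swap' Fm[of N]] by (simp add: case_prod_beta)
    qed
    show "AE g in G. norm (\<integral>\<omega>. F N \<omega> g \<partial>M) \<le> 1" for N
    proof (rule AE_I2)
      fix g
      have "norm (\<integral>\<omega>. F N \<omega> g \<partial>M) \<le> (\<integral>\<omega>. norm (F N \<omega> g) \<partial>M)" by (rule integral_norm_bound)
      then show "norm (\<integral>\<omega>. F N \<omega> g \<partial>M) \<le> 1" by (simp add: norm_F prob_space)
    qed
  qed (use lim in auto)
  also have "(\<integral>g. complex_of_real (exp (- (\<Sum>i<K. (c * g i)\<^sup>2) / 2)) \<partial>G)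
     = complex_of_real (\<integral>g. (\<Prod>i<K. exp (- l * (g i)\<^sup>2)) \<partial>G)"
  proof -
    have "exp (- (\<Sum>i<K. (c * g i)\<^sup>2) / 2) = (\<Prod>i<K. exp (- l * (g i)\<^sup>2))" for g :: "nat \<Rightarrow> real"
      by (simp add: exp_sum[symmetric] power_mult_distrib c2 sum_negf sum_distrib_left[symmetric])
    then show ?thesis by (simp only: integral_complex_of_real)
  qed
  also have "(\<integral>g. (\<Prod>i<K. exp (- l * (g i)\<^sup>2)) \<partial>G) = (\<Prod>i<K. \<integral>x. exp (- l * x\<^sup>2) \<partial>?n)"
    unfolding G_def by (rule Gp.product_integral_prod) (use l in \<open>auto intro!: n.integrable_const_bound[of _ 1]\<close>)
  also have "\<dots> = (1 + 2 * l) powr (- real K / 2)"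
    unfolding integral_std_normal_exp_sq[OF l] using l by (simp add: powr_realpow[symmetric] powr_powr)
  finally show ?thesis unfolding swap[symmetric] tendsto_of_real_iff .
qed

text \<open>Evaluating at frequency \<open>\<sigma>\<close> undoes the normalisation of the central
  limit theorem. The degenerate case \<open>v = 0\<close> is handled directly; it occurs for the
  zero vector \<open>t\<close> in \<open>chi_stat_char\<close>.\<close>

lemma (in prob_space) clt_char:
  fixes X :: "nat \<Rightarrow> 'a \<Rightarrow> real"
  assumes indep: "indep_vars (\<lambda>_. borel) X UNIV"
    and mean: "\<And>l. expectation (X l) = 0" and var: "\<And>l. expectation (\<lambda>\<omega>. (X l \<omega>)\<^sup>2) = v"
    and sq: "\<And>l. integrable M (\<lambda>\<omega>. (X l \<omega>)\<^sup>2)"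
    and ident: "\<And>l. distr M borel (X l) = \<mu>" and v: "v \<ge> 0"
  shows "(\<lambda>N. \<integral>\<omega>. iexp ((\<Sum>l<N. X l \<omega>) / sqrt (real N)) \<partial>M) \<longlonglongrightarrow> complex_of_real (exp (- v / 2))"
proof -
  have X[measurable]: "X l \<in> borel_measurable M" for l using indep by (auto simp: indep_vars_def)
  show ?thesis
  proof (cases "v = 0")
    case True
    have "AE \<omega> in M. \<forall>l. X l \<omega> = 0"
    proof (subst AE_all_countable, rule allI)
      fix l
      have "AE \<omega> in M. (X l \<omega>)\<^sup>2 = 0"
        using integral_nonneg_eq_0_iff_AE[OF sq[of l]] var[of l] True by auto
      then show "AE \<omega> in M. X l \<omega> = 0" by simp
    qed
    then have "(\<integral>\<omega>. iexp ((\<Sum>l<N. X l \<omega>) / sqrt (real N)) \<partial>M) = (\<integral>\<omega>. 1 \<partial>M)" for N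
      by (intro integral_cong_AE) (auto elim!: eventually_mono)
    then show ?thesis using True by (simp add: prob_space)
  next
    case False
    define \<sigma> where "\<sigma> = sqrt v"
    have \<sigma>: "\<sigma> > 0" "\<sigma>\<^sup>2 = v" using v False by (auto simp: \<sigma>_def)
    have "weak_conv_m (\<lambda>N. distr M borel (\<lambda>\<omega>. (\<Sum>l<N. X l \<omega>) / sqrt (real N * \<sigma>\<^sup>2))) std_normal_distribution"
      by (rule central_limit_theorem_zero_mean[OF indep mean \<sigma>(1) sq _ ident]) (simp add: mean var \<sigma>(2))
    then have "(\<lambda>N. char (distr M borel (\<lambda>\<omega>. (\<Sum>l<N. X l \<omega>) / sqrt (real N * \<sigma>\<^sup>2))) \<sigma>) \<longlonglongrightarrow> char std_normal_distribution \<sigma>"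
      by (intro levy_continuity1) (auto intro!: real_dist_normal_dist)
    also have "char std_normal_distribution \<sigma> = complex_of_real (exp (- v / 2))"
      by (simp add: char_std_normal_distribution \<sigma>(2))
    also have "(\<lambda>N. char (distr M borel (\<lambda>\<omega>. (\<Sum>l<N. X l \<omega>) / sqrt (real N * \<sigma>\<^sup>2))) \<sigma>)
        = (\<lambda>N. \<integral>\<omega>. iexp ((\<Sum>l<N. X l \<omega>) / sqrt (real N)) \<partial>M)"
    proof
      fix N
      have "\<sigma> * ((\<Sum>l<N. X l \<omega>) / sqrt (real N * \<sigma>\<^sup>2)) = (\<Sum>l<N. X l \<omega>) / sqrt (real N)" for \<omega>
        using \<sigma>(1) by (simp add: real_sqrt_mult)
      then show "char (distr M borel (\<lambda>\<omega>. (\<Sum>l<N. X l \<omega>) / sqrt (real N * \<sigma>\<^sup>2))) \<sigma>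
        = (\<integral>\<omega>. iexp ((\<Sum>l<N. X l \<omega>) / sqrt (real N)) \<partial>M)"
        unfolding char_def by (subst integral_distr) (auto simp del: of_real_mult of_real_divide of_real_sum)
    qed
    finally show ?thesis .
  qed
qed

text \<open>Independence and centring remove the cross term in each induction step, so the second
  moment grows only linearly in \<open>N\<close>.\<close>

lemma (in prob_space) sum_second_moment:
  fixes X :: "nat \<Rightarrow> 'a \<Rightarrow> real"
  assumes indep: "indep_vars (\<lambda>_. borel) X UNIV"
    and mean: "\<And>l. expectation (X l) = 0" and bnd: "\<And>l \<omega>. \<omega> \<in> space M \<Longrightarrow> \<bar>X l \<omega>\<bar> \<le> B"
  shows "expectation (\<lambda>\<omega>. (\<Sum>l<N. X l \<omega>)\<^sup>2) \<le> real N * B\<^sup>2"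
proof (induction N)
  case (Suc N)
  have X[measurable]: "X l \<in> borel_measurable M" for l using indep by (auto simp: indep_vars_def)
  define S where "S \<omega> = (\<Sum>l<N. X l \<omega>)" for \<omega>
  have [measurable]: "S \<in> borel_measurable M" unfolding S_def by measurable
  have Sb: "\<bar>S \<omega>\<bar> \<le> real N * B" if "\<omega> \<in> space M" for \<omega>
    unfolding S_def using sum_bounded_above[of "{..<N}" "\<lambda>l. \<bar>X l \<omega>\<bar>" B] bnd[OF that]
    by (intro order_trans[OF sum_abs]) auto
  have sq: "x\<^sup>2 \<le> b\<^sup>2" if "\<bar>x\<bar> \<le> b" for x b :: real using that by (simp add: abs_le_square_iff[symmetric])
  have iX: "integrable M (X N)" by (rule integrable_const_bound[of _ B]) (auto intro!: AE_I2 bnd)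
  have iS: "integrable M S" by (rule integrable_const_bound[of _ "real N * B"]) (auto intro!: AE_I2 Sb)
  have iX2: "integrable M (\<lambda>\<omega>. (X N \<omega>)\<^sup>2)"
    by (rule integrable_const_bound[of _ "B\<^sup>2"]) (auto intro!: AE_I2 sq bnd)
  have iS2: "integrable M (\<lambda>\<omega>. (S \<omega>)\<^sup>2)"
    by (rule integrable_const_bound[of _ "(real N * B)\<^sup>2"]) (auto intro!: AE_I2 sq Sb)
  have ind: "indep_var borel (X N) borel S"
    unfolding S_def by (rule indep_vars_sum) (auto intro: indep_vars_subset[OF indep])
  have "expectation (\<lambda>\<omega>. X N \<omega> * S \<omega>) = 0" and iXS: "integrable M (\<lambda>\<omega>. X N \<omega> * S \<omega>)"
    using indep_var_lebesgue_integral[OF ind iX iS] indep_var_integrable[OF ind iX iS] mean by auto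
  moreover have "(\<Sum>l<Suc N. X l \<omega>)\<^sup>2 = (S \<omega>)\<^sup>2 + 2 * (X N \<omega> * S \<omega>) + (X N \<omega>)\<^sup>2" for \<omega>
    by (simp add: S_def power2_eq_square algebra_simps)
  ultimately have "expectation (\<lambda>\<omega>. (\<Sum>l<Suc N. X l \<omega>)\<^sup>2) = expectation (\<lambda>\<omega>. (S \<omega>)\<^sup>2) + expectation (\<lambda>\<omega>. (X N \<omega>)\<^sup>2)"
    using iS2 iX2 by simp
  also have "expectation (\<lambda>\<omega>. (X N \<omega>)\<^sup>2) \<le> expectation (\<lambda>\<omega>. B\<^sup>2)"
    using iX2 by (intro integral_mono) (auto intro!: sq bnd)
  finally show ?case using Suc.IH by (simp add: S_def prob_space algebra_simps)
qed simp

lemma (in prob_space) sum_tail_bound: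
  fixes X :: "nat \<Rightarrow> 'a \<Rightarrow> real"
  assumes indep: "indep_vars (\<lambda>_. borel) X UNIV"
    and mean: "\<And>l. expectation (X l) = 0" and bnd: "\<And>l \<omega>. \<omega> \<in> space M \<Longrightarrow> \<bar>X l \<omega>\<bar> \<le> B" and a: "a > 0"
  shows "prob {\<omega> \<in> space M. a \<le> \<bar>\<Sum>l<N. X l \<omega>\<bar>} \<le> real N * B\<^sup>2 / a\<^sup>2"
proof -
  have X[measurable]: "X l \<in> borel_measurable M" for l using indep by (auto simp: indep_vars_def)
  have "\<bar>\<Sum>l<N. X l \<omega>\<bar> \<le> real N * B" if "\<omega> \<in> space M" for \<omega>
    using sum_bounded_above[of "{..<N}" "\<lambda>l. \<bar>X l \<omega>\<bar>" B] bnd[OF that]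
    by (intro order_trans[OF sum_abs]) auto
  then have "integrable M (\<lambda>\<omega>. (\<Sum>l<N. X l \<omega>)\<^sup>2)"
    by (intro integrable_const_bound[of _ "(real N * B)\<^sup>2"]) (auto intro!: AE_I2 simp: abs_le_square_iff[symmetric] intro: order_trans[OF _ abs_ge_self])
  then have "prob {\<omega> \<in> space M. a \<le> \<bar>\<Sum>l<N. X l \<omega>\<bar>} \<le> expectation (\<lambda>\<omega>. (\<Sum>l<N. X l \<omega>)\<^sup>2) / a\<^sup>2"
    using a by (intro second_moment_method) auto
  also have "\<dots> \<le> real N * B\<^sup>2 / a\<^sup>2"
    using sum_second_moment[OF indep mean bnd] by (intro divide_right_mono) auto
  finally show ?thesis .
qed

section \<open>Cluster samples\<close>

locale cluster_sample = loglinear_frame M M0 W \<theta>0 e b + P: prob_space P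
  for M M0 :: nat and W :: "nat \<Rightarrow> nat \<Rightarrow> real" and \<theta>0 :: "nat \<Rightarrow> real" and e b :: "nat \<Rightarrow> nat \<Rightarrow> real"
    and P :: "'a measure" +
  fixes n :: nat and \<rho>2 :: real and Y :: "nat \<Rightarrow> 'a \<Rightarrow> nat \<Rightarrow> nat"
  assumes n_pos: "n \<ge> 1" and rho2: "\<rho>2 \<ge> 0"
    and Y_sum: "\<And>l \<omega>. (\<Sum>r<M. Y l \<omega> r) = n"
    and Y_indep: "P.indep_vars (\<lambda>_. Pi\<^sub>M {..<M} (\<lambda>_. count_space UNIV))
                    (\<lambda>l \<omega>. restrict (Y l \<omega>) {..<M}) UNIV"
    and Y_ident: "\<And>l. distr P (Pi\<^sub>M {..<M} (\<lambda>_. count_space UNIV)) (\<lambda>\<omega>. restrict (Y l \<omega>) {..<M})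
                      = distr P (Pi\<^sub>M {..<M} (\<lambda>_. count_space UNIV)) (\<lambda>\<omega>. restrict (Y 0 \<omega>) {..<M})"
    and Y_mean: "\<And>l r. r < M \<Longrightarrow> integral\<^sup>L P (\<lambda>\<omega>. real (Y l \<omega> r)) = real n * loglin_p M M0 W \<theta>0 r"
    and Y_var: "\<And>l r s. r < M \<Longrightarrow> s < M \<Longrightarrow>
         integral\<^sup>L P (\<lambda>\<omega>. (real (Y l \<omega> r) - real n * loglin_p M M0 W \<theta>0 r) *
                            (real (Y l \<omega> s) - real n * loglin_p M M0 W \<theta>0 s))
         = (1 + (real n - 1) * \<rho>2) * real n *
           ((if r = s then loglin_p M M0 W \<theta>0 r else 0)
            - loglin_p M M0 W \<theta>0 r * loglin_p M M0 W \<theta>0 s)"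
begin

section \<open>Moments of centred cluster frequencies\<close>

definition design :: real where "design = 1 + (real n - 1) * \<rho>2"

definition xi :: "nat \<Rightarrow> 'a \<Rightarrow> nat \<Rightarrow> real" where "xi l \<omega> r = real (Y l \<omega> r) / real n - p0 r"

definition lin :: "(nat \<Rightarrow> real) \<Rightarrow> nat \<Rightarrow> 'a \<Rightarrow> real" where "lin g l \<omega> = (\<Sum>r<M. g r * xi l \<omega> r)"

definition rel_freq :: "nat \<Rightarrow> 'a \<Rightarrow> nat \<Rightarrow> real" where
  "rel_freq N \<omega> r = (\<Sum>l<N. real (Y l \<omega> r)) / (real n * real N)"

lemma design_pos: "design \<ge> 1"
  using n_pos rho2 by (simp add: design_def)

lemma Y_le: "r < M \<Longrightarrow> Y l \<omega> r \<le> n"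
  using member_le_sum[of r "{..<M}" "Y l \<omega>"] Y_sum by simp

lemma abs_xi_le: assumes "r < M" shows "\<bar>xi l \<omega> r\<bar> \<le> 1"
proof -
  have "0 \<le> real (Y l \<omega> r) / real n" "real (Y l \<omega> r) / real n \<le> 1" using Y_le[OF assms] n_pos by auto
  then show ?thesis using pm_pos[of \<theta>0 r] pm_le_1[OF assms, of \<theta>0] unfolding xi_def by linarith
qed

lemma measurable_coord: "r < M \<Longrightarrow> (\<lambda>y. real (y r)) \<in> borel_measurable (Pi\<^sub>M {..<M} (\<lambda>_. count_space UNIV))"
  by (rule measurable_compose[OF measurable_component_singleton]) auto

lemma measurable_Y: assumes "r < M" shows "(\<lambda>\<omega>. real (Y l \<omega> r)) \<in> borel_measurable P"
proof -
  have "(\<lambda>\<omega>. restrict (Y l \<omega>) {..<M}) \<in> measurable P (Pi\<^sub>M {..<M} (\<lambda>_. count_space UNIV))"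
    using Y_indep by (auto simp: P.indep_vars_def)
  from measurable_compose[OF this measurable_coord[OF assms]] show ?thesis using assms by simp
qed

lemma measurable_xi[measurable]: "r < M \<Longrightarrow> (\<lambda>\<omega>. xi l \<omega> r) \<in> borel_measurable P"
  unfolding xi_def using measurable_Y by (intro borel_measurable_diff borel_measurable_divide) auto

text \<open>Independence and equality of laws are assumed for whole restricted vectors; every scalar
  summand used later is obtained as a measurable image.\<close>

lemma iid_image:
  assumes "h \<in> borel_measurable (Pi\<^sub>M {..<M} (\<lambda>_. count_space UNIV))"
  shows "P.indep_vars (\<lambda>_. borel) (\<lambda>l \<omega>. h (restrict (Y l \<omega>) {..<M})) UNIV"
    and "distr P borel (\<lambda>\<omega>. h (restrict (Y l \<omega>) {..<M})) = distr P borel (\<lambda>\<omega>. h (restrict (Y 0 \<omega>) {..<M}))"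
proof -
  show "P.indep_vars (\<lambda>_. borel) (\<lambda>l \<omega>. h (restrict (Y l \<omega>) {..<M})) UNIV"
    by (rule P.indep_vars_compose2[OF Y_indep assms])
  have m: "(\<lambda>\<omega>. restrict (Y l \<omega>) {..<M}) \<in> measurable P (Pi\<^sub>M {..<M} (\<lambda>_. count_space UNIV))" for l
    using Y_indep by (auto simp: P.indep_vars_def)
  have "distr P borel (\<lambda>\<omega>. h (restrict (Y l \<omega>) {..<M}))
      = distr (distr P (Pi\<^sub>M {..<M} (\<lambda>_. count_space UNIV)) (\<lambda>\<omega>. restrict (Y l \<omega>) {..<M})) borel h" for l
    by (subst distr_distr[OF assms m]) (simp add: comp_def)
  then show "distr P borel (\<lambda>\<omega>. h (restrict (Y l \<omega>) {..<M})) = distr P borel (\<lambda>\<omega>. h (restrict (Y 0 \<omega>) {..<M}))"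
    by (simp add: Y_ident[of l])
qed

lemma iid_lin:
  shows "P.indep_vars (\<lambda>_. borel) (\<lambda>l. lin g l) UNIV" and "distr P borel (lin g l) = distr P borel (lin g 0)"
proof -
  define h where "h y = (\<Sum>r<M. g r * (real (y r) / real n - p0 r))" for y :: "nat \<Rightarrow> nat"
  have h: "h \<in> borel_measurable (Pi\<^sub>M {..<M} (\<lambda>_. count_space UNIV))"
    unfolding h_def
    by (intro borel_measurable_sum borel_measurable_times borel_measurable_diff borel_measurable_divide) (auto intro!: measurable_coord)
  have eq: "lin g l = (\<lambda>\<omega>. h (restrict (Y l \<omega>) {..<M}))" for l
    by (auto simp: lin_def h_def xi_def fun_eq_iff)
  show "P.indep_vars (\<lambda>_. borel) (\<lambda>l. lin g l) UNIV" "distr P borel (lin g l) = distr P borel (lin g 0)"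
    unfolding eq by (rule iid_image[OF h])+
qed

lemma integrable_xi: "r < M \<Longrightarrow> integrable P (\<lambda>\<omega>. xi l \<omega> r)"
  by (rule P.integrable_const_bound[of _ 1]) (auto intro!: AE_I2 abs_xi_le)

lemma integrable_xi2: assumes "r < M" "s < M" shows "integrable P (\<lambda>\<omega>. xi l \<omega> r * xi l \<omega> s)"
proof (rule P.integrable_const_bound[of _ 1])
  have "\<bar>xi l \<omega> r\<bar> * \<bar>xi l \<omega> s\<bar> \<le> 1 * 1" for \<omega> using abs_xi_le assms by (intro mult_mono) auto
  then show "AE \<omega> in P. norm (xi l \<omega> r * xi l \<omega> s) \<le> 1" by (auto simp: abs_mult)
qed (use assms in measurable)

lemma mean_xi: assumes "r < M" shows "P.expectation (\<lambda>\<omega>. xi l \<omega> r) = 0"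
proof -
  have "integrable P (\<lambda>\<omega>. real (Y l \<omega> r))"
    using Y_le[OF assms] measurable_Y[OF assms] by (intro P.integrable_const_bound[of _ "real n"]) auto
  then have "P.expectation (\<lambda>\<omega>. xi l \<omega> r) = P.expectation (\<lambda>\<omega>. real (Y l \<omega> r)) / real n - p0 r"
    unfolding xi_def by (simp add: P.prob_space)
  then show ?thesis using Y_mean[OF assms] n_pos by simp
qed

lemma cov_xi:
  assumes "r < M" "s < M"
  shows "P.expectation (\<lambda>\<omega>. xi l \<omega> r * xi l \<omega> s)
           = design / real n * ((if r = s then p0 r else 0) - p0 r * p0 s)"
proof -
  have "(\<lambda>\<omega>. xi l \<omega> r * xi l \<omega> s) = (\<lambda>\<omega>. (real (Y l \<omega> r) - real n * p0 r) * (real (Y l \<omega> s) - real n * p0 s) / (real n)\<^sup>2)"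
    using n_pos by (auto simp: xi_def fun_eq_iff field_simps power2_eq_square)
  then have "P.expectation (\<lambda>\<omega>. xi l \<omega> r * xi l \<omega> s)
     = P.expectation (\<lambda>\<omega>. (real (Y l \<omega> r) - real n * p0 r) * (real (Y l \<omega> s) - real n * p0 s)) / (real n)\<^sup>2"
    by simp
  then show ?thesis unfolding Y_var[OF assms] using n_pos by (simp add: design_def power2_eq_square)
qed

lemma mean_lin: "P.expectation (lin g l) = 0"
  unfolding lin_def by (subst Bochner_Integration.integral_sum) (auto simp: mean_xi integrable_xi)

lemma second_moment_lin:
  "P.expectation (\<lambda>\<omega>. (lin g l \<omega>)\<^sup>2)
     = design / real n * ((\<Sum>r<M. (g r)\<^sup>2 * p0 r) - (\<Sum>r<M. g r * p0 r)\<^sup>2)"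
proof -
  have "(lin g l \<omega>)\<^sup>2 = (\<Sum>r<M. \<Sum>s<M. (g r * g s) * (xi l \<omega> r * xi l \<omega> s))" for \<omega>
    unfolding lin_def power2_eq_square sum_product by (intro sum.cong refl) (simp add: mult_ac)
  then have "P.expectation (\<lambda>\<omega>. (lin g l \<omega>)\<^sup>2)
      = P.expectation (\<lambda>\<omega>. \<Sum>r<M. \<Sum>s<M. (g r * g s) * (xi l \<omega> r * xi l \<omega> s))" by simp
  also have "\<dots> = (\<Sum>r<M. P.expectation (\<lambda>\<omega>. \<Sum>s<M. (g r * g s) * (xi l \<omega> r * xi l \<omega> s)))"
    by (rule Bochner_Integration.integral_sum)
       (auto intro!: Bochner_Integration.integrable_sum integrable_mult_right integrable_xi2)
  also have "\<dots> = (\<Sum>r<M. \<Sum>s<M. P.expectation (\<lambda>\<omega>. (g r * g s) * (xi l \<omega> r * xi l \<omega> s)))"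
    by (intro sum.cong refl Bochner_Integration.integral_sum) (auto intro!: integrable_mult_right integrable_xi2)
  also have "\<dots> = (\<Sum>r<M. \<Sum>s<M. (g r * g s) * P.expectation (\<lambda>\<omega>. xi l \<omega> r * xi l \<omega> s))"
    by simp
  also have "\<dots> = (\<Sum>r<M. \<Sum>s<M. design / real n * ((if r = s then (g r)\<^sup>2 * p0 r else 0) - (g r * p0 r) * (g s * p0 s)))"
    by (intro sum.cong refl) (auto simp: cov_xi power2_eq_square algebra_simps)
  also have "\<dots> = design / real n * (\<Sum>r<M. \<Sum>s<M. (if r = s then (g r)\<^sup>2 * p0 r else 0) - (g r * p0 r) * (g s * p0 s))"
    by (simp only: sum_distrib_left)
  also have "(\<Sum>r<M. \<Sum>s<M. (if r = s then (g r)\<^sup>2 * p0 r else 0) - (g r * p0 r) * (g s * p0 s))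
      = (\<Sum>r<M. (g r)\<^sup>2 * p0 r) - (\<Sum>r<M. g r * p0 r)\<^sup>2"
    by (simp add: sum_subtractf sum_product power2_eq_square[of "\<Sum>r<M. g r * p0 r"])
  finally show ?thesis .
qed

section \<open>Tail bounds for the relative frequencies\<close>

lemma rel_freq_diff:
  assumes "N > 0" shows "rel_freq N \<omega> r - p0 r = (\<Sum>l<N. xi l \<omega> r) / real N"
  using assms n_pos by (simp add: rel_freq_def xi_def sum_subtractf sum_divide_distrib[symmetric] field_simps)

lemma rel_freq_sum: assumes "N > 0" shows "(\<Sum>r<M. rel_freq N \<omega> r) = 1"
proof -
  have "(\<Sum>r<M. \<Sum>l<N. real (Y l \<omega> r)) = (\<Sum>l<N. real (\<Sum>r<M. Y l \<omega> r))"
    by (subst sum.swap) simp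
  then show ?thesis using assms n_pos by (simp add: rel_freq_def Y_sum sum_divide_distrib[symmetric])
qed

lemma rel_freq_nonneg: "0 \<le> rel_freq N \<omega> r"
  by (simp add: rel_freq_def sum_nonneg)

lemma measurable_rel_freq[measurable]: "r < M \<Longrightarrow> (\<lambda>\<omega>. rel_freq N \<omega> r) \<in> borel_measurable P"
  unfolding rel_freq_def using measurable_Y by (intro borel_measurable_divide borel_measurable_sum) auto

lemma unit_lin: "r < M \<Longrightarrow> lin (unit_fun r) l \<omega> = xi l \<omega> r"
  unfolding lin_def unit_fun_def by (simp add: if_distrib[of "\<lambda>c. c * _"] cong: if_cong)

text \<open>Markov's inequality: every centred coordinate is bounded by 1, so its sum has second
  moment at most \<open>N\<close>, and weighting by \<open>1 / p0 r\<close> produces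
  \<open>inv_sum\<close>. The bound is uniform in \<open>N\<close>, which is tightness.\<close>

lemma wdist_rel_freq_tail:
  assumes N: "N > 0" and R: "R > 0"
  shows "P.prob {\<omega> \<in> space P. R \<le> real N * (wdist (rel_freq N \<omega>) p0)\<^sup>2} \<le> inv_sum / R"
proof -
  have eq: "real N * (wdist (rel_freq N \<omega>) p0)\<^sup>2 = (\<Sum>r<M. (\<Sum>l<N. xi l \<omega> r)\<^sup>2 * (1 / (real N * p0 r)))" for \<omega>
    unfolding wdist_sq rel_freq_diff[OF N] sum_distrib_left using N
    by (intro sum.cong refl) (simp add: power_divide power2_eq_square)
  have int: "integrable P (\<lambda>\<omega>. (\<Sum>l<N. xi l \<omega> r)\<^sup>2)" if r: "r < M" for r
  proof (rule P.integrable_const_bound[of _ "(real N)\<^sup>2"])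
    have "\<bar>\<Sum>l<N. xi l \<omega> r\<bar> \<le> real N" for \<omega>
      using sum_bounded_above[of "{..<N}" "\<lambda>l. \<bar>xi l \<omega> r\<bar>" 1] abs_xi_le[OF r]
      by (intro order_trans[OF sum_abs]) auto
    then show "AE \<omega> in P. norm ((\<Sum>l<N. xi l \<omega> r)\<^sup>2) \<le> (real N)\<^sup>2"
      by (intro AE_I2) (simp add: abs_le_square_iff[symmetric])
  qed (use r in measurable)
  have mom: "P.expectation (\<lambda>\<omega>. (\<Sum>l<N. xi l \<omega> r)\<^sup>2) \<le> real N" if r: "r < M" for r
    using P.sum_second_moment[OF iid_lin(1)[of "unit_fun r"] mean_lin, of 1 N] abs_xi_le[OF r]
    by (simp add: unit_lin[OF r])
  have "P.expectation (\<lambda>\<omega>. real N * (wdist (rel_freq N \<omega>) p0)\<^sup>2)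
      = (\<Sum>r<M. P.expectation (\<lambda>\<omega>. (\<Sum>l<N. xi l \<omega> r)\<^sup>2) * (1 / (real N * p0 r)))"
    unfolding eq using int by (subst Bochner_Integration.integral_sum) auto
  also have "\<dots> \<le> (\<Sum>r<M. real N * (1 / (real N * p0 r)))"
    using mom pm_pos by (intro sum_mono mult_right_mono) (auto simp: less_imp_le)
  also have "\<dots> = inv_sum" using N by (simp add: inv_sum_def)
  finally have E: "P.expectation (\<lambda>\<omega>. real N * (wdist (rel_freq N \<omega>) p0)\<^sup>2) \<le> inv_sum" .
  have I: "integrable P (\<lambda>\<omega>. real N * (wdist (rel_freq N \<omega>) p0)\<^sup>2)"
    unfolding eq using int by auto
  have "P.prob {\<omega> \<in> space P. R \<le> real N * (wdist (rel_freq N \<omega>) p0)\<^sup>2}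
      \<le> P.expectation (\<lambda>\<omega>. real N * (wdist (rel_freq N \<omega>) p0)\<^sup>2) / R"
    using integral_Markov_inequality_measure[OF I, of "space P" R] R by auto
  also have "\<dots> \<le> inv_sum / R" using E R by (intro divide_right_mono) auto
  finally show ?thesis .
qed

definition xi_var :: "nat \<Rightarrow> real" where "xi_var r = design / real n * (p0 r - (p0 r)\<^sup>2)"

text \<open>Chebyshev's inequality for the squares minus their mean, which are again i.i.d., centred
  and bounded.\<close>

lemma xi_sq_tail:
  assumes r: "r < M" and N: "N > 0" and \<tau>: "\<tau> > 0"
  shows "P.prob {\<omega> \<in> space P. \<tau> \<le> \<bar>(\<Sum>l<N. (xi l \<omega> r)\<^sup>2) / real N - xi_var r\<bar>}
           \<le> (1 + \<bar>xi_var r\<bar>)\<^sup>2 / \<tau>\<^sup>2 / real N"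
proof -
  define X where "X l \<omega> = (xi l \<omega> r)\<^sup>2 - xi_var r" for l \<omega>
  define h where "h y = (real (y r) / real n - p0 r)\<^sup>2 - xi_var r" for y :: "nat \<Rightarrow> nat"
  have "h \<in> borel_measurable (Pi\<^sub>M {..<M} (\<lambda>_. count_space UNIV))"
    unfolding h_def using measurable_coord[OF r]
    by (intro borel_measurable_diff borel_measurable_power borel_measurable_divide) auto
  from iid_image(1)[OF this] have ind: "P.indep_vars (\<lambda>_. borel) X UNIV"
    using r by (simp add: h_def X_def[abs_def] xi_def)
  have "P.expectation (\<lambda>\<omega>. (xi l \<omega> r)\<^sup>2) = xi_var r" for l
    using cov_xi[OF r r, of l] by (simp add: xi_var_def power2_eq_square)
  then have mean: "P.expectation (X l) = 0" for l
    using integrable_xi2[OF r r, of l] unfolding X_def by (simp add: P.prob_space power2_eq_square)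
  have bnd: "\<bar>X l \<omega>\<bar> \<le> 1 + \<bar>xi_var r\<bar>" for l \<omega>
  proof -
    have "(xi l \<omega> r)\<^sup>2 \<le> 1" using abs_xi_le[OF r, of l \<omega>] by (simp add: abs_square_le_1)
    then have "\<bar>(xi l \<omega> r)\<^sup>2\<bar> \<le> 1" by simp
    then show ?thesis unfolding X_def by linarith
  qed
  have "(\<tau> \<le> \<bar>(\<Sum>l<N. (xi l \<omega> r)\<^sup>2) / real N - xi_var r\<bar>) = (real N * \<tau> \<le> \<bar>\<Sum>l<N. X l \<omega>\<bar>)" for \<omega>
  proof -
    have "(\<Sum>l<N. X l \<omega>) = real N * ((\<Sum>l<N. (xi l \<omega> r)\<^sup>2) / real N - xi_var r)"
      using N by (simp add: X_def sum_subtractf right_diff_distrib)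
    then have "\<bar>\<Sum>l<N. X l \<omega>\<bar> = real N * \<bar>(\<Sum>l<N. (xi l \<omega> r)\<^sup>2) / real N - xi_var r\<bar>" by (simp add: abs_mult)
    then show ?thesis using N by simp
  qed
  then have "P.prob {\<omega> \<in> space P. \<tau> \<le> \<bar>(\<Sum>l<N. (xi l \<omega> r)\<^sup>2) / real N - xi_var r\<bar>}
      \<le> real N * (1 + \<bar>xi_var r\<bar>)\<^sup>2 / (real N * \<tau>)\<^sup>2"
    using P.sum_tail_bound[OF ind mean bnd, of "real N * \<tau>" N] N \<tau> by simp
  also have "\<dots> = (1 + \<bar>xi_var r\<bar>)\<^sup>2 / \<tau>\<^sup>2 / real N"
    using N by (simp add: power_mult_distrib power2_eq_square)
  finally show ?thesis .
qed

text \<open>The factor \<open>sqrt (n / design)\<close> standardises the variance, and division by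
  \<open>sqrt (p0 r)\<close> turns frequencies into scaled deviations.\<close>

definition std_coord :: "nat \<Rightarrow> nat \<Rightarrow> 'a \<Rightarrow> real" where
  "std_coord N i \<omega> = (\<Sum>l<N. lin (\<lambda>r. sqrt (real n / design) * e i r / sqrt (p0 r)) l \<omega>) / sqrt (real N)"

definition chi_stat :: "nat \<Rightarrow> 'a \<Rightarrow> real" where "chi_stat N \<omega> = (\<Sum>i<K. (std_coord N i \<omega>)\<^sup>2)"

lemma measurable_lin[measurable]: "lin g l \<in> borel_measurable P"
  unfolding lin_def by (intro borel_measurable_sum borel_measurable_times measurable_xi) auto

lemma measurable_std_coord[measurable]: "std_coord N i \<in> borel_measurable P"
  unfolding std_coord_def by measurable

lemma measurable_chi_stat[measurable]: "chi_stat N \<in> borel_measurable P"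
  unfolding chi_stat_def by measurable

text \<open>The meeting point of the deterministic and the probabilistic part: it isolates the
  factor \<open>design\<close> that the estimator has to cancel.\<close>

lemma chi_stat_eq:
  assumes N: "N > 0"
  shows "design * chi_stat N \<omega> = real n * real N * defect (rel_freq N \<omega>)"
proof -
  have "std_coord N i \<omega> = sqrt (real n / design) * sqrt (real N) * inner_upto M (e i) (scaled_diff (rel_freq N \<omega>) p0)" for i
  proof -
    have "(\<Sum>l<N. lin (\<lambda>r. sqrt (real n / design) * e i r / sqrt (p0 r)) l \<omega>)
        = (\<Sum>r<M. sqrt (real n / design) * e i r / sqrt (p0 r) * (\<Sum>l<N. xi l \<omega> r))"
      unfolding lin_def sum_distrib_left by (rule sum.swap)
    also have "\<dots> = sqrt (real n / design) * real N * inner_upto M (e i) (scaled_diff (rel_freq N \<omega>) p0)"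
      unfolding inner_upto_def scaled_diff_def rel_freq_diff[OF N] sum_distrib_left[of "_ * real N"] using N
      by (intro sum.cong refl) simp
    finally show ?thesis unfolding std_coord_def using N by (simp add: real_div_sqrt field_simps)
  qed
  then have "chi_stat N \<omega> = (\<Sum>i<K. (real n / design * real N) * (inner_upto M (e i) (scaled_diff (rel_freq N \<omega>) p0))\<^sup>2)"
    unfolding chi_stat_def using design_pos by (intro sum.cong refl) (simp add: power_mult_distrib)
  then show ?thesis unfolding defect_def sum_distrib_left[symmetric] using design_pos by simp
qed

text \<open>A Cramer-Wold step: any combination of the coordinates is one normalised sum of
  \<open>lin g\<close>. Its variance is the sum of the squared \<open>t i\<close>, since
  \<open>e\<close> is orthonormal and its orthogonality to \<open>score 0\<close> kills the rank-one
  part of the covariance.\<close>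

lemma chi_stat_char:
  "(\<lambda>N. \<integral>\<omega>. iexp (\<Sum>i<K. t i * std_coord N i \<omega>) \<partial>P) \<longlonglongrightarrow> complex_of_real (exp (- (\<Sum>i<K. (t i)\<^sup>2) / 2))"
proof -
  define a where "a r = (\<Sum>i<K. t i * e i r)" for r
  define g where "g r = sqrt (real n / design) * a r / sqrt (p0 r)" for r
  have comb: "(\<Sum>i<K. t i * std_coord N i \<omega>) = (\<Sum>l<N. lin g l \<omega>) / sqrt (real N)" for N \<omega>
  proof -
    have "lin g l \<omega> = (\<Sum>i<K. t i * lin (\<lambda>r. sqrt (real n / design) * e i r / sqrt (p0 r)) l \<omega>)" for l
    proof -
      have "lin g l \<omega> = (\<Sum>r<M. \<Sum>i<K. t i * (sqrt (real n / design) * e i r / sqrt (p0 r) * xi l \<omega> r))"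
        unfolding lin_def g_def a_def sum_distrib_left sum_distrib_right sum_divide_distrib
        by (intro sum.cong refl) (simp add: mult_ac)
      also have "\<dots> = (\<Sum>i<K. \<Sum>r<M. t i * (sqrt (real n / design) * e i r / sqrt (p0 r) * xi l \<omega> r))" by (rule sum.swap)
      finally show ?thesis by (simp only: lin_def sum_distrib_left)
    qed
    then have "(\<Sum>l<N. lin g l \<omega>) = (\<Sum>i<K. t i * (\<Sum>l<N. lin (\<lambda>r. sqrt (real n / design) * e i r / sqrt (p0 r)) l \<omega>))"
      by (simp only: sum_distrib_left) (rule sum.swap)
    then show ?thesis by (simp only: std_coord_def times_divide_eq_right sum_divide_distrib[symmetric])
  qed
  have "(\<Sum>r<M. (g r)\<^sup>2 * p0 r) = real n / design * (\<Sum>r<M. (a r)\<^sup>2)"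
  proof -
    have "(g r)\<^sup>2 * p0 r = real n / design * (a r)\<^sup>2" for r
      using pm_pos[of \<theta>0 r] design_pos unfolding g_def by (simp add: power_divide power_mult_distrib)
    then show ?thesis by (simp add: sum_distrib_left)
  qed
  also have "(\<Sum>r<M. (a r)\<^sup>2) = (\<Sum>i<K. (t i)\<^sup>2)"
    using L2_set_frame_part[of t] by (simp add: a_def[abs_def] L2_set_def sum_nonneg)
  finally have 1: "(\<Sum>r<M. (g r)\<^sup>2 * p0 r) = real n / design * (\<Sum>i<K. (t i)\<^sup>2)" .
  have "(\<Sum>r<M. g r * p0 r) = sqrt (real n / design) * inner_upto M (score 0) a"
    unfolding inner_upto_def sum_distrib_left
  proof (intro sum.cong refl)
    fix r
    have "p0 r / sqrt (p0 r) = sqrt (p0 r)" using pm_pos[of \<theta>0 r] by (intro real_div_sqrt) simp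
    moreover have "g r * p0 r = sqrt (real n / design) * a r * (p0 r / sqrt (p0 r))" by (simp add: g_def)
    ultimately show "g r * p0 r = sqrt (real n / design) * (score 0 r * a r)" by (simp add: score_def)
  qed
  also have "inner_upto M (score 0) a = 0"
    unfolding a_def[abs_def] by (simp add: inner_upto_sum_right inner_upto_commute[of M "score 0"] e_score)
  finally have 2: "(\<Sum>r<M. g r * p0 r) = 0" by simp
  have var: "P.expectation (\<lambda>\<omega>. (lin g l \<omega>)\<^sup>2) = (\<Sum>i<K. (t i)\<^sup>2)" for l
    unfolding second_moment_lin 1 2 using design_pos n_pos by simp
  have sq: "integrable P (\<lambda>\<omega>. (lin g l \<omega>)\<^sup>2)" for l
  proof -
    have "(lin g l \<omega>)\<^sup>2 = (\<Sum>r<M. \<Sum>s<M. (g r * g s) * (xi l \<omega> r * xi l \<omega> s))" for \<omega>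
      unfolding lin_def power2_eq_square sum_product by (intro sum.cong refl) (simp add: mult_ac)
    then show ?thesis
      by (simp only:) (auto intro!: Bochner_Integration.integrable_sum integrable_mult_right integrable_xi2)
  qed
  show ?thesis
    unfolding comb using P.clt_char[OF iid_lin(1) mean_lin var sq iid_lin(2)] by (simp add: sum_nonneg)
qed

lemma chi_stat_conv:
  assumes "x < y"
  shows "(\<lambda>N. \<integral>\<omega>. cts_step x y (chi_stat N \<omega>) \<partial>P) \<longlonglongrightarrow> (\<integral>z. cts_step x y z \<partial>chi2_distribution K)"
proof (rule laplace_imp_cts_step_conv[OF P.prob_space_axioms measurable_chi_stat _ _ chi2_nonneg _ assms])
  have K: "K \<ge> 1" using M0_less by simp
  show "real_distribution (chi2_distribution K)" by (rule real_distribution_chi2[OF K])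
  show "0 \<le> chi_stat N \<omega>" for N \<omega> by (simp add: chi_stat_def sum_nonneg)
  show "(\<lambda>N. \<integral>\<omega>. exp (- real m * chi_stat N \<omega>) \<partial>P) \<longlonglongrightarrow> (\<integral>x. exp (- real m * x) \<partial>chi2_distribution K)" for m
    unfolding integral_chi2_exp[OF K of_nat_0_le_iff] chi_stat_def
    by (rule P.laplace_quadratic_form[OF _ chi_stat_char]) auto
qed

end

section \<open>The design effect and the test statistic\<close>

text \<open>Continuity at \<open>(v, 0, a, 1)\<close>, where the four arguments stand for the
  average square about \<open>p0\<close>, the deviation of the sample mean, the fitted probability
  and \<open>N / (N - 1)\<close>; one tolerance serves all four.\<close>

lemma variance_ratio_continuous:
  fixes v a :: real
  assumes a: "a > 0" and \<epsilon>: "\<epsilon> > 0"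
  shows "\<exists>\<tau>>0. \<forall>A x q \<kappa>. \<bar>A - v\<bar> \<le> \<tau> \<longrightarrow> \<bar>x\<bar> \<le> \<tau> \<longrightarrow> \<bar>q - a\<bar> \<le> \<tau> \<longrightarrow> \<bar>\<kappa> - 1\<bar> \<le> \<tau> \<longrightarrow>
           \<bar>\<kappa> * ((A - x\<^sup>2) / q) - v / a\<bar> \<le> \<epsilon>"
proof -
  define f :: "real \<times> real \<times> real \<times> real \<Rightarrow> real"
    where "f z = snd (snd (snd z)) * ((fst z - (fst (snd z))\<^sup>2) / fst (snd (snd z)))" for z
  have "isCont f (v, 0, a, 1)"
    unfolding f_def using a by (intro continuous_intros) auto
  then obtain d where d: "d > 0" and "\<And>z. dist z (v, 0, a, 1) < d \<Longrightarrow> dist (f z) (f (v, 0, a, 1)) < \<epsilon>"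
    using \<epsilon> unfolding continuous_at_eps_delta by blast
  then have near: "\<bar>\<kappa> * ((A - x\<^sup>2) / q) - v / a\<bar> < \<epsilon>" if "dist (A, x, q, \<kappa>) (v, 0, a, 1) < d" for A x q \<kappa>
    using that by (fastforce simp: f_def dist_real_def)
  have "\<bar>\<kappa> * ((A - x\<^sup>2) / q) - v / a\<bar> \<le> \<epsilon>"
    \<comment> \<open>Four deviations of at most \<open>d / 5\<close> keep the total strictly below
      \<open>d\<close>.\<close>
    if h: "\<bar>A - v\<bar> \<le> d / 5" "\<bar>x\<bar> \<le> d / 5" "\<bar>q - a\<bar> \<le> d / 5" "\<bar>\<kappa> - 1\<bar> \<le> d / 5" for A x q \<kappa>
  proof -
    have s: "dist (u, w) (u', w') \<le> \<bar>u - u'\<bar> + dist w w'" for u u' :: real and w w' :: "'b::metric_space"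
      unfolding dist_Pair_Pair dist_real_def
      using sqrt_sum_squares_le_sum[of "\<bar>u - u'\<bar>" "dist w w'"] by simp
    have "dist (A, x, q, \<kappa>) (v, 0, a, 1) \<le> \<bar>A - v\<bar> + (\<bar>x - 0\<bar> + (\<bar>q - a\<bar> + dist \<kappa> 1))"
      by (intro order_trans[OF s] add_left_mono order_refl)
    also have "\<dots> < d" using h d by (simp add: dist_real_def)
    finally show ?thesis using near by (simp add: less_imp_le)
  qed
  then show ?thesis using d by (intro exI[of _ "d / 5"]) auto
qed

lemma (in loglinear_model) loglinear_frame_exists: "\<exists>e b. loglinear_frame M M0 W \<theta>0 e b"
proof (rule independent_complement[OF independent_score])
  show "Suc M0 \<le> M" using M0_less by simp
  fix e b
  assume "orthonormal_upto M (M - Suc M0) e"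
    and "\<And>i j. i < M - Suc M0 \<Longrightarrow> j < Suc M0 \<Longrightarrow> inner_upto M (e i) (score j) = 0"
    and "\<And>j l. j < Suc M0 \<Longrightarrow> l < Suc M0 \<Longrightarrow> inner_upto M (b j) (score l) = (if j = l then 1 else 0)"
    and "\<And>x r. r < M \<Longrightarrow> x r = (\<Sum>i<M - Suc M0. inner_upto M (e i) x * e i r)
                                  + (\<Sum>j<Suc M0. inner_upto M (b j) x * score j r)"
  then have "loglinear_frame M M0 W \<theta>0 e b"
    by (intro loglinear_frame.intro loglinear_model_axioms loglinear_frame_axioms.intro)
  then show ?thesis by blast
qed

context cluster_sample
begin

section \<open>Consistency of the design effect estimator\<close>

definition design_estimate :: "(nat \<Rightarrow> real) \<Rightarrow> nat \<Rightarrow> 'a \<Rightarrow> real" where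
  "design_estimate q N \<omega> = real n * (\<Sum>l<N. \<Sum>r<M. (real (Y l \<omega> r) / real n - rel_freq N \<omega> r)\<^sup>2 / q r)
                              / ((real N - 1) * (real M - 1))"

lemma abs_diff_le_wdist: assumes r: "r < M" shows "\<bar>p r - p0 r\<bar> \<le> wdist p p0"
proof -
  have p: "p0 r > 0" "p0 r \<le> 1" using pm_pos pm_le_1[OF r] by auto
  have "\<bar>p r - p0 r\<bar> = sqrt (p0 r) * \<bar>scaled_diff p p0 r\<bar>" using p by (simp add: scaled_diff_def)
  also have "\<dots> \<le> 1 * wdist p p0" using p scaled_diff_le[OF r] by (intro mult_mono) auto
  finally show ?thesis by simp
qed

text \<open>Recentring from the sample mean to \<open>p0\<close> makes the summands independent of
  each other; the correction is the squared deviation of the mean.\<close>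

lemma design_estimate_eq:
  assumes N: "N > 1"
  shows "design_estimate q N \<omega> = (\<Sum>r<M. real n / (real M - 1) *
    (real N / (real N - 1) * (((\<Sum>l<N. (xi l \<omega> r)\<^sup>2) / real N - (rel_freq N \<omega> r - p0 r)\<^sup>2) / q r)))"
proof -
  have inner: "(\<Sum>l<N. (real (Y l \<omega> r) / real n - rel_freq N \<omega> r)\<^sup>2)
       = real N * ((\<Sum>l<N. (xi l \<omega> r)\<^sup>2) / real N - (rel_freq N \<omega> r - p0 r)\<^sup>2)" for r
  proof -
    define x where "x = rel_freq N \<omega> r - p0 r"
    have sx: "(\<Sum>l<N. xi l \<omega> r) = real N * x" using rel_freq_diff[of N \<omega> r] N by (simp add: x_def)
    have "(\<Sum>l<N. (real (Y l \<omega> r) / real n - rel_freq N \<omega> r)\<^sup>2) = (\<Sum>l<N. (xi l \<omega> r - x)\<^sup>2)"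
      by (simp add: xi_def x_def)
    also have "\<dots> = (\<Sum>l<N. (xi l \<omega> r)\<^sup>2 - 2 * x * xi l \<omega> r + x\<^sup>2)"
      by (intro sum.cong refl) (simp add: power2_eq_square algebra_simps)
    also have "\<dots> = (\<Sum>l<N. (xi l \<omega> r)\<^sup>2) - 2 * x * (\<Sum>l<N. xi l \<omega> r) + real N * x\<^sup>2"
      by (simp add: sum.distrib sum_subtractf sum_distrib_left)
    also have "\<dots> = real N * ((\<Sum>l<N. (xi l \<omega> r)\<^sup>2) / real N - x\<^sup>2)"
      unfolding sx using N by (simp add: power2_eq_square algebra_simps)
    finally show ?thesis by (simp add: x_def)
  qed
  have "(\<Sum>l<N. \<Sum>r<M. (real (Y l \<omega> r) / real n - rel_freq N \<omega> r)\<^sup>2 / q r)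
      = (\<Sum>r<M. real N * ((\<Sum>l<N. (xi l \<omega> r)\<^sup>2) / real N - (rel_freq N \<omega> r - p0 r)\<^sup>2) / q r)"
    by (subst sum.swap) (simp only: inner sum_divide_distrib[symmetric])
  then show ?thesis
    unfolding design_estimate_def by (simp only: sum_distrib_left sum_divide_distrib) (intro sum.cong refl, simp)
qed

lemma design_estimate_close:
  assumes \<epsilon>: "\<epsilon> > 0"
  shows "\<exists>\<tau>>0. \<forall>N q \<omega>. N > 1 \<longrightarrow> (\<forall>r<M. \<bar>(\<Sum>l<N. (xi l \<omega> r)\<^sup>2) / real N - xi_var r\<bar> \<le> \<tau>) \<longrightarrow>
           wdist (rel_freq N \<omega>) p0 \<le> \<tau> \<longrightarrow> wdist q p0 \<le> \<tau> \<longrightarrow> \<bar>real N / (real N - 1) - 1\<bar> \<le> \<tau> \<longrightarrow>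
           \<bar>design_estimate q N \<omega> - design\<bar> \<le> \<epsilon>"
proof -
  define k where "k = real n / (real M - 1)"
  have M1: "real M - 1 > 0" using M0_less by simp
  have k: "k > 0" using n_pos M1 by (simp add: k_def)
  define \<epsilon>1 where "\<epsilon>1 = \<epsilon> / (k * real M)"
  have \<epsilon>1: "\<epsilon>1 > 0" using \<epsilon> k M_pos by (simp add: \<epsilon>1_def)
  have "\<forall>r. \<exists>\<tau>>0. \<forall>A x q \<kappa>. \<bar>A - xi_var r\<bar> \<le> \<tau> \<longrightarrow> \<bar>x\<bar> \<le> \<tau> \<longrightarrow> \<bar>q - p0 r\<bar> \<le> \<tau> \<longrightarrow> \<bar>\<kappa> - 1\<bar> \<le> \<tau> \<longrightarrow>
           \<bar>\<kappa> * ((A - x\<^sup>2) / q) - xi_var r / p0 r\<bar> \<le> \<epsilon>1"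
    using variance_ratio_continuous[OF pm_pos \<epsilon>1] by blast
  from choice[OF this] obtain t where t: "\<And>r. t r > 0" and T: "\<And>r A x q \<kappa>. \<bar>A - xi_var r\<bar> \<le> t r \<Longrightarrow> \<bar>x\<bar> \<le> t r \<Longrightarrow> \<bar>q - p0 r\<bar> \<le> t r \<Longrightarrow> \<bar>\<kappa> - 1\<bar> \<le> t r \<Longrightarrow>
           \<bar>\<kappa> * ((A - x\<^sup>2) / q) - xi_var r / p0 r\<bar> \<le> \<epsilon>1"
    by blast
  define \<tau> where "\<tau> = Min (t ` {..<M})"
  have \<tau>: "\<tau> > 0" unfolding \<tau>_def using t M_pos by (subst Min_gr_iff) auto
  have \<tau>_le: "\<tau> \<le> t r" if "r < M" for r unfolding \<tau>_def using that by (intro Min_le) auto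
  \<comment> \<open>Each ratio \<open>xi_var r / p0 r\<close> is
    \<open>design / n * (1 - p0 r)\<close>, and the numbers \<open>1 - p0 r\<close> add up to
    \<open>M - 1\<close>: this explains the divisor in the estimator.\<close>
  have lim: "(\<Sum>r<M. k * (xi_var r / p0 r)) = design"
  proof -
    have "k * (xi_var r / p0 r) = design / (real M - 1) * (1 - p0 r)" for r
      using pm_pos[of \<theta>0 r] n_pos M1 by (simp add: k_def xi_var_def power2_eq_square field_simps)
    then have "(\<Sum>r<M. k * (xi_var r / p0 r)) = design / (real M - 1) * (\<Sum>r<M. 1 - p0 r)"
      by (simp add: sum_distrib_left)
    also have "(\<Sum>r<M. 1 - p0 r) = real M - 1" by (simp add: sum_subtractf pm_sum)
    finally show ?thesis using M1 by simp
  qed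
  have "\<bar>design_estimate q N \<omega> - design\<bar> \<le> \<epsilon>"
    if N: "N > 1" and A: "\<forall>r<M. \<bar>(\<Sum>l<N. (xi l \<omega> r)\<^sup>2) / real N - xi_var r\<bar> \<le> \<tau>"
      and x: "wdist (rel_freq N \<omega>) p0 \<le> \<tau>" and q: "wdist q p0 \<le> \<tau>" and \<kappa>: "\<bar>real N / (real N - 1) - 1\<bar> \<le> \<tau>" for N q \<omega>
  proof -
    let ?F = "\<lambda>r. real N / (real N - 1) * (((\<Sum>l<N. (xi l \<omega> r)\<^sup>2) / real N - (rel_freq N \<omega> r - p0 r)\<^sup>2) / q r)"
    have "\<bar>?F r - xi_var r / p0 r\<bar> \<le> \<epsilon>1" if r: "r < M" for r
    proof (rule T)
      show "\<bar>(\<Sum>l<N. (xi l \<omega> r)\<^sup>2) / real N - xi_var r\<bar> \<le> t r" using A r \<tau>_le[OF r] by force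
      show "\<bar>rel_freq N \<omega> r - p0 r\<bar> \<le> t r" "\<bar>q r - p0 r\<bar> \<le> t r"
        using abs_diff_le_wdist[OF r, of "rel_freq N \<omega>"] abs_diff_le_wdist[OF r, of q] x q \<tau>_le[OF r] by linarith+
      show "\<bar>real N / (real N - 1) - 1\<bar> \<le> t r" using \<kappa> \<tau>_le[OF r] by linarith
    qed
    then have F: "\<bar>k * ?F r - k * (xi_var r / p0 r)\<bar> \<le> k * \<epsilon>1" if "r < M" for r
      using that k by (simp only: right_diff_distrib[symmetric] abs_mult abs_of_pos[OF k]) (intro mult_left_mono, auto)
    have "design_estimate q N \<omega> - design = (\<Sum>r<M. k * ?F r - k * (xi_var r / p0 r))"
      unfolding design_estimate_eq[OF N] lim[symmetric] k_def by (simp only: sum_subtractf)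
    also have "\<bar>\<dots>\<bar> \<le> (\<Sum>r<M. k * \<epsilon>1)" using F by (intro order_trans[OF sum_abs] sum_mono) auto
    also have "\<dots> = \<epsilon>" using k M_pos by (simp add: \<epsilon>1_def)
    finally show ?thesis .
  qed
  then show ?thesis using \<tau> by blast
qed

text \<open>\<open>real_of_ereal\<close> sends an infinite divergence to 0. This happens only with
  empty cells, hence away from \<open>p0\<close>, on an event of vanishing probability.\<close>

definition div_stat :: "(real \<Rightarrow> real) \<Rightarrow> (nat \<Rightarrow> real) \<Rightarrow> nat \<Rightarrow> 'a \<Rightarrow> real" where
  "div_stat \<phi> \<theta> N \<omega> = 2 * real n * real N / deriv (deriv \<phi>) 1 *
                          real_of_ereal (phi_div M \<phi> (rel_freq N \<omega>) (pm \<theta>))"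

definition phi_minimiser :: "(real \<Rightarrow> real) \<Rightarrow> (nat \<Rightarrow> real) \<Rightarrow> (nat \<Rightarrow> real) \<Rightarrow> bool" where
  "phi_minimiser \<phi> p \<theta> \<longleftrightarrow> (\<forall>\<theta>'. phi_div M \<phi> p (pm \<theta>) \<le> phi_div M \<phi> p (pm \<theta>'))"

text \<open>Pathwise and for every admissible choice of \<open>\<theta>\<close>: the conditional
  assumption on \<open>\<theta>\<close> becomes effective because \<open>minimiser_exists\<close>
  applies near \<open>p0\<close>.\<close>

lemma statistic_close:
  assumes adm1: "admissible_phi \<phi>1" and adm2: "admissible_phi \<phi>2" and \<epsilon>: "\<epsilon> > 0" and R: "R > 0"
  shows "\<exists>\<tau>>0. \<forall>\<^sub>F N in sequentially. \<forall>\<omega> \<theta>.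
     real N * (wdist (rel_freq N \<omega>) p0)\<^sup>2 \<le> R \<longrightarrow>
     (\<forall>r<M. \<bar>(\<Sum>l<N. (xi l \<omega> r)\<^sup>2) / real N - xi_var r\<bar> \<le> \<tau>) \<longrightarrow>
     (Ex (phi_minimiser \<phi>2 (rel_freq N \<omega>)) \<longrightarrow> phi_minimiser \<phi>2 (rel_freq N \<omega>) \<theta>) \<longrightarrow>
     \<bar>div_stat \<phi>1 \<theta> N \<omega> / design_estimate (pm \<theta>) N \<omega> - chi_stat N \<omega>\<bar> \<le> \<epsilon>"
proof -
  have dp: "design > 0" using design_pos by simp
  have np: "real n > 0" using n_pos by simp
  \<comment> \<open>Bounds \<open>1 + \<bar>Q\<bar>\<close>, since \<open>design * Q\<close> is at
    most \<open>n * N\<close> times the squared distance, hence at most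
    \<open>n * R\<close>.\<close>
  define B where "B = 1 + real n * R / design"
  have B: "B \<ge> 1" using np R dp by (simp add: B_def)
  \<comment> \<open>The first bound keeps the estimate above \<open>design / 2\<close>; the second
    pays for the error \<open>\<epsilon>1 * (1 + \<bar>Q\<bar>)\<close> after division by the
    estimate.\<close>
  define \<epsilon>1 where "\<epsilon>1 = min (design / 2) (\<epsilon> * design / (2 * B))"
  have \<epsilon>1: "\<epsilon>1 > 0" "\<epsilon>1 \<le> design / 2" "\<epsilon>1 * B \<le> \<epsilon> * (design / 2)"
  proof -
    show "\<epsilon>1 > 0" "\<epsilon>1 \<le> design / 2" using \<epsilon> dp B by (auto simp: \<epsilon>1_def)
    have "\<epsilon>1 * B \<le> \<epsilon> * design / (2 * B) * B" using B by (intro mult_right_mono) (auto simp: \<epsilon>1_def)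
    then show "\<epsilon>1 * B \<le> \<epsilon> * (design / 2)" using B by simp
  qed
  \<comment> \<open>Multiplied by \<open>n * N\<close> times the squared distance, at most
    \<open>n * R\<close>, this relative error becomes \<open>\<epsilon>1\<close>.\<close>
  define \<epsilon>2 where "\<epsilon>2 = \<epsilon>1 / (real n * R)"
  have \<epsilon>2: "\<epsilon>2 > 0" using \<epsilon>1 np R by (simp add: \<epsilon>2_def)
  obtain \<delta>1 where \<delta>1: "\<delta>1 > 0" and ex: "\<And>p. (\<Sum>r<M. p r) = 1 \<Longrightarrow> wdist p p0 \<le> \<delta>1 \<Longrightarrow>
           \<exists>\<theta>. \<forall>\<theta>'. real_phi_div M \<phi>2 p (pm \<theta>) \<le> real_phi_div M \<phi>2 p (pm \<theta>')"
    using minimiser_exists[OF adm2] by blast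
  obtain \<delta>2 where \<delta>2: "\<delta>2 > 0" and key: "\<And>p \<theta>. (\<Sum>r<M. p r) = 1 \<Longrightarrow> wdist p p0 \<le> \<delta>2 \<Longrightarrow>
           \<forall>\<theta>'. real_phi_div M \<phi>2 p (pm \<theta>) \<le> real_phi_div M \<phi>2 p (pm \<theta>') \<Longrightarrow>
           \<bar>2 / deriv (deriv \<phi>1) 1 * real_phi_div M \<phi>1 p (pm \<theta>) - defect p\<bar> \<le> \<epsilon>2 * (wdist p p0)\<^sup>2"
    using minimum_divergence_defect[OF adm1 adm2 \<epsilon>2] by blast
  obtain C \<delta>3 where C: "C > 0" "\<delta>3 > 0" and near: "\<And>p \<theta>. (\<Sum>r<M. p r) = 1 \<Longrightarrow> wdist p p0 \<le> \<delta>3 \<Longrightarrow>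
           real_phi_div M \<phi>2 p (pm \<theta>) \<le> real_phi_div M \<phi>2 p p0 \<Longrightarrow>
           wdist (pm \<theta>) p0 \<le> C * wdist p p0"
    using sublevel_near[OF adm2] by blast
  obtain \<tau> where \<tau>: "\<tau> > 0" and des: "\<And>N q \<omega>. N > 1 \<Longrightarrow> (\<forall>r<M. \<bar>(\<Sum>l<N. (xi l \<omega> r)\<^sup>2) / real N - xi_var r\<bar> \<le> \<tau>) \<Longrightarrow>
           wdist (rel_freq N \<omega>) p0 \<le> \<tau> \<Longrightarrow> wdist q p0 \<le> \<tau> \<Longrightarrow> \<bar>real N / (real N - 1) - 1\<bar> \<le> \<tau> \<Longrightarrow>
           \<bar>design_estimate q N \<omega> - design\<bar> \<le> \<epsilon>1"
    using design_estimate_close[OF \<epsilon>1(1)] by blast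
  define d0 where "d0 = Min {\<delta>1, \<delta>2, \<delta>3, 1 / (2 * inv_sum), \<tau>, \<tau> / C}"
  have d0: "d0 > 0" using \<delta>1 \<delta>2 C inv_sum_pos \<tau> by (simp add: d0_def)
  have d0_le: "d0 \<le> \<delta>1" "d0 \<le> \<delta>2" "d0 \<le> \<delta>3" "d0 \<le> 1 / (2 * inv_sum)" "d0 \<le> \<tau>" "d0 \<le> \<tau> / C"
    by (simp_all add: d0_def)
  \<comment> \<open>For large \<open>N\<close> the bound by \<open>R\<close> forces the distance
    below \<open>d0\<close>.\<close>
  have "filterlim (\<lambda>N. real N * d0\<^sup>2) at_top sequentially"
    using d0 by (intro filterlim_at_top_mult_tendsto_pos[where c="d0\<^sup>2"] filterlim_real_sequentially tendsto_const) auto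
  then have ev1: "\<forall>\<^sub>F N in sequentially. R \<le> real N * d0\<^sup>2" by (simp add: filterlim_at_top)
  have "(\<lambda>N. real N / (real N - 1)) \<longlonglongrightarrow> 1" by real_asymp
  then have "\<forall>\<^sub>F N in sequentially. dist (real N / (real N - 1)) 1 < \<tau>" using \<tau> by (rule tendstoD)
  then have ev2: "\<forall>\<^sub>F N in sequentially. \<bar>real N / (real N - 1) - 1\<bar> \<le> \<tau>"
    by eventually_elim (simp add: dist_real_def)
  have "\<forall>\<^sub>F N in sequentially. \<forall>\<omega> \<theta>.
     real N * (wdist (rel_freq N \<omega>) p0)\<^sup>2 \<le> R \<longrightarrow>
     (\<forall>r<M. \<bar>(\<Sum>l<N. (xi l \<omega> r)\<^sup>2) / real N - xi_var r\<bar> \<le> \<tau>) \<longrightarrow>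
     (Ex (phi_minimiser \<phi>2 (rel_freq N \<omega>)) \<longrightarrow> phi_minimiser \<phi>2 (rel_freq N \<omega>) \<theta>) \<longrightarrow>
     \<bar>div_stat \<phi>1 \<theta> N \<omega> / design_estimate (pm \<theta>) N \<omega> - chi_stat N \<omega>\<bar> \<le> \<epsilon>"
    using ev1 ev2 eventually_gt_at_top[of "1::nat"]
  proof eventually_elim
    case (elim N)
    show ?case
    proof (intro allI impI)
      fix \<omega> \<theta>
      assume wR: "real N * (wdist (rel_freq N \<omega>) p0)\<^sup>2 \<le> R"
        and avg: "\<forall>r<M. \<bar>(\<Sum>l<N. (xi l \<omega> r)\<^sup>2) / real N - xi_var r\<bar> \<le> \<tau>"
        and min: "Ex (phi_minimiser \<phi>2 (rel_freq N \<omega>)) \<longrightarrow> phi_minimiser \<phi>2 (rel_freq N \<omega>) \<theta>"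
      define p where "p = rel_freq N \<omega>"
      have N: "N > 0" using elim by simp
      have "real N * (wdist p p0)\<^sup>2 \<le> real N * d0\<^sup>2" using wR elim(1) by (simp add: p_def)
      then have "(wdist p p0)\<^sup>2 \<le> d0\<^sup>2" using N by simp
      then have w: "wdist p p0 \<le> d0" by (rule power2_le_imp_le) (use d0 in simp)
      have p1: "(\<Sum>r<M. p r) = 1" unfolding p_def by (rule rel_freq_sum[OF N])
      have pos: "p r > 0" if "r < M" for r using near_p0(1)[OF _ that] w d0_le(4) by simp
      have div: "phi_div M \<phi> p (pm \<theta>) = ereal (real_phi_div M \<phi> p (pm \<theta>))" for \<phi> \<theta>
        using pos pm_pos by (intro phi_div_eq_real) auto
      have "\<exists>\<theta>. \<forall>\<theta>'. real_phi_div M \<phi>2 p (pm \<theta>) \<le> real_phi_div M \<phi>2 p (pm \<theta>')"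
        using ex[OF p1] w d0_le(1) by simp
      moreover have pm_iff: "phi_minimiser \<phi>2 p \<theta>1 \<longleftrightarrow>
          (\<forall>\<theta>'. real_phi_div M \<phi>2 p (pm \<theta>1) \<le> real_phi_div M \<phi>2 p (pm \<theta>'))" for \<theta>1
        by (simp add: phi_minimiser_def div)
      ultimately have "Ex (phi_minimiser \<phi>2 p)" by blast
      then have mn: "\<forall>\<theta>'. real_phi_div M \<phi>2 p (pm \<theta>) \<le> real_phi_div M \<phi>2 p (pm \<theta>')"
        using min unfolding p_def[symmetric] pm_iff[symmetric] by blast
      have k: "\<bar>2 / deriv (deriv \<phi>1) 1 * real_phi_div M \<phi>1 p (pm \<theta>) - defect p\<bar> \<le> \<epsilon>2 * (wdist p p0)\<^sup>2"
        using key[OF p1 _ mn] w d0_le(2) by simp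
      have "wdist (pm \<theta>) p0 \<le> C * wdist p p0" using near[OF p1] w d0_le(3) mn by simp
      also have "\<dots> \<le> C * (\<tau> / C)" using w d0_le(6) C by (intro mult_left_mono) auto
      also have "\<dots> = \<tau>" using C by simp
      finally have q: "wdist (pm \<theta>) p0 \<le> \<tau>" .
      define V where "V = design_estimate (pm \<theta>) N \<omega>"
      have V: "\<bar>V - design\<bar> \<le> \<epsilon>1"
        unfolding V_def using elim w d0_le(5) q avg by (intro des) (auto simp: p_def)
      define T where "T = div_stat \<phi>1 \<theta> N \<omega>"
      define Q where "Q = chi_stat N \<omega>"
      have dQ: "design * Q = real n * real N * defect p" unfolding Q_def p_def by (rule chi_stat_eq[OF N])
      have "T - design * Q = (real n * real N) * (2 / deriv (deriv \<phi>1) 1 * real_phi_div M \<phi>1 p (pm \<theta>) - defect p)"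
        unfolding dQ T_def div_stat_def p_def[symmetric] div by (simp add: algebra_simps)
      then have "\<bar>T - design * Q\<bar> = (real n * real N) * \<bar>2 / deriv (deriv \<phi>1) 1 * real_phi_div M \<phi>1 p (pm \<theta>) - defect p\<bar>"
        by (simp only: abs_mult abs_of_nat)
      also have "\<dots> \<le> (real n * real N) * (\<epsilon>2 * (wdist p p0)\<^sup>2)" using k by (intro mult_left_mono) auto
      also have "\<dots> = (real n * \<epsilon>2) * (real N * (wdist p p0)\<^sup>2)" by simp
      also have "\<dots> \<le> (real n * \<epsilon>2) * R" using wR \<epsilon>2 np by (intro mult_left_mono) (auto simp: p_def)
      also have "\<dots> = \<epsilon>1" using np R by (simp add: \<epsilon>2_def)
      finally have TQ: "\<bar>T - design * Q\<bar> \<le> \<epsilon>1" .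
      have Q0: "0 \<le> Q" by (simp add: Q_def chi_stat_def sum_nonneg)
      have "design * Q \<le> real n * (real N * (wdist p p0)\<^sup>2)"
        unfolding dQ using defect_le[of p] by (simp add: mult.assoc mult_left_mono)
      also have "\<dots> \<le> real n * R" using wR by (intro mult_left_mono) (auto simp: p_def)
      finally have "Q \<le> real n * R / design" using dp by (simp add: field_simps)
      then have QB: "1 + \<bar>Q\<bar> \<le> B" using Q0 by (simp add: B_def)
      have Vp: "V \<ge> design / 2" using V \<epsilon>1(2) by linarith
      then have V0: "V > 0" using dp by linarith
      have "\<bar>T - V * Q\<bar> \<le> \<bar>T - design * Q\<bar> + \<bar>V - design\<bar> * \<bar>Q\<bar>"
      proof -
        have "T - V * Q = (T - design * Q) - (V - design) * Q" by (simp add: algebra_simps)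
        then show ?thesis by (metis abs_mult abs_triangle_ineq4)
      qed
      also have "\<dots> \<le> \<epsilon>1 + \<epsilon>1 * \<bar>Q\<bar>" using TQ V by (intro add_mono mult_right_mono) auto
      also have "\<dots> = \<epsilon>1 * (1 + \<bar>Q\<bar>)" by (simp add: algebra_simps)
      also have "\<dots> \<le> \<epsilon>1 * B" using QB \<epsilon>1 by (intro mult_left_mono) auto
      also have "\<dots> \<le> \<epsilon> * (design / 2)" by (rule \<epsilon>1(3))
      also have "\<dots> \<le> \<epsilon> * V" using Vp \<epsilon> by (intro mult_left_mono) auto
      finally have "\<bar>T - V * Q\<bar> / V \<le> \<epsilon>" using V0 by (simp add: field_simps)
      moreover have "T / V - Q = (T - V * Q) / V" using V0 by (simp add: field_simps)
      ultimately have "\<bar>T / V - Q\<bar> \<le> \<epsilon>" using V0 by simp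
      then show "\<bar>div_stat \<phi>1 \<theta> N \<omega> / design_estimate (pm \<theta>) N \<omega> - chi_stat N \<omega>\<bar> \<le> \<epsilon>"
        unfolding T_def V_def Q_def .
    qed
  qed
  then show ?thesis using \<tau> by blast
qed

section \<open>Measurability, and the limit theorem for the ratio\<close>

lemma measurable_pm:
  assumes "\<And>j. (\<lambda>\<omega>. \<theta> \<omega> j) \<in> borel_measurable P"
  shows "(\<lambda>\<omega>. pm (\<theta> \<omega>) r) \<in> borel_measurable P"
  unfolding loglin_p_def using assms by measurable

lemma measurable_design_estimate:
  assumes [measurable]: "\<And>r. (\<lambda>\<omega>. q \<omega> r) \<in> borel_measurable P"
  shows "(\<lambda>\<omega>. design_estimate (q \<omega>) N \<omega>) \<in> borel_measurable P"
  unfolding design_estimate_def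
  by (intro borel_measurable_divide borel_measurable_times borel_measurable_const borel_measurable_sum
      borel_measurable_power borel_measurable_diff measurable_Y measurable_rel_freq assms) auto

text \<open>Admissibility says nothing about \<open>\<phi>\<close> outside the positive reals, so
  measurability goes through the truncation \<open>\<psi>\<close>; a zero frequency is treated in
  its own branch.\<close>

lemma measurable_div_stat:
  assumes adm: "admissible_phi \<phi>" and m: "\<And>j. (\<lambda>\<omega>. \<theta> \<omega> j) \<in> borel_measurable P"
  shows "(\<lambda>\<omega>. div_stat \<phi> (\<theta> \<omega>) N \<omega>) \<in> borel_measurable P"
proof -
  define \<psi> where "\<psi> u = (if u \<in> {0<..} then \<phi> u else 0)" for u
  have c: "continuous_on {0<..} \<phi>"
    using admissible_DERIV(1)[OF adm] by (intro DERIV_continuous_on) (auto intro: has_field_derivative_at_within)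
  have [measurable]: "\<psi> \<in> borel_measurable borel"
    unfolding \<psi>_def by (rule borel_measurable_continuous_on_if) (use c in \<open>auto intro: continuous_intros\<close>)
  have q[measurable]: "(\<lambda>\<omega>. pm (\<theta> \<omega>) r) \<in> borel_measurable P" for r by (rule measurable_pm[OF m])
  define summand where "summand r \<omega> = (if rel_freq N \<omega> r = 0 then ereal (pm (\<theta> \<omega>) r) * Lim (at_right 0) (\<lambda>u. ereal (\<phi> u))
              else ereal (pm (\<theta> \<omega>) r * \<psi> (rel_freq N \<omega> r / pm (\<theta> \<omega>) r)))" for r \<omega>
  have "summand r \<in> borel_measurable P" if "r < M" for r
  proof -
    note [measurable] = measurable_rel_freq[OF that]
    show ?thesis unfolding summand_def by measurable
  qed
  then have sm: "(\<lambda>\<omega>. \<Sum>r<M. summand r \<omega>) \<in> borel_measurable P" by (intro borel_measurable_ereal_sum) auto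
  have eq: "phi_div M \<phi> (rel_freq N \<omega>) (pm (\<theta> \<omega>)) = (\<Sum>r<M. summand r \<omega>)" for \<omega>
    unfolding phi_div_def
  proof (intro sum.cong refl)
    fix r
    have q: "pm (\<theta> \<omega>) r > 0" by (rule pm_pos)
    have "\<psi> (rel_freq N \<omega> r / pm (\<theta> \<omega>) r) = \<phi> (rel_freq N \<omega> r / pm (\<theta> \<omega>) r)" if "rel_freq N \<omega> r \<noteq> 0"
      using that rel_freq_nonneg[of N \<omega> r] q by (simp add: \<psi>_def)
    then show "(if pm (\<theta> \<omega>) r = 0 then (if rel_freq N \<omega> r = 0 then 0
                   else ereal (rel_freq N \<omega> r) * Lim at_top (\<lambda>u. ereal (\<phi> u / u)))
              else if rel_freq N \<omega> r = 0 then ereal (pm (\<theta> \<omega>) r) * Lim (at_right 0) (\<lambda>u. ereal (\<phi> u))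
              else ereal (pm (\<theta> \<omega>) r * \<phi> (rel_freq N \<omega> r / pm (\<theta> \<omega>) r))) = summand r \<omega>"
      using q by (simp add: summand_def)
  qed
  show ?thesis unfolding div_stat_def eq using sm by measurable
qed

theorem statistic_weak_conv:
  fixes \<theta>hat :: "nat \<Rightarrow> 'a \<Rightarrow> nat \<Rightarrow> real"
  assumes adm1: "admissible_phi \<phi>1" and adm2: "admissible_phi \<phi>2"
    and meas: "\<And>N j. (\<lambda>\<omega>. \<theta>hat N \<omega> j) \<in> borel_measurable P"
    and min: "\<And>N \<omega>. Ex (phi_minimiser \<phi>2 (rel_freq N \<omega>)) \<Longrightarrow> phi_minimiser \<phi>2 (rel_freq N \<omega>) (\<theta>hat N \<omega>)"
  shows "weak_conv_m (\<lambda>N. distr P borel (\<lambda>\<omega>. div_stat \<phi>1 (\<theta>hat N \<omega>) N \<omega> / design_estimate (pm (\<theta>hat N \<omega>)) N \<omega>))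
           (chi2_distribution K)"
proof (rule slutsky_weak_conv[OF P.prob_space_axioms measurable_chi_stat _ _ chi_stat_conv])
  let ?R = "\<lambda>N \<omega>. div_stat \<phi>1 (\<theta>hat N \<omega>) N \<omega> / design_estimate (pm (\<theta>hat N \<omega>)) N \<omega>"
  show m[measurable]: "?R N \<in> borel_measurable P" for N
    by (intro borel_measurable_divide measurable_div_stat[OF adm1] measurable_design_estimate measurable_pm meas)
  show "real_distribution (chi2_distribution K)" using M0_less by (intro real_distribution_chi2) simp
  fix \<epsilon> :: real assume \<epsilon>: "\<epsilon> > 0"
  show "(\<lambda>N. P.prob {\<omega> \<in> space P. \<epsilon> < \<bar>?R N \<omega> - chi_stat N \<omega>\<bar>}) \<longlonglongrightarrow> 0"
  proof (rule tendstoI)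
    fix \<eta> :: real assume \<eta>: "\<eta> > 0"
    \<comment> \<open>Makes the Markov bound \<open>inv_sum / R\<close> equal to
      \<open>\<eta> / 2\<close>. It is fixed before \<open>\<tau>\<close>, which depends on it; the
      events governed by \<open>\<tau>\<close> have total probability of order
      \<open>1 / N\<close>.\<close>
    define R where "R = 2 * inv_sum / \<eta>"
    have R: "R > 0" using \<eta> inv_sum_pos by (simp add: R_def)
    obtain \<tau> where \<tau>: "\<tau> > 0" and ev: "\<forall>\<^sub>F N in sequentially. \<forall>\<omega> \<theta>.
       real N * (wdist (rel_freq N \<omega>) p0)\<^sup>2 \<le> R \<longrightarrow>
       (\<forall>r<M. \<bar>(\<Sum>l<N. (xi l \<omega> r)\<^sup>2) / real N - xi_var r\<bar> \<le> \<tau>) \<longrightarrow>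
       (Ex (phi_minimiser \<phi>2 (rel_freq N \<omega>)) \<longrightarrow> phi_minimiser \<phi>2 (rel_freq N \<omega>) \<theta>) \<longrightarrow>
       \<bar>div_stat \<phi>1 \<theta> N \<omega> / design_estimate (pm \<theta>) N \<omega> - chi_stat N \<omega>\<bar> \<le> \<epsilon>"
      using statistic_close[OF adm1 adm2 \<epsilon> R] by blast
    define c where "c = (\<Sum>r<M. (1 + \<bar>xi_var r\<bar>)\<^sup>2 / \<tau>\<^sup>2)"
    have "(\<lambda>N. c / real N) \<longlonglongrightarrow> 0" by real_asymp
    then have "\<forall>\<^sub>F N in sequentially. c / real N < \<eta> / 2" using \<eta> by (intro order_tendstoD) auto
    with ev eventually_gt_at_top[of "0::nat"]
    show "\<forall>\<^sub>F N in sequentially. dist (P.prob {\<omega> \<in> space P. \<epsilon> < \<bar>?R N \<omega> - chi_stat N \<omega>\<bar>}) 0 < \<eta>"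
    proof eventually_elim
      case (elim N)
      define A where "A = {\<omega> \<in> space P. R \<le> real N * (wdist (rel_freq N \<omega>) p0)\<^sup>2}"
      define B where "B r = {\<omega> \<in> space P. \<tau> \<le> \<bar>(\<Sum>l<N. (xi l \<omega> r)\<^sup>2) / real N - xi_var r\<bar>}" for r
      have "(\<lambda>\<omega>. (wdist (rel_freq N \<omega>) p0)\<^sup>2) \<in> borel_measurable P"
        unfolding wdist_sq
        by (intro borel_measurable_sum borel_measurable_divide borel_measurable_power borel_measurable_diff measurable_rel_freq) auto
      then have A: "A \<in> sets P" unfolding A_def by measurable
      have B: "B r \<in> sets P" if "r < M" for r
        using measurable_xi[OF that] unfolding B_def by measurable
      have "{\<omega> \<in> space P. \<epsilon> < \<bar>?R N \<omega> - chi_stat N \<omega>\<bar>} \<subseteq> A \<union> (\<Union>r<M. B r)"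
      proof (rule subsetI, rule ccontr)
        fix \<omega> assume \<omega>: "\<omega> \<in> {\<omega> \<in> space P. \<epsilon> < \<bar>?R N \<omega> - chi_stat N \<omega>\<bar>}" and n: "\<omega> \<notin> A \<union> (\<Union>r<M. B r)"
        have "real N * (wdist (rel_freq N \<omega>) p0)\<^sup>2 \<le> R" using \<omega> n by (auto simp: A_def)
        moreover have "\<forall>r<M. \<bar>(\<Sum>l<N. (xi l \<omega> r)\<^sup>2) / real N - xi_var r\<bar> \<le> \<tau>"
          using \<omega> n unfolding B_def by (auto simp: not_le intro: less_imp_le)
        ultimately have "\<bar>?R N \<omega> - chi_stat N \<omega>\<bar> \<le> \<epsilon>" using elim(1) min by blast
        then show False using \<omega> by simp
      qed
      then have "P.prob {\<omega> \<in> space P. \<epsilon> < \<bar>?R N \<omega> - chi_stat N \<omega>\<bar>} \<le> P.prob (A \<union> (\<Union>r<M. B r))"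
        using A B by (intro P.finite_measure_mono) auto
      also have "\<dots> \<le> P.prob A + P.prob (\<Union>r<M. B r)" using A B by (intro measure_Un_le) auto
      finally have 1: "P.prob {\<omega> \<in> space P. \<epsilon> < \<bar>?R N \<omega> - chi_stat N \<omega>\<bar>} \<le> P.prob A + P.prob (\<Union>r<M. B r)" .
      have "P.prob (\<Union>r<M. B r) \<le> (\<Sum>r<M. P.prob (B r))"
        using B by (intro measure_UNION_le) auto
      also have "\<dots> \<le> (\<Sum>r<M. (1 + \<bar>xi_var r\<bar>)\<^sup>2 / \<tau>\<^sup>2 / real N)"
        unfolding B_def using elim(2) \<tau> by (intro sum_mono xi_sq_tail) auto
      also have "\<dots> = c / real N" by (simp add: c_def sum_divide_distrib)
      finally have 2: "P.prob (\<Union>r<M. B r) < \<eta> / 2" using elim(3) by linarith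
      have "P.prob A \<le> inv_sum / R" unfolding A_def by (rule wdist_rel_freq_tail[OF elim(2) R])
      also have "inv_sum / R = \<eta> / 2" using \<eta> inv_sum_pos by (simp add: R_def)
      finally show ?case using 1 2 by (simp add: dist_real_def)
    qed
  qed
qed

end

theorem theorem3:
  fixes P :: "'a measure"
    and M M0 n :: nat
    and W :: "nat \<Rightarrow> nat \<Rightarrow> real"
    and \<theta>0 :: "nat \<Rightarrow> real"
    and \<rho>2 :: real
    and Y :: "nat \<Rightarrow> 'a \<Rightarrow> nat \<Rightarrow> nat"
    and \<phi>1 \<phi>2 :: "real \<Rightarrow> real"
    and \<theta>hat :: "nat \<Rightarrow> 'a \<Rightarrow> nat \<Rightarrow> real"
    and phat :: "nat \<Rightarrow> 'a \<Rightarrow> nat \<Rightarrow> real"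
    and X2 :: "nat \<Rightarrow> 'a \<Rightarrow> real"
    and vartheta_tilde :: "nat \<Rightarrow> 'a \<Rightarrow> real"
    and T :: "nat \<Rightarrow> 'a \<Rightarrow> real"
  assumes prob: "prob_space P"
    and M3: "M \<ge> 3" and M0pos: "1 \<le> M0" and M0M: "M0 < M - 1"
    and W_indep: "\<And>(a::real) (c::nat \<Rightarrow> real).
         (\<forall>r<M. a + (\<Sum>j<M0. W r j * c j) = 0) \<Longrightarrow> a = 0 \<and> (\<forall>j<M0. c j = 0)"
    and n2: "n \<ge> 2"
    and rho2: "\<rho>2 \<ge> 0"
    and Y_sum: "\<And>l \<omega>. (\<Sum>r<M. Y l \<omega> r) = n"
    and Y_indep: "prob_space.indep_vars P (\<lambda>_. Pi\<^sub>M {..<M} (\<lambda>_. count_space UNIV))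
                    (\<lambda>l \<omega>. restrict (Y l \<omega>) {..<M}) UNIV"
    and Y_ident: "\<And>l. distr P (Pi\<^sub>M {..<M} (\<lambda>_. count_space UNIV)) (\<lambda>\<omega>. restrict (Y l \<omega>) {..<M})
                      = distr P (Pi\<^sub>M {..<M} (\<lambda>_. count_space UNIV)) (\<lambda>\<omega>. restrict (Y 0 \<omega>) {..<M})"
    and Y_mean: "\<And>l r. r < M \<Longrightarrow>
         integral\<^sup>L P (\<lambda>\<omega>. real (Y l \<omega> r)) = real n * loglin_p M M0 W \<theta>0 r"
    and Y_var: "\<And>l r s. r < M \<Longrightarrow> s < M \<Longrightarrow>
         integral\<^sup>L P (\<lambda>\<omega>. (real (Y l \<omega> r) - real n * loglin_p M M0 W \<theta>0 r) *
                            (real (Y l \<omega> s) - real n * loglin_p M M0 W \<theta>0 s))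
         = (1 + (real n - 1) * \<rho>2) * real n *
           ((if r = s then loglin_p M M0 W \<theta>0 r else 0)
            - loglin_p M M0 W \<theta>0 r * loglin_p M M0 W \<theta>0 s)"
    and adm1: "admissible_phi \<phi>1" and adm2: "admissible_phi \<phi>2"
    and phat_def: "\<And>N \<omega> r. phat N \<omega> r = (\<Sum>l<N. real (Y l \<omega> r)) / (real n * real N)"
    and \<theta>hat_meas: "\<And>N j. (\<lambda>\<omega>. \<theta>hat N \<omega> j) \<in> borel_measurable P"
    and \<theta>hat_min: "\<And>N \<omega>. (\<exists>\<theta>. \<forall>\<theta>'. phi_div M \<phi>2 (phat N \<omega>) (loglin_p M M0 W \<theta>)
                                         \<le> phi_div M \<phi>2 (phat N \<omega>) (loglin_p M M0 W \<theta>')) \<Longrightarrow>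
         (\<forall>\<theta>'. phi_div M \<phi>2 (phat N \<omega>) (loglin_p M M0 W (\<theta>hat N \<omega>))
                 \<le> phi_div M \<phi>2 (phat N \<omega>) (loglin_p M M0 W \<theta>'))"
    and X2_def: "\<And>N \<omega>. X2 N \<omega> = real n * (\<Sum>l<N. \<Sum>r<M.
                   (real (Y l \<omega> r) / real n - phat N \<omega> r)\<^sup>2 / loglin_p M M0 W (\<theta>hat N \<omega>) r)"
    and vt_def: "\<And>N \<omega>. vartheta_tilde N \<omega> = X2 N \<omega> / ((real N - 1) * (real M - 1))"
    and T_def: "\<And>N \<omega>. T N \<omega> = 2 * real n * real N / deriv (deriv \<phi>1) 1 *
                   real_of_ereal (phi_div M \<phi>1 (phat N \<omega>) (loglin_p M M0 W (\<theta>hat N \<omega>)))"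
  shows "weak_conv_m (\<lambda>N. distr P borel (\<lambda>\<omega>. T N \<omega> / vartheta_tilde N \<omega>))
                     (chi2_distribution (M - M0 - 1))"
proof -
  interpret LM: loglinear_model M M0 W \<theta>0
    by unfold_locales (use M0M W_indep in auto)
  obtain e b where LF: "loglinear_frame M M0 W \<theta>0 e b" using LM.loglinear_frame_exists by blast
  interpret CS: cluster_sample M M0 W \<theta>0 e b P n \<rho>2 Y
    by (intro cluster_sample.intro LF prob cluster_sample_axioms.intro)
       (use n2 rho2 Y_sum Y_indep Y_ident Y_mean Y_var in auto)
  have ph: "phat N \<omega> = CS.rel_freq N \<omega>" for N \<omega>
    by (auto simp: phat_def CS.rel_freq_def)
  have min: "CS.phi_minimiser \<phi>2 (CS.rel_freq N \<omega>) (\<theta>hat N \<omega>)"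
    if "Ex (CS.phi_minimiser \<phi>2 (CS.rel_freq N \<omega>))" for N \<omega>
    using \<theta>hat_min[of N \<omega>] that unfolding CS.phi_minimiser_def[abs_def] ph by blast
  have "weak_conv_m (\<lambda>N. distr P borel (\<lambda>\<omega>. CS.div_stat \<phi>1 (\<theta>hat N \<omega>) N \<omega> /
           CS.design_estimate (loglin_p M M0 W (\<theta>hat N \<omega>)) N \<omega>)) (chi2_distribution (M - Suc M0))"
    by (rule CS.statistic_weak_conv[OF adm1 adm2 \<theta>hat_meas min])
  moreover have "T N \<omega> / vartheta_tilde N \<omega> = CS.div_stat \<phi>1 (\<theta>hat N \<omega>) N \<omega> /
           CS.design_estimate (loglin_p M M0 W (\<theta>hat N \<omega>)) N \<omega>" for N \<omega>
    by (simp add: T_def vt_def X2_def ph CS.div_stat_def CS.design_estimate_def)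
  ultimately show ?thesis by simp
qed

end
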